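(* Let $0<r\leq \infty$ and $1\leq p,q \leq \infty$ satisfy $\frac 1 r = \frac 1 q + \frac 1 p$. Let $a \in L^p S^m_\varrho$ with $0\leq \varrho \leq 1$ and \[ m < \frac{n(\varrho-1)}{\min(2,p,q)}. \] Then the pseudodifferential operator $T_a f(x)=\int_{\mathbb{R}^n} a(x,\xi)\, e^{i\langle x,\xi\rangle}\, \widehat{f}(\xi)\,d\xi$, $f\in\mathcal{S}(\mathbb{R}^n)$, is bounded from $L^q$ to $L^r$.
   Context: $\langle\xi\rangle=(1+|\xi|^2)^{1/2}$. For $1\le p\le\infty$, $m\in\mathbb{R}$, $0\le\varrho\le1$, the class $L^pS^m_\varrho$ consists of functions $a(x,\xi)$, $x,\xi\in\mathbb{R}^n$, measurable in $x$, with $a(x,\cdot)\in C^\infty(\mathbb{R}^n)$ for a.e. $x$, such that for every multi-index $\alpha$ there is $C_\alpha$ with $\|\partial_\xi^\alpha a(\cdot,\xi)\|_{L^p(\mathbb{R}^n)}\le C_\alpha\langle\xi\rangle^{m-\varrho|\alpha|}$ for all $\xi$. *)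

theory Defs
  imports "HOL-Analysis.Analysis"
begin

definition jbr :: "'n::euclidean_space \<Rightarrow> real" where
  "jbr \<xi> = sqrt (1 + norm \<xi> ^ 2)"

text \<open>Partial derivative in the direction of a basis vector, and iterated partial
  derivatives along a list of basis vectors (a multi-index; its order is |alpha| = length).\<close>
definition pdir :: "'n::euclidean_space \<Rightarrow> ('n \<Rightarrow> complex) \<Rightarrow> 'n \<Rightarrow> complex" where
  "pdir b f x = frechet_derivative f (at x) b"

primrec dpart :: "'n::euclidean_space list \<Rightarrow> ('n \<Rightarrow> complex) \<Rightarrow> 'n \<Rightarrow> complex" where
  "dpart [] f = f"
| "dpart (b # ds) f = pdir b (dpart ds f)"

definition smooth_fun :: "('n::euclidean_space \<Rightarrow> complex) \<Rightarrow> bool" where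
  "smooth_fun f \<longleftrightarrow> (\<forall>ds. set ds \<subseteq> Basis \<longrightarrow> (\<forall>x. dpart ds f differentiable (at x)))"

definition schwartz :: "('n::euclidean_space \<Rightarrow> complex) \<Rightarrow> bool" where
  "schwartz f \<longleftrightarrow> smooth_fun f \<and>
     (\<forall>ds (N::nat). set ds \<subseteq> Basis \<longrightarrow>
        (\<exists>C. \<forall>x. (1 + norm x) ^ N * norm (dpart ds f x) \<le> C))"

definition Lnorm :: "ennreal \<Rightarrow> ('n::euclidean_space \<Rightarrow> complex) \<Rightarrow> ennreal" where
  "Lnorm p f =
     (if p = top then Inf {c. AE x in lebesgue. ennreal (norm (f x)) \<le> c}
      else (let I = (\<integral>\<^sup>+ x. ennreal (norm (f x) powr enn2real p) \<partial>lebesgue)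
            in if I = top then top else ennreal (enn2real I powr (1 / enn2real p))))"

definition LpS :: "ennreal \<Rightarrow> real \<Rightarrow> real \<Rightarrow> ('n::euclidean_space \<Rightarrow> 'n \<Rightarrow> complex) \<Rightarrow> bool" where
  "LpS p m \<rho> a \<longleftrightarrow>
     (\<forall>\<xi>. (\<lambda>x. a x \<xi>) \<in> borel_measurable lebesgue) \<and>
     (AE x in lebesgue. smooth_fun (a x)) \<and>
     (\<forall>ds. set ds \<subseteq> Basis \<longrightarrow>
        (\<exists>C::real. \<forall>\<xi>. Lnorm p (\<lambda>x. dpart ds (a x) \<xi>)
                        \<le> ennreal (C * jbr \<xi> powr (m - \<rho> * real (length ds)))))"

text \<open>Fourier transform (normalisation constants are irrelevant for boundedness).\<close>
definition fourier :: "('n::euclidean_space \<Rightarrow> complex) \<Rightarrow> 'n \<Rightarrow> complex" where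
  "fourier f \<xi> = (LINT x|lebesgue. cis (- (x \<bullet> \<xi>)) * f x)"

definition psido :: "('n::euclidean_space \<Rightarrow> 'n \<Rightarrow> complex) \<Rightarrow> ('n \<Rightarrow> complex) \<Rightarrow> 'n \<Rightarrow> complex" where
  "psido a f x = (LINT \<xi>|lebesgue. a x \<xi> * cis (x \<bullet> \<xi>) * fourier f \<xi>)"

end

theory Submission
  imports Defs "HOL-Complex_Analysis.Complex_Analysis"
begin

text \<open>The threshold for \<open>m\<close> is a count of exponents. At frequency 2^j the symbol
  has L^s mass 2^(j (m + n/s)) in \<xi>. Each derivative gains 2^(-j \<rho>), so the kernel lives at
  distance 2^(-j \<rho>) from the diagonal, and the weighted average of \<open>f\<close> on that
  scale gains 2^(-j \<rho> n/s). The product decays geometrically exactly when m < n (\<rho> - 1) /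
  s. As \<rho> - 1 is at most 0, a larger \<open>s\<close> is better; Hausdorff--Young caps it at 2
  and the two Minkowski steps cap it at \<open>p\<close> and \<open>q\<close>, whence the minimum.

  Two choices keep the Fourier analysis elementary. Only pure derivatives along basis vectors occur,
  so every derivative of a cutoff is a derivative in one complex variable. Hausdorff--Young is then
  real interpolation between the L^1 and L^2 bounds, in a bilinear form free of conjugate
  exponents.\<close>

text \<open>
  Let \<open>s = min 2 p q\<close> and \<open>n\<close> the dimension. The symbol is cut into dyadic frequency pieces \<open>a\<^sub>j\<close> living at
  \<open>|\<xi>| ~ 2\<^sup>j\<close>, so that \<open>T a\<^sub>j f (x) = \<integral> K\<^sub>j (x, z) f (x - z) dz\<close> with \<open>K\<^sub>j (x, z)\<close> the Fourier transform of
  \<open>a\<^sub>j (x, \<cdot>)\<close>. The Hausdorff--Young inequality with exponent \<open>s\<close>, applied to \<open>a\<^sub>j\<close> and its derivatives of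
  order \<open>n + 1\<close>, and Hoelder's inequality with the weight \<open>1 + |2 powr (j \<rho>) z| ^ (n + 1)\<close> bound the piece
  pointwise by \<open>A\<^sub>j (x) F\<^sub>j (x)\<close>, where \<open>A\<^sub>j\<close> is an \<open>L\<^sup>s\<close> norm in \<open>\<xi>\<close> of derivatives of the symbol and \<open>F\<^sub>j\<close>
  a weighted \<open>L\<^sup>s\<close> average of \<open>f\<close> around \<open>x\<close>. The strict inequality for \<open>m\<close> leaves a factor \<open>2 powr (- 3 \<delta> j)\<close>.
  One part of it makes a single function \<open>A\<close> dominate all \<open>A\<^sub>j\<close>, one part a single \<open>F\<close> dominate
  all \<open>F\<^sub>j\<close>, and the rest is summed, whence \<open>|T a f| \<le> C A F\<close>
  pointwise; no triangle inequality in \<open>L\<^sup>r\<close> with \<open>r < 1\<close> is needed. Minkowski's inequality gives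
  \<open>A \<in> L\<^sup>p\<close> (as \<open>s \<le> p\<close>) and \<open>\<parallel>F\<parallel>\<^sub>q \<le> C \<parallel>f\<parallel>\<^sub>q\<close> (as \<open>s \<le> q\<close>), and Hoelder's inequality concludes.
\<close>

section \<open>Japanese brackets and polynomial weights\<close>

lemma jbr_ge_one: "1 \<le> jbr x"
  by (simp add: jbr_def)

lemma jbr_pos [simp]: "0 < jbr x"
  using jbr_ge_one[of x] by linarith

lemma norm_le_jbr: "norm x \<le> jbr x"
  by (simp add: jbr_def real_le_rsqrt)

lemma jbr_le_one_plus_norm: "jbr x \<le> 1 + norm x"
  unfolding jbr_def by (rule real_le_lsqrt) (auto simp: power2_eq_square algebra_simps)

lemma jbr_square: "jbr x ^ 2 = 1 + norm x ^ 2"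
  by (simp add: jbr_def)

lemma borel_measurable_jbr [measurable]: "jbr \<in> borel_measurable borel"
  unfolding jbr_def[abs_def] by measurable

text \<open>The integrand is dominated by a sum of 2^(-k \<tau>) times indicators of balls of radius
  2^k. Their volumes grow like 2^(k n), which leaves a geometric series of ratio 2^(n - \<tau>) <
  1.\<close>

lemma nn_integral_jbr_powr_finite:
  assumes "\<tau> > real DIM('n::euclidean_space)"
  shows "(\<integral>\<^sup>+ x. ennreal (jbr x powr (-\<tau>)) \<partial>(lborel :: 'n measure)) < \<infinity>"
proof -
  define c where "c k = 2 powr \<tau> * 2 powr (- real k * \<tau>)" for k :: nat
  define V where "V = unit_ball_vol (real DIM('n))"
  have pt: "ennreal (jbr x powr (-\<tau>)) \<le> (\<Sum>k. ennreal (c k) * indicator (cball 0 (2^k)) x)" for x :: 'n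
  proof -
    obtain k0 :: nat where "norm x < 2 ^ k0"
      using real_arch_pow[of 2 "norm x"] by auto
    then have ex: "\<exists>k. norm x \<le> 2^k" by (auto intro: less_imp_le)
    define k where "k = (LEAST k. norm x \<le> 2^k)"
    have k: "norm x \<le> 2^k" unfolding k_def by (rule LeastI_ex[OF ex])
    have tau: "0 < \<tau>" using assms by (simp add: order_le_less_trans[OF of_nat_0_le_iff])
    \<comment> \<open>Minimality of \<open>k\<close> gives the lower bound 2^(k - 1) for the norm;
      for k = 0 the bracket itself is at least 1. The shift by 1 is the factor
      \<open>2 powr \<tau>\<close> in \<open>c\<close>.\<close>
    have "2 powr (real k - 1) \<le> jbr x"
    proof (cases k)
      case 0
      then show ?thesis using jbr_ge_one[of x] by (simp add: powr_minus powr_def) 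
         (smt (verit) exp_gt_zero exp_ln_iff exp_minus jbr_ge_one ln_ge_zero exp_le_one_iff ln_gt_zero)
    next
      case (Suc l)
      have "\<not> norm x \<le> 2^l"
        using not_less_Least[of l "\<lambda>k. norm x \<le> 2^k"] Suc k_def by auto
      then show ?thesis using norm_le_jbr[of x] Suc by (simp add: powr_realpow)
    qed
    then have "jbr x powr (-\<tau>) \<le> (2 powr (real k - 1)) powr (-\<tau>)"
      using tau by (intro powr_mono2') auto
    also have "\<dots> = c k" unfolding c_def powr_powr powr_add[symmetric] by (simp add: algebra_simps)
    finally have "ennreal (jbr x powr (-\<tau>)) \<le> ennreal (c k) * indicator (cball 0 (2^k)) x"
      using k by (simp add: ennreal_leI)
    also have "\<dots> = (\<Sum>i\<in>{k}. ennreal (c i) * indicator (cball 0 (2^i)) x)"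
      by (simp only: sum.insert[OF finite.emptyI] empty_iff not_False_eq_True sum.empty add_0_right)
    also have "\<dots> \<le> (\<Sum>i. ennreal (c i) * indicator (cball 0 (2^i)) x)"
      by (rule sum_le_suminf) auto
    finally show ?thesis .
  qed
  define r where "r = 2 powr (real DIM('n) - \<tau>)"
  have r: "0 \<le> r" "r < 1" using assms by (auto simp: r_def powr_less_one)
  have tm: "c k * (V * (2^k)^DIM('n)) = (2 powr \<tau> * V) * r ^ k" for k
  proof -
    have "r ^ k = 2 powr (real k * (real DIM('n) - \<tau>))"
      unfolding r_def by (subst powr_realpow[symmetric], simp) (simp only: powr_powr mult.commute)
    also have "\<dots> = 2 powr (- real k * \<tau>) * (2^k)^DIM('n)"
      by (subst powr_realpow[symmetric], simp)+
        (simp add: powr_powr powr_add[symmetric] algebra_simps powr_realpow[symmetric])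
    finally show ?thesis by (simp add: c_def)
  qed
  have [measurable]: "cball (0::'n) (2^k) \<in> sets borel" for k :: nat by simp
  have "(\<integral>\<^sup>+ x. ennreal (jbr x powr (-\<tau>)) \<partial>(lborel :: 'n measure))
      \<le> (\<integral>\<^sup>+ x. (\<Sum>k. ennreal (c k) * indicator (cball 0 (2^k)) x) \<partial>(lborel :: 'n measure))"
    by (rule nn_integral_mono) (rule pt)
  also have "\<dots> = (\<Sum>k. (\<integral>\<^sup>+ x. ennreal (c k) * indicator (cball 0 (2^k)) x \<partial>(lborel :: 'n measure)))"
    by (rule nn_integral_suminf) measurable
  also have "\<dots> = (\<Sum>k. ennreal (c k * (V * (2^k)^DIM('n))))"
    by (simp add: nn_integral_cmult_indicator emeasure_cball V_def ennreal_mult c_def)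
  also have "\<dots> = (\<Sum>k. ennreal ((2 powr \<tau> * V) * r ^ k))"
    by (simp only: tm)
  also have "\<dots> < \<infinity>"
  proof -
    have "summable (\<lambda>k. (2 powr \<tau> * V) * r ^ k)" using r by (intro summable_mult summable_geometric) auto
    moreover have "0 \<le> V" by (simp add: V_def)
    ultimately show ?thesis
      using r by (subst suminf_ennreal2) auto
  qed
  finally show ?thesis .
qed

lemma nn_integral_lborel_affine:
  fixes h :: "'n::euclidean_space \<Rightarrow> ennreal"
  assumes [measurable]: "h \<in> borel_measurable borel" and "c \<noteq> 0"
  shows "(\<integral>\<^sup>+ x. h (t + c *\<^sub>R x) \<partial>lborel) = ennreal (1 / \<bar>c\<bar> ^ DIM('n)) * (\<integral>\<^sup>+ x. h x \<partial>lborel)"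
proof -
  have "(\<integral>\<^sup>+ x. h x \<partial>lborel) = ennreal (\<bar>c\<bar> ^ DIM('n)) * (\<integral>\<^sup>+ x. h (t + c *\<^sub>R x) \<partial>lborel)"
    by (subst lborel_affine[OF assms(2), of t])
      (simp add: nn_integral_density nn_integral_distr nn_integral_cmult)
  then show ?thesis using assms(2)
    by (simp add: mult.assoc[symmetric] ennreal_mult[symmetric] divide_simps)
qed

text \<open>Comparable with (1 + R |y|)^(n + 1), but written with pure coordinate powers: each of
  them, multiplied with a Fourier transform, is the modulus of the transform of an iterated
  derivative along one basis vector. The exponent n + 1 is the least integer for which
  \<open>1 / wt R\<close> is integrable.\<close>

definition wt :: "real \<Rightarrow> 'n::euclidean_space \<Rightarrow> real" where
  "wt R y = 1 + (\<Sum>b\<in>Basis. (R * \<bar>y \<bullet> b\<bar>) ^ Suc DIM('n))"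

lemma borel_measurable_wt [measurable]: "wt R \<in> borel_measurable borel"
  unfolding wt_def[abs_def] by measurable

lemma wt_ge_one: "R \<ge> 0 \<Longrightarrow> 1 \<le> wt R y"
  by (simp add: wt_def sum_nonneg)

text \<open>The bracket is at most n + 1 times the larger of 1 and the greatest coordinate, and the
  power of that maximum is bounded by a single summand of \<open>wt 1\<close>.\<close>

lemma jbr_le_wt:
  "jbr y ^ Suc DIM('n) \<le> real (Suc DIM('n)) ^ Suc DIM('n) * wt 1 (y::'n::euclidean_space)"
proof -
  define M where "M = Max (insert 1 ((\<lambda>b. \<bar>y \<bullet> b\<bar>) ` Basis))"
  have M1: "1 \<le> M" unfolding M_def by (rule Max_ge) auto
  have Mb: "\<bar>y \<bullet> b\<bar> \<le> M" if "b \<in> Basis" for b unfolding M_def using that by (intro Max_ge) auto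
  have "jbr y \<le> 1 + norm y" by (rule jbr_le_one_plus_norm)
  also have "norm y \<le> (\<Sum>b\<in>Basis. \<bar>y \<bullet> b\<bar>)" by (rule norm_le_l1)
  also have "\<dots> \<le> (\<Sum>b\<in>(Basis::'n set). M)" by (intro sum_mono Mb)
  also have "1 + \<dots> \<le> real (Suc DIM('n)) * M" using M1 by (simp add: algebra_simps)
  finally have "jbr y ^ Suc DIM('n) \<le> (real (Suc DIM('n)) * M) ^ Suc DIM('n)"
    by (intro power_mono) (auto intro: less_imp_le)
  also have "\<dots> = real (Suc DIM('n)) ^ Suc DIM('n) * M ^ Suc DIM('n)" by (rule power_mult_distrib)
  also have "M ^ Suc DIM('n) \<le> wt 1 y"
  proof -
    have "M \<in> insert 1 ((\<lambda>b. \<bar>y \<bullet> b\<bar>) ` Basis)" unfolding M_def by (rule Max_in) auto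
    then show ?thesis
    proof
      assume "M = 1" then show ?thesis using wt_ge_one[of 1 y] by simp
    next
      assume "M \<in> (\<lambda>b. \<bar>y \<bullet> b\<bar>) ` Basis"
      then obtain b where b: "b \<in> Basis" "M = \<bar>y \<bullet> b\<bar>" by auto
      have "M ^ Suc DIM('n) \<le> (\<Sum>b\<in>Basis. \<bar>y \<bullet> b\<bar> ^ Suc DIM('n))"
        unfolding b(2) by (rule member_le_sum[OF b(1)]) auto
      then show ?thesis by (simp add: wt_def)
    qed
  qed
  finally show ?thesis by simp
qed

text \<open>Dilation reduces to R = 1. The factor R^(-n), used later with R = 2^(j \<rho>), is the
  source of the term n \<rho> in the condition on \<open>m\<close>.\<close>

lemma nn_integral_inverse_wt:
  obtains C :: real where "C \<ge> 0"
    "\<And>R. R > 0 \<Longrightarrow> (\<integral>\<^sup>+ y. ennreal (1 / wt R y) \<partial>(lborel :: 'n::euclidean_space measure)) = ennreal (C / R ^ DIM('n))"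
proof -
  define I where "I = (\<integral>\<^sup>+ y. ennreal (1 / wt 1 y) \<partial>(lborel :: 'n measure))"
  define K where "K = real (Suc DIM('n)) ^ Suc DIM('n)"
  have "I \<le> (\<integral>\<^sup>+ y. ennreal K * ennreal (jbr y powr (- real (Suc DIM('n)))) \<partial>(lborel :: 'n measure))"
    unfolding I_def
  proof (rule nn_integral_mono)
    fix y :: 'n
    have p: "0 < jbr y ^ Suc DIM('n)" by simp
    have w: "0 < wt 1 y" using wt_ge_one[of 1 y] by linarith
    have "1 / wt 1 y \<le> K / jbr y ^ Suc DIM('n)"
      using jbr_le_wt[of y] p w unfolding K_def[symmetric] by (simp add: divide_simps mult.commute)
    then have "1 / wt 1 y \<le> K * jbr y powr (- real (Suc DIM('n)))"
      unfolding powr_minus powr_realpow[OF jbr_pos] by (simp add: divide_inverse)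
    then show "ennreal (1 / wt 1 y) \<le> ennreal K * ennreal (jbr y powr (- real (Suc DIM('n))))"
      by (subst ennreal_mult[symmetric]) (auto simp: K_def intro!: ennreal_leI)
  qed
  also have "\<dots> = ennreal K * (\<integral>\<^sup>+ y. ennreal (jbr y powr (- real (Suc DIM('n)))) \<partial>(lborel :: 'n measure))"
    by (rule nn_integral_cmult) measurable
  also have "\<dots> < \<infinity>"
    using nn_integral_jbr_powr_finite[where 'n='n, of "real (Suc DIM('n))"] by (simp add: ennreal_mult_less_top)
  finally have fin: "I < \<infinity>" .
  define C where "C = enn2real I"
  have C: "I = ennreal C" "C \<ge> 0" using fin by (auto simp: C_def)
  show thesis
  proof
    show "C \<ge> 0" by fact
    fix R :: real assume R: "R > 0"
    have "(\<integral>\<^sup>+ y. ennreal (1 / wt R y) \<partial>(lborel :: 'n measure)) = (\<integral>\<^sup>+ y. ennreal (1 / wt 1 (0 + R *\<^sub>R y)) \<partial>(lborel :: 'n measure))"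
      using R by (simp add: wt_def abs_mult)
    also have "\<dots> = ennreal (1 / \<bar>R\<bar> ^ DIM('n)) * I"
      unfolding I_def using R by (intro nn_integral_lborel_affine) auto
    also have "\<dots> = ennreal (C / R ^ DIM('n))"
      using R C by (simp add: ennreal_mult[symmetric] mult.commute)
    finally show "(\<integral>\<^sup>+ y. ennreal (1 / wt R y) \<partial>(lborel :: 'n measure)) = ennreal (C / R ^ DIM('n))" .
  qed
qed

section \<open>Directional derivatives and the Fourier transform\<close>

lemma lborel_translate:
  fixes f :: "'n::euclidean_space \<Rightarrow> 'b::{banach,second_countable_topology}"
  assumes "integrable lborel f"
  shows "integrable lborel (\<lambda>x. f (x + c))" "(LINT x|lborel. f (x + c)) = (LINT x|lborel. f x)"
proof -
  have [measurable]: "f \<in> borel_measurable borel" using assms by auto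
  have "integrable (distr lborel borel ((+) c)) f"
    using assms unfolding lborel_distr_plus .
  then show "integrable lborel (\<lambda>x. f (x + c))"
    by (subst (asm) integrable_distr_eq) (auto simp: add.commute)
  have "(LINT x|distr lborel borel ((+) c). f x) = (LINT x|lborel. f (c + x))"
    by (subst integral_distr) auto
  then show "(LINT x|lborel. f (x + c)) = (LINT x|lborel. f x)"
    unfolding lborel_distr_plus by (simp add: add.commute)
qed

text \<open>A relation instead of a derivative operator, and along one line only: symbols supply
  such pairs through \<open>dpart\<close>, cutoffs through complex derivatives, and both can be
  multiplied without full differentiability.\<close>

definition dir_deriv :: "'n::euclidean_space \<Rightarrow> ('n \<Rightarrow> complex) \<Rightarrow> ('n \<Rightarrow> complex) \<Rightarrow> bool" where
  "dir_deriv b g g' \<longleftrightarrow> (\<forall>x. ((\<lambda>t::real. g (x + t *\<^sub>R b)) has_vector_derivative g' x) (at 0))"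

lemma dir_deriv_at:
  assumes "dir_deriv b g g'"
  shows "((\<lambda>t::real. g (x + t *\<^sub>R b)) has_vector_derivative g' (x + t *\<^sub>R b)) (at t)"
proof -
  have "((\<lambda>u::real. g ((x + t *\<^sub>R b) + u *\<^sub>R b)) has_vector_derivative g' (x + t *\<^sub>R b)) (at 0)"
    using assms by (simp add: dir_deriv_def)
  then have "((\<lambda>u::real. g ((x + t *\<^sub>R b) + u *\<^sub>R b)) has_vector_derivative g' (x + t *\<^sub>R b)) (at (t - t))"
    by simp
  moreover have "((\<lambda>u. u - t) has_vector_derivative 1) (at t)"
    unfolding has_real_derivative_iff_has_vector_derivative[symmetric]
    by (rule DERIV_cong[OF DERIV_diff[OF DERIV_ident DERIV_const]]) simp
  ultimately have "((\<lambda>u::real. g ((x + t *\<^sub>R b) + (u - t) *\<^sub>R b)) has_vector_derivative g' (x + t *\<^sub>R b)) (at t)"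
    using vector_diff_chain_at[where f="\<lambda>u. u - t" and x=t and f'=1
        and g="\<lambda>u. g ((x + t *\<^sub>R b) + u *\<^sub>R b)" and g'="g' (x + t *\<^sub>R b)"] by (simp add: o_def)
  then show ?thesis by (simp add: algebra_simps)
qed

lemma dir_deriv_continuous:
  assumes "dir_deriv b g g'"
  shows "continuous_on S (\<lambda>t::real. g (x + t *\<^sub>R b))"
  by (intro continuous_at_imp_continuous_on ballI has_vector_derivative_continuous[OF dir_deriv_at[OF assms]])

text \<open>A sequence of difference quotients instead of a limit along the reals makes
  measurability pass to the derivative.\<close>

lemma dir_deriv_tendsto:
  assumes D: "dir_deriv b g g'"
  shows "(\<lambda>k. real (Suc k) *\<^sub>R (g (x + (1 / real (Suc k)) *\<^sub>R b) - g x)) \<longlonglongrightarrow> g' x"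
proof -
  have "((\<lambda>t::real. g (x + t *\<^sub>R b)) has_vector_derivative g' x) (at 0)"
    using D by (simp add: dir_deriv_def)
  then have "((\<lambda>t. norm (g (x + t *\<^sub>R b) - g x - t *\<^sub>R g' x) / norm t) \<longlongrightarrow> 0) (at 0)"
    by (simp add: has_vector_derivative_def has_derivative_at)
  then have "((\<lambda>t. norm ((g (x + t *\<^sub>R b) - g x) /\<^sub>R t - g' x)) \<longlongrightarrow> 0) (at 0)"
  proof (rule Lim_transform_eventually)
    show "\<forall>\<^sub>F t in at 0. norm (g (x + t *\<^sub>R b) - g x - t *\<^sub>R g' x) / norm t
        = norm ((g (x + t *\<^sub>R b) - g x) /\<^sub>R t - g' x)"
    proof (rule eventually_mono[OF eventually_neq_at_within[of 0]])
      fix t :: real assume t: "t \<noteq> 0"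
      then have "(g (x + t *\<^sub>R b) - g x) /\<^sub>R t - g' x = (g (x + t *\<^sub>R b) - g x - t *\<^sub>R g' x) /\<^sub>R t"
        by (simp add: scaleR_diff_right)
      then show "norm (g (x + t *\<^sub>R b) - g x - t *\<^sub>R g' x) / norm t
        = norm ((g (x + t *\<^sub>R b) - g x) /\<^sub>R t - g' x)" by (simp add: divide_inverse mult.commute)
    qed
  qed
  then have "((\<lambda>t. (g (x + t *\<^sub>R b) - g x) /\<^sub>R t) \<longlongrightarrow> g' x) (at 0)"
    by (rule LIM_zero_cancel[OF tendsto_norm_zero_cancel])
  moreover have "filterlim (\<lambda>k. 1 / real (Suc k)) (at 0) sequentially"
    unfolding filterlim_at using LIMSEQ_Suc[OF lim_1_over_n[where 'a=real]] by auto
  ultimately have "(\<lambda>k. (g (x + (1 / real (Suc k)) *\<^sub>R b) - g x) /\<^sub>R (1 / real (Suc k))) \<longlonglongrightarrow> g' x"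
    by (rule filterlim_compose)
  then show ?thesis by simp
qed

lemma dir_deriv_measurable:
  assumes D: "dir_deriv b g g'" and [measurable]: "g \<in> borel_measurable borel"
  shows "g' \<in> borel_measurable borel"
  by (rule borel_measurable_LIMSEQ_metric[OF _ dir_deriv_tendsto[OF D]]) measurable

text \<open>By translation invariance \<open>g (x + b) - g x\<close> has integral 0. The fundamental
  theorem on the segment from \<open>x\<close> to \<open>x + b\<close>, followed by Fubini, turns
  the same integral into that of \<open>g'\<close>. Integrability thus replaces decay at
  infinity.\<close>

lemma integral_dir_deriv:
  assumes D: "dir_deriv b g g'" and g: "integrable lborel g" and g': "integrable lborel g'"
    and C: "\<And>x. continuous_on UNIV (\<lambda>t::real. g' (x + t *\<^sub>R b))"
  shows "(LINT x|lborel. g' x) = 0"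
proof -
  define I where "I = (indicator {0..1} :: real \<Rightarrow> real)"
  have [measurable]: "g' \<in> borel_measurable borel" using g' by auto
  have [measurable]: "I \<in> borel_measurable borel" unfolding I_def by measurable
  have ftc: "(LINT t|lborel. I t *\<^sub>R g' (x + t *\<^sub>R b)) = g (x + b) - g x" for x
  proof -
    have "has_bochner_integral lborel (\<lambda>t. indicator {0..1} t *\<^sub>R g' (x + t *\<^sub>R b))
        ((\<lambda>t. g (x + t *\<^sub>R b)) 1 - (\<lambda>t. g (x + t *\<^sub>R b)) 0)"
      using dir_deriv_at[OF D] C
      by (intro has_bochner_integral_FTC_Icc)
        (auto intro: has_vector_derivative_at_within continuous_on_subset)
    then show ?thesis by (simp add: has_bochner_integral_iff I_def)
  qed
  have int: "integrable (lborel \<Otimes>\<^sub>M lborel) (\<lambda>(t, x). I t *\<^sub>R g' (x + t *\<^sub>R b))"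
  proof (rule lborel_pair.Fubini_integrable)
    show "(\<lambda>(t, x). I t *\<^sub>R g' (x + t *\<^sub>R b)) \<in> borel_measurable (lborel \<Otimes>\<^sub>M lborel)"
      by measurable
    have "(LINT x|lborel. norm (case (t, x) of (t, x) \<Rightarrow> I t *\<^sub>R g' (x + t *\<^sub>R b)))
        = indicator {0..1} t * (LINT x|lborel. norm (g' x))" for t
      using lborel_translate(2)[OF integrable_norm[OF g'], of "t *\<^sub>R b"] by (simp add: I_def)
    then show "integrable lborel (\<lambda>t. LINT x|lborel. norm (case (t, x) of (t, x) \<Rightarrow> I t *\<^sub>R g' (x + t *\<^sub>R b)))"
      by simp
    show "AE t in lborel. integrable lborel (\<lambda>x. case (t, x) of (t, x) \<Rightarrow> I t *\<^sub>R g' (x + t *\<^sub>R b))"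
      using lborel_translate(1)[OF g'] by auto
  qed
  have "(LINT x|lborel. (LINT t|lborel. I t *\<^sub>R g' (x + t *\<^sub>R b)))
      = (LINT t|lborel. (LINT x|lborel. I t *\<^sub>R g' (x + t *\<^sub>R b)))"
    using lborel_pair.Fubini_integral[OF int] by simp
  also have "\<dots> = (LINT t|lborel. I t *\<^sub>R (LINT x|lborel. g' x))"
    using lborel_translate(2)[OF g'] by simp
  also have "\<dots> = (LINT x|lborel. g' x)" by (simp add: I_def)
  finally show ?thesis
    unfolding ftc using lborel_translate[OF g, of b] g by simp
qed

text \<open>The sign is that of the inverse transform, so that the kernel of the operator is
  \<open>FT\<close> of the symbol in \<xi>; the transform \<open>fourier f\<close> becomes
  \<open>FT\<close> of the reflection of \<open>f\<close>.\<close>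

definition FT :: "('n::euclidean_space \<Rightarrow> complex) \<Rightarrow> 'n \<Rightarrow> complex" where
  "FT g y = (LINT \<xi>|lborel. g \<xi> * cis (y \<bullet> \<xi>))"

abbreviation power_mass :: "real \<Rightarrow> ('n::euclidean_space \<Rightarrow> real) \<Rightarrow> ennreal" where
  "power_mass s h \<equiv> (\<integral>\<^sup>+ y. ennreal (h y powr s) \<partial>lborel)"

abbreviation square_mass :: "('n::euclidean_space \<Rightarrow> complex) \<Rightarrow> ennreal" where
  "square_mass g \<equiv> (\<integral>\<^sup>+ y. ennreal (norm (g y) ^ 2) \<partial>lborel)"

text \<open>By duality, a bound for all \<open>h\<close> in the unit ball of L^s is the
  Hausdorff--Young inequality; the conjugate exponent, infinite for s = 1, stays implicit. In the
  application \<open>h\<close> is a translate of \<open>f\<close> divided by the weight.\<close>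

abbreviation FT_pairing :: "('n::euclidean_space \<Rightarrow> complex) \<Rightarrow> ('n \<Rightarrow> real) \<Rightarrow> ennreal" where
  "FT_pairing g h \<equiv> (\<integral>\<^sup>+ y. ennreal (norm (FT g y)) * ennreal (h y) \<partial>lborel)"

lemma borel_measurable_cis_inner [measurable]:
  assumes [measurable]: "f \<in> borel_measurable M"
  shows "(\<lambda>x. cis (f x)) \<in> borel_measurable M"
  unfolding cis_conv_exp by measurable

lemma borel_measurable_FT [measurable]:
  fixes g :: "'n::euclidean_space \<Rightarrow> complex"
  assumes [measurable]: "g \<in> borel_measurable borel"
  shows "FT g \<in> borel_measurable borel"
  unfolding FT_def[abs_def] by measurable

lemma integrable_cis:
  fixes g :: "'n::euclidean_space \<Rightarrow> complex"
  assumes "integrable lborel g"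
  shows "integrable lborel (\<lambda>\<xi>. g \<xi> * cis (y \<bullet> \<xi>))"
proof (rule Bochner_Integration.integrable_bound[OF assms])
  have [measurable]: "g \<in> borel_measurable borel" using assms by auto
  show "(\<lambda>\<xi>. g \<xi> * cis (y \<bullet> \<xi>)) \<in> borel_measurable lborel" by measurable
qed (simp add: norm_mult)

lemma norm_FT_le:
  fixes g :: "'n::euclidean_space \<Rightarrow> complex"
  shows "norm (FT g y) \<le> (LINT \<xi>|lborel. norm (g \<xi>))"
  unfolding FT_def by (rule order_trans[OF integral_norm_bound]) (simp add: norm_mult)

text \<open>Integration by parts without boundary terms: the derivative along \<open>b\<close> of
  \<open>g x * cis (y \<bullet> x)\<close> integrates to 0.\<close>

lemma norm_FT_dir_deriv:
  assumes D: "dir_deriv b g g'" and g: "integrable lborel g" and g': "integrable lborel g'"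
    and C: "\<And>x. continuous_on UNIV (\<lambda>t::real. g' (x + t *\<^sub>R b))"
  shows "norm (FT g' y) = \<bar>y \<bullet> b\<bar> * norm (FT g y)"
proof -
  define h where "h x = g x * cis (y \<bullet> x)" for x
  define h' where "h' x = g' x * cis (y \<bullet> x) + (\<i> * of_real (y \<bullet> b)) * (g x * cis (y \<bullet> x))" for x
  have "dir_deriv b h h'"
    unfolding dir_deriv_def
  proof
    fix x
    have 1: "((\<lambda>t. cis (y \<bullet> (x + t *\<^sub>R b))) has_vector_derivative (y \<bullet> b) *\<^sub>R (\<i> * cis (y \<bullet> x))) (at 0)"
    proof -
      have "((\<lambda>t::real. y \<bullet> x + t * (y \<bullet> b)) has_derivative (\<lambda>t. t * (y \<bullet> b))) (at 0)"
        by (auto intro!: derivative_eq_intros)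
      from has_derivative_cis[OF this] show ?thesis
        by (simp add: has_vector_derivative_def inner_add_right)
    qed
    have "((\<lambda>t. g (x + t *\<^sub>R b)) has_vector_derivative g' x) (at 0)"
      using D by (simp add: dir_deriv_def)
    from has_vector_derivative_mult[OF this 1]
    show "((\<lambda>t. h (x + t *\<^sub>R b)) has_vector_derivative h' x) (at 0)"
      unfolding h_def h'_def by (rule has_vector_derivative_eq_rhs) (simp add: scaleR_conv_of_real)
  qed
  moreover have "integrable lborel h" unfolding h_def by (rule integrable_cis[OF g])
  moreover have "integrable lborel h'" unfolding h'_def
    by (intro Bochner_Integration.integrable_add integrable_mult_right integrable_cis g g')
  moreover have "continuous_on UNIV (\<lambda>t::real. h' (x + t *\<^sub>R b))" for x
    unfolding h'_def cis_conv_exp using C dir_deriv_continuous[OF D]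
    by (auto intro!: continuous_intros)
  ultimately have "(LINT x|lborel. h' x) = 0" by (rule integral_dir_deriv)
  then have "FT g' y + (\<i> * of_real (y \<bullet> b)) * FT g y = 0"
    unfolding h'_def FT_def
    by (subst (asm) Bochner_Integration.integral_add) (auto intro!: integrable_cis g g')
  then have "FT g' y = - ((\<i> * of_real (y \<bullet> b)) * FT g y)" by (simp add: eq_neg_iff_add_eq_0)
  then show ?thesis by (simp add: norm_mult)
qed

lemma norm_FT_iterated_dir_deriv:
  assumes D: "\<And>k. dir_deriv b (G k) (G (Suc k))"
    and I: "\<And>k. k \<le> N \<Longrightarrow> integrable lborel (G k)"
  shows "norm (FT (G N) y) = \<bar>y \<bullet> b\<bar> ^ N * norm (FT (G 0) y)"
  using I
proof (induction N)
  case (Suc N)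
  have "norm (FT (G (Suc N)) y) = \<bar>y \<bullet> b\<bar> * norm (FT (G N) y)"
    by (rule norm_FT_dir_deriv[OF D]) (auto intro: Suc.prems dir_deriv_continuous[OF D])
  then show ?case using Suc by simp
qed simp

section \<open>Dyadic frequency cutoffs\<close>

lemma norm_one_plus_power_minus_one:
  "norm ((1 + w) ^ n - 1) \<le> (1 + norm w) ^ n - (1::real)" for w :: complex
proof (induction n)
  case (Suc n)
  have "(1 + w) ^ Suc n - 1 = (1 + w) * ((1 + w) ^ n - 1) + w" by (simp add: algebra_simps)
  also have "norm \<dots> \<le> norm (1 + w) * norm ((1 + w) ^ n - 1) + norm w"
    by (metis norm_triangle_ineq norm_mult)
  also have "\<dots> \<le> (1 + norm w) * ((1 + norm w) ^ n - 1) + norm w"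
    using norm_triangle_ineq[of 1 w] by (intro add_right_mono mult_mono Suc) auto
  finally show ?case by (simp add: algebra_simps)
qed simp

text \<open>A relative perturbation of size 1/(4 L) changes an L-th power by a relative error of at
  most exp(1/4) - 1, which is below 1/2. This fixes the opening of the sector.\<close>

lemma norm_power_diff_le_half:
  fixes z :: complex
  assumes "norm (z - of_real c) \<le> c / (4 * real L)" "c > 0" "L > 0"
  shows "norm (z ^ L - of_real (c ^ L)) \<le> c ^ L / 2"
proof -
  define w where "w = (z - of_real c) / of_real c"
  have z: "z = of_real c * (1 + w)" using assms by (simp add: w_def field_simps)
  have w: "norm w \<le> 1 / (4 * real L)" using assms by (simp add: w_def norm_divide divide_simps mult_ac)
  have "norm ((1 + w) ^ L - 1) \<le> (1 + norm w) ^ L - 1" by (rule norm_one_plus_power_minus_one)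
  also have "(1 + norm w) ^ L \<le> exp (norm w) ^ L" by (intro power_mono) (auto simp: exp_ge_add_one_self)
  also have "\<dots> = exp (real L * norm w)" by (simp add: exp_of_nat_mult)
  also have "real L * norm w \<le> 1 / 4"
    using mult_left_mono[OF w, of "real L"] assms by simp
  also have "exp (1 / 4 :: real) \<le> 1 + 2 * (1/4)"
    using exp_bound_lemma[of "1/4 :: real"] by simp
  finally have h: "norm ((1 + w) ^ L - 1) \<le> 1 / 2" by simp
  have "z ^ L - of_real (c ^ L) = of_real (c ^ L) * ((1 + w) ^ L - 1)"
    unfolding z by (simp add: power_mult_distrib right_diff_distrib)
  then have "norm (z ^ L - of_real (c ^ L)) = c ^ L * norm ((1 + w) ^ L - 1)"
    using assms by (simp add: norm_mult norm_power)
  then show ?thesis using mult_left_mono[OF h, of "c ^ L"] assms by simp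
qed

text \<open>The cutoffs are holomorphic functions of \<open>1 + |\<xi>|\<^sup>2\<close> in a sector around the positive axis. They are not
  compactly supported, but decay on both sides of their dyadic shell to any prescribed order \<open>L\<close>, and Cauchy's
  inequality controls all their derivatives at once.\<close>

definition dycut :: "nat \<Rightarrow> nat \<Rightarrow> complex \<Rightarrow> complex" where
  "dycut L j z = 1 / (1 + (z / 4 ^ j) ^ L) - (if j = 0 then 0 else 1 / (1 + (z / 4 ^ (j - 1)) ^ L))"

text \<open>The differences telescope. For L > 0 the right-hand side tends to 1 as \<open>J\<close>
  grows, so the cutoffs form a partition of unity only in the limit.\<close>

lemma sum_dycut: "(\<Sum>j\<le>J. dycut L j z) = 1 / (1 + (z / 4 ^ J) ^ L)"
  by (induction J) (auto simp: dycut_def)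

text \<open>Near the positive axis the L-th power keeps a positive real part, comparable with its
  modulus; hence the denominators of \<open>dycut\<close> have no zeros there and do not
  shrink.\<close>

lemma sector_power:
  fixes z :: complex
  assumes z: "norm (z - of_real c) \<le> c / (4 * real L)" and c: "c > 0" and L: "L > 0"
  shows "Re ((z / 4 ^ j) ^ L) \<ge> (c / 4 ^ j) ^ L / 2" "norm ((z / 4 ^ j) ^ L) \<le> 3 / 2 * (c / 4 ^ j) ^ L"
    "norm (1 + (z / 4 ^ j) ^ L) \<ge> 1 + (c / 4 ^ j) ^ L / 2"
proof -
  have "norm (z / 4 ^ j - of_real (c / 4 ^ j)) = norm (z - of_real c) / 4 ^ j"
    by (simp add: diff_divide_distrib[symmetric] norm_divide norm_power)
  also have "\<dots> \<le> (c / 4 ^ j) / (4 * real L)"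
    using divide_right_mono[OF z, of "4 ^ j"] by (simp add: field_simps)
  finally have *: "norm ((z / 4 ^ j) ^ L - of_real ((c / 4 ^ j) ^ L)) \<le> (c / 4 ^ j) ^ L / 2"
    using c L by (intro norm_power_diff_le_half) auto
  define v where "v = (z / 4 ^ j) ^ L"
  define V where "V = (c / 4 ^ j) ^ L"
  have "\<bar>Re (v - of_real V)\<bar> \<le> V / 2" using * abs_Re_le_cmod[of "v - of_real V"] unfolding v_def V_def by linarith
  then have "\<bar>Re v - V\<bar> \<le> V / 2" by simp
  then show 1: "Re v \<ge> V / 2" by linarith
  show "norm v \<le> 3 / 2 * V"
  proof -
    have "norm v \<le> norm (v - of_real V) + norm (of_real V :: complex)"
      using norm_triangle_ineq[of "v - of_real V" "of_real V"] by simp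
    also have "norm (of_real V :: complex) = V" using c by (simp add: V_def norm_power norm_divide)
    finally show ?thesis using * unfolding v_def[symmetric] V_def[symmetric] by linarith
  qed
  show "norm (1 + v) \<ge> 1 + V / 2"
    using 1 complex_Re_le_cmod[of "1 + v"] by simp
qed

text \<open>The first bound is decay below the dyadic shell, where the two terms of
  \<open>dycut\<close> nearly cancel; the second is decay above it, where each term is
  small.\<close>

lemma dycut_bound:
  fixes z :: complex
  assumes z: "norm (z - of_real c) \<le> c / (4 * real L)" and c: "c \<ge> 1" and L: "L > 0"
  shows "norm (dycut L j z) \<le> 6 * 4 ^ L * (c / 4 ^ j) ^ L"
    and "norm (dycut L j z) \<le> 6 * 4 ^ L / (c / 4 ^ j) ^ L"
proof -
  define v where "v = (z / 4 ^ j) ^ L"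
  define V where "V = (c / 4 ^ j) ^ L"
  have c0: "c > 0" using c by simp
  note s = sector_power[OF z c0 L, of j, folded v_def V_def]
  have V: "V > 0" using c0 by (simp add: V_def)
  have F: "(4::real) ^ L \<ge> 1" by simp
  have "norm (dycut L j z) \<le> 6 * 4 ^ L * V \<and> norm (dycut L j z) \<le> 6 * 4 ^ L / V"
  proof (cases "j = 0")
    case True
    \<comment> \<open>The zeroth cutoff has no second term to cancel with; \<open>c \<ge> 1\<close>
      makes the low-frequency bound harmless.\<close>
    have V1: "V \<ge> 1" using c True by (simp add: V_def one_le_power)
    have "norm (dycut L j z) = 1 / norm (1 + v)" using True by (simp add: dycut_def v_def norm_divide)
    also have "\<dots> \<le> 1 / (V / 2)" using s(3) V by (intro divide_left_mono) (auto intro!: mult_pos_pos)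
    also have "\<dots> = 2 / V" by simp
    finally have 1: "norm (dycut L j z) \<le> 2 / V" .
    moreover have "2 / V \<le> 6 * 4 ^ L / V" using F V by (intro divide_right_mono) linarith+
    moreover have "6 * 4 ^ L / V \<le> 6 * 4 ^ L / 1" using V1 by (intro divide_left_mono) auto
    moreover have "6 * 4 ^ L * 1 \<le> 6 * 4 ^ L * V" using V1 by (intro mult_left_mono) auto
    ultimately show ?thesis by linarith
  next
    case False
    then obtain i where j: "j = Suc i" by (cases j) auto
    have v4: "(z / 4 ^ (j - 1)) ^ L = 4 ^ L * v"
      unfolding v_def j by (simp add: power_mult_distrib[symmetric])
    have V4: "(c / 4 ^ (j - 1)) ^ L = 4 ^ L * V"
      unfolding V_def j by (simp add: power_mult_distrib[symmetric])
    note s' = sector_power[OF z c0 L, of "j - 1", unfolded v4 V4]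
    have n2: "norm (1 + 4 ^ L * v) \<ge> 1 + V / 2"
      using s'(3) mult_right_mono[OF F, of V] V by linarith
    have nz: "1 + v \<noteq> 0" "1 + 4 ^ L * v \<noteq> 0" using s(3) n2 V by auto
    have "dycut L j z = 1 / (1 + v) - 1 / (1 + 4 ^ L * v)"
      unfolding dycut_def v4 using False by (simp add: v_def)
    \<comment> \<open>The constants cancel in the numerator. What remains is of size V / (1 +
      V/2)^2, which is small both for small and for large V.\<close>
    also have "\<dots> = (4 ^ L - 1) * v / ((1 + v) * (1 + 4 ^ L * v))"
      using nz by (subst diff_frac_eq) (simp_all add: algebra_simps)
    finally have "norm (dycut L j z) = norm ((4::complex) ^ L - 1) * norm v / (norm (1 + v) * norm (1 + 4 ^ L * v))"
      by (simp add: norm_divide norm_mult)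
    also have "norm ((4::complex) ^ L - 1) = 4 ^ L - 1"
    proof -
      have "(4::complex) ^ L - 1 = of_real (4 ^ L - 1)" by simp
      then show ?thesis using F by (simp only: norm_of_real)
    qed
    also have "(4 ^ L - 1) * norm v / (norm (1 + v) * norm (1 + 4 ^ L * v))
        \<le> 4 ^ L * (3 / 2 * V) / ((1 + V / 2) * (1 + V / 2))"
      using s(2,3) n2 V F by (intro frac_le mult_mono mult_nonneg_nonneg mult_pos_pos) auto
    finally have b: "norm (dycut L j z) \<le> 4 ^ L * (3 / 2 * V) / ((1 + V / 2) * (1 + V / 2))" .
    have gen: "K * (3 / 2 * V) / ((1 + V / 2) * (1 + V / 2)) \<le> 6 * K * V"
        "K * (3 / 2 * V) / ((1 + V / 2) * (1 + V / 2)) \<le> 6 * K / V" if K: "K > 0" for K :: real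
    proof -
      have KV: "0 < K * V" using K V by simp
      have "1 * 1 \<le> (1 + V / 2) * (1 + V / 2)" using V by (intro mult_mono) auto
      then have "K * (3 / 2 * V) / ((1 + V / 2) * (1 + V / 2)) \<le> K * (3 / 2 * V) / (1 * 1)"
        using KV by (intro divide_left_mono) auto
      also have "\<dots> \<le> 6 * K * V" using KV by simp
      finally show "K * (3 / 2 * V) / ((1 + V / 2) * (1 + V / 2)) \<le> 6 * K * V" using KV by simp
      have "V / 2 * (V / 2) \<le> (1 + V / 2) * (1 + V / 2)" using V by (intro mult_mono) auto
      then have "K * (3 / 2 * V) / ((1 + V / 2) * (1 + V / 2)) \<le> K * (3 / 2 * V) / (V / 2 * (V / 2))"
        using KV V by (intro divide_left_mono) auto
      also have "\<dots> = 6 * K / V" using V by (simp add: field_simps)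
      finally show "K * (3 / 2 * V) / ((1 + V / 2) * (1 + V / 2)) \<le> 6 * K / V" .
    qed
    have "norm (dycut L j z) \<le> 6 * 4 ^ L * V" "norm (dycut L j z) \<le> 6 * 4 ^ L / V"
      using order_trans[OF b gen(1)] order_trans[OF b gen(2)] by auto
    then show ?thesis by blast
  qed
  then show "norm (dycut L j z) \<le> 6 * 4 ^ L * (c / 4 ^ j) ^ L"
    and "norm (dycut L j z) \<le> 6 * 4 ^ L / (c / 4 ^ j) ^ L" by (auto simp: V_def)
qed

lemma dycut_holomorphic:
  assumes L: "L > 0" and S: "\<And>z. z \<in> S \<Longrightarrow> \<exists>c>0. norm (z - of_real c) \<le> c / (4 * real L)"
  shows "dycut L j holomorphic_on S"
proof -
  have nz: "1 + (z / 4 ^ i) ^ L \<noteq> 0" if "z \<in> S" for z i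
  proof -
    obtain c where c: "c > 0" "norm (z - of_real c) \<le> c / (4 * real L)" using S \<open>z \<in> S\<close> by blast
    have "0 < (c / 4 ^ i) ^ L" using c by simp
    then show ?thesis using sector_power(3)[OF c(2,1) L, of i] by auto
  qed
  have "(\<lambda>z. 1 / (1 + (z / 4 ^ i) ^ L)) holomorphic_on S" for i :: nat
    by (intro holomorphic_intros nz) auto
  then have "(\<lambda>z. 1 / (1 + (z / 4 ^ j) ^ L) - c * (1 / (1 + (z / 4 ^ (j - 1)) ^ L))) holomorphic_on S" for c
    by (intro holomorphic_on_diff holomorphic_on_mult holomorphic_on_const)
  from this[of "if j = 0 then 0 else 1"] show ?thesis
    unfolding dycut_def[abs_def] by (rule back_subst[of "\<lambda>f. f holomorphic_on S"]) auto
qed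

text \<open>On the line through \<open>\<xi>\<close> in the direction of the unit vector \<open>b\<close>, the quantity
  \<open>d = 1 + |\<xi>|\<^sup>2 - (\<xi> \<bullet> b)\<^sup>2\<close> is constant, so that \<open>k\<close>-fold differentiation in direction \<open>b\<close> becomes complex
  differentiation of \<open>line_dycut L j d\<close> at \<open>\<xi> \<bullet> b\<close>.\<close>

definition line_dycut :: "nat \<Rightarrow> nat \<Rightarrow> real \<Rightarrow> complex \<Rightarrow> complex" where
  "line_dycut L j d z = dycut L j (of_real d + z ^ 2)"

definition cutoff :: "nat \<Rightarrow> nat \<Rightarrow> 'n::euclidean_space \<Rightarrow> nat \<Rightarrow> 'n \<Rightarrow> complex" where
  "cutoff L j b k \<xi> = (deriv ^^ k) (line_dycut L j (1 + norm \<xi> ^ 2 - (\<xi> \<bullet> b) ^ 2)) (of_real (\<xi> \<bullet> b))"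

text \<open>The direction drops out at order 0, so the derivative chains in all directions start
  from one function.\<close>

lemma cutoff_0: "cutoff L j b 0 \<xi> = dycut L j (of_real (jbr \<xi> ^ 2))"
proof -
  have "of_real (1 + norm \<xi> ^ 2 - (\<xi> \<bullet> b) ^ 2) + of_real (\<xi> \<bullet> b) ^ 2 = (of_real (jbr \<xi> ^ 2) :: complex)"
    unfolding of_real_power[symmetric] of_real_add[symmetric] jbr_square by simp
  then show ?thesis by (simp only: cutoff_def line_dycut_def funpow_0)
qed

text \<open>With e = 1/(12 L) and J the bracket of \<xi>, squaring moves a point of the disc by at
  most 2 J (e J) + (e J)^2, hence by at most 3 e J^2. The 12 is this 3 times the 4 of the sector
  condition.\<close>

lemma line_dycut_ball:
  fixes b :: "'n::euclidean_space" and z :: complex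
  assumes b: "b \<in> Basis" and L: "L > 0"
    and z: "norm (z - of_real (\<xi> \<bullet> b)) \<le> jbr \<xi> / (12 * real L)"
  shows "norm (of_real (1 + norm \<xi> ^ 2 - (\<xi> \<bullet> b) ^ 2) + z ^ 2 - of_real (jbr \<xi> ^ 2)) \<le> jbr \<xi> ^ 2 / (4 * real L)"
proof -
  define J where "J = jbr \<xi>"
  define \<tau> where "\<tau> = \<xi> \<bullet> b"
  define e where "e = 1 / (12 * real L)"
  have J: "J > 0" by (simp add: J_def)
  have e: "0 \<le> e" "e \<le> 1" using L by (auto simp: e_def divide_le_eq)
  have \<tau>: "\<bar>\<tau>\<bar> \<le> J" unfolding \<tau>_def J_def
    using Basis_le_norm[OF b, of \<xi>] norm_le_jbr[of \<xi>] by linarith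
  have z': "norm (z - of_real \<tau>) \<le> e * J" using z by (simp add: \<tau>_def J_def e_def)
  have "of_real (1 + norm \<xi> ^ 2 - (\<xi> \<bullet> b) ^ 2) + z ^ 2 - of_real (jbr \<xi> ^ 2)
      = 2 * of_real \<tau> * (z - of_real \<tau>) + (z - of_real \<tau>) ^ 2"
    unfolding jbr_square \<tau>_def by (simp add: power2_eq_square algebra_simps)
  also have "norm \<dots> \<le> 2 * \<bar>\<tau>\<bar> * norm (z - of_real \<tau>) + norm (z - of_real \<tau>) ^ 2"
    by (rule order_trans[OF norm_triangle_ineq]) (simp add: norm_mult norm_power)
  also have "\<dots> \<le> 2 * J * (e * J) + (e * J) ^ 2"
    using \<tau> z' J e by (intro add_mono mult_mono power_mono) auto
  also have "\<dots> = (2 + e) * e * J ^ 2" by (simp add: power2_eq_square algebra_simps)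
  also have "\<dots> \<le> 3 * e * J ^ 2" using e J by (intro mult_right_mono) auto
  also have "\<dots> = J ^ 2 / (4 * real L)" by (simp add: e_def)
  finally show ?thesis by (simp add: J_def)
qed

lemma line_dycut_holomorphic:
  fixes b :: "'n::euclidean_space"
  assumes b: "b \<in> Basis" and L: "L > 0"
  shows "line_dycut L j (1 + norm \<xi> ^ 2 - (\<xi> \<bullet> b) ^ 2) holomorphic_on cball (of_real (\<xi> \<bullet> b)) (jbr \<xi> / (12 * real L))"
proof -
  let ?c = "1 + norm \<xi> ^ 2 - (\<xi> \<bullet> b) ^ 2"
  let ?S = "cball (of_real (\<xi> \<bullet> b)) (jbr \<xi> / (12 * real L)) :: complex set"
  have "dycut L j holomorphic_on (\<lambda>z. of_real ?c + z ^ 2) ` ?S"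
  proof (rule dycut_holomorphic[OF L])
    fix w assume "w \<in> (\<lambda>z. of_real ?c + z ^ 2) ` ?S"
    then obtain z where z: "w = of_real ?c + z ^ 2" "norm (z - of_real (\<xi> \<bullet> b)) \<le> jbr \<xi> / (12 * real L)"
      by (auto simp: dist_norm norm_minus_commute)
    have "norm (w - of_real (jbr \<xi> ^ 2)) \<le> jbr \<xi> ^ 2 / (4 * real L)"
      unfolding z(1) by (rule line_dycut_ball[OF b L z(2)])
    moreover have "jbr \<xi> ^ 2 > 0" by (rule zero_less_power[OF jbr_pos])
    ultimately show "\<exists>c>0. norm (w - of_real c) \<le> c / (4 * real L)" by blast
  qed
  moreover have "(\<lambda>z. of_real ?c + z ^ 2) holomorphic_on ?S"
    by (intro holomorphic_on_add holomorphic_on_const holomorphic_on_power holomorphic_on_ident)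
  ultimately show ?thesis
    unfolding line_dycut_def[abs_def] using holomorphic_on_compose[of "\<lambda>z. of_real ?c + z ^ 2" ?S "dycut L j"]
    by (simp add: o_def)
qed

text \<open>Cauchy's inequality on a disc whose radius is proportional to the bracket of \<xi>:
  every derivative gains one power of the bracket, and the two-sided decay of \<open>dycut\<close>
  persists.\<close>

lemma cutoff_bound:
  fixes b :: "'n::euclidean_space"
  assumes b: "b \<in> Basis" and L: "L > 0"
  shows "norm (cutoff L j b k \<xi>) \<le> fact k * (6 * 4 ^ L * (12 * real L) ^ k) * (jbr \<xi> ^ 2 / 4 ^ j) ^ L / jbr \<xi> ^ k"
    and "norm (cutoff L j b k \<xi>) \<le> fact k * (6 * 4 ^ L * (12 * real L) ^ k) / (jbr \<xi> ^ 2 / 4 ^ j) ^ L / jbr \<xi> ^ k"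
proof -
  define r where "r = jbr \<xi> / (12 * real L)"
  have r: "r > 0" using L by (simp add: r_def)
  have c1: "jbr \<xi> ^ 2 \<ge> 1" using jbr_ge_one[of \<xi>] by (simp add: one_le_power)
  note hol = line_dycut_holomorphic[OF b L, of j \<xi>, folded r_def]
  have *: "norm (cutoff L j b k \<xi>) \<le> fact k * B / r ^ k"
    if B: "\<And>w. norm (w - of_real (jbr \<xi> ^ 2)) \<le> jbr \<xi> ^ 2 / (4 * real L) \<Longrightarrow> norm (dycut L j w) \<le> B" for B
    unfolding cutoff_def
  proof (rule Cauchy_inequality)
    show "line_dycut L j (1 + norm \<xi> ^ 2 - (\<xi> \<bullet> b) ^ 2) holomorphic_on ball (of_real (\<xi> \<bullet> b)) r"
      by (rule holomorphic_on_subset[OF hol ball_subset_cball])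
    show "continuous_on (cball (of_real (\<xi> \<bullet> b)) r) (line_dycut L j (1 + norm \<xi> ^ 2 - (\<xi> \<bullet> b) ^ 2))"
      by (rule holomorphic_on_imp_continuous_on[OF hol])
    show "0 < r" by fact
    fix x :: complex assume "norm (of_real (\<xi> \<bullet> b) - x) = r"
    then have "norm (x - of_real (\<xi> \<bullet> b)) \<le> jbr \<xi> / (12 * real L)"
      by (simp add: norm_minus_commute r_def)
    from line_dycut_ball[OF b L this]
    show "norm (line_dycut L j (1 + norm \<xi> ^ 2 - (\<xi> \<bullet> b) ^ 2) x) \<le> B"
      unfolding line_dycut_def by (rule B)
  qed
  have rk: "1 / r ^ k = (12 * real L) ^ k / jbr \<xi> ^ k" by (simp add: r_def power_divide)
  have "norm (cutoff L j b k \<xi>) \<le> fact k * (6 * 4 ^ L * (jbr \<xi> ^ 2 / 4 ^ j) ^ L) * (1 / r ^ k)"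
    using *[OF dycut_bound(1)[OF _ c1 L]] by simp
  then show "norm (cutoff L j b k \<xi>) \<le> fact k * (6 * 4 ^ L * (12 * real L) ^ k) * (jbr \<xi> ^ 2 / 4 ^ j) ^ L / jbr \<xi> ^ k"
    unfolding rk by (simp add: mult_ac)
  have "norm (cutoff L j b k \<xi>) \<le> fact k * (6 * 4 ^ L / (jbr \<xi> ^ 2 / 4 ^ j) ^ L) * (1 / r ^ k)"
    using *[OF dycut_bound(2)[OF _ c1 L]] by simp
  then show "norm (cutoff L j b k \<xi>) \<le> fact k * (6 * 4 ^ L * (12 * real L) ^ k) / (jbr \<xi> ^ 2 / 4 ^ j) ^ L / jbr \<xi> ^ k"
    unfolding rk by (simp add: mult_ac)
qed

lemma dir_deriv_cutoff:
  fixes b :: "'n::euclidean_space"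
  assumes b: "b \<in> Basis" and L: "L > 0"
  shows "dir_deriv b (cutoff L j b k) (cutoff L j b (Suc k))"
  unfolding dir_deriv_def
proof
  fix \<xi> :: 'n
  define d where "d = 1 + norm \<xi> ^ 2 - (\<xi> \<bullet> b) ^ 2"
  have r: "jbr \<xi> / (12 * real L) > 0" using L by simp
  have inv: "1 + norm (\<xi> + t *\<^sub>R b) ^ 2 - ((\<xi> + t *\<^sub>R b) \<bullet> b) ^ 2 = d" for t
  proof -
    have bb: "b \<bullet> b = 1" using b by simp
    have "norm (\<xi> + t *\<^sub>R b) ^ 2 = norm \<xi> ^ 2 + 2 * (\<xi> \<bullet> b) * t + t ^ 2"
      unfolding power2_norm_eq_inner inner_add_left inner_add_right inner_scaleR_left inner_scaleR_right bb inner_commute[of b \<xi>]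
      by (simp add: power2_eq_square distrib_left)
    moreover have "(\<xi> + t *\<^sub>R b) \<bullet> b = \<xi> \<bullet> b + t" by (simp add: inner_add_left bb)
    ultimately show ?thesis by (simp add: d_def power2_sum)
  qed
  have eq: "cutoff L j b k (\<xi> + t *\<^sub>R b) = (deriv ^^ k) (line_dycut L j d) (of_real (\<xi> \<bullet> b + t))" for t
    unfolding cutoff_def inv using b by (simp add: inner_simps)
  have "((deriv ^^ k) (line_dycut L j d) has_field_derivative (deriv ^^ Suc k) (line_dycut L j d) (of_real (\<xi> \<bullet> b)))
      (at (of_real (\<xi> \<bullet> b)))"
    using line_dycut_holomorphic[OF b L, of j \<xi>] r
    by (intro has_field_derivative_higher_deriv[of _ "ball (of_real (\<xi> \<bullet> b)) (jbr \<xi> / (12 * real L))"])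
      (auto intro: holomorphic_on_subset simp: d_def)
  then have "((deriv ^^ k) (line_dycut L j d) has_field_derivative cutoff L j b (Suc k) \<xi>)
      (at (of_real (\<xi> \<bullet> b + 0)))" by (simp add: cutoff_def d_def)
  moreover have "((\<lambda>t::real. complex_of_real (\<xi> \<bullet> b + t)) has_vector_derivative 1) (at 0)"
    by (auto simp: has_vector_derivative_def scaleR_conv_of_real intro!: derivative_eq_intros)
  ultimately have "((\<lambda>t. (deriv ^^ k) (line_dycut L j d) (of_real (\<xi> \<bullet> b + t))) has_vector_derivative cutoff L j b (Suc k) \<xi>) (at 0)"
    using field_vector_diff_chain_at[of "\<lambda>t::real. complex_of_real (\<xi> \<bullet> b + t)" 1 0 "(deriv ^^ k) (line_dycut L j d)"]
    by (simp add: o_def)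
  then show "((\<lambda>t. cutoff L j b k (\<xi> + t *\<^sub>R b)) has_vector_derivative cutoff L j b (Suc k) \<xi>) (at 0)"
    unfolding eq .
qed

lemma borel_measurable_cutoff_0: "cutoff L j b 0 \<in> borel_measurable borel"
  unfolding cutoff_0[abs_def] dycut_def by measurable

lemma borel_measurable_cutoff [measurable]:
  assumes b: "b \<in> Basis" and L: "L > 0"
  shows "cutoff L j b k \<in> borel_measurable borel"
  by (induction k) (auto intro: borel_measurable_cutoff_0 dir_deriv_measurable[OF dir_deriv_cutoff[OF b L]])

section \<open>A Plancherel inequality\<close>

lemma nn_integral_reflect:
  fixes h :: "'n::euclidean_space \<Rightarrow> ennreal"
  assumes "h \<in> borel_measurable borel"
  shows "(\<integral>\<^sup>+ y. h (x - y) \<partial>lborel) = (\<integral>\<^sup>+ y. h y \<partial>lborel)"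
  using nn_integral_lborel_affine[OF assms, of "-1" x] by simp

lemma lborel_integral_scale:
  fixes F :: "'n::euclidean_space \<Rightarrow> complex"
  assumes [measurable]: "F \<in> borel_measurable borel" and c: "c > 0"
  shows "(LINT x|lborel. F (c *\<^sub>R x)) = (LINT x|lborel. F x) / c ^ DIM('n)"
proof -
  have "(LINT x|lborel. F x) = (LINT x|density (distr lborel borel (\<lambda>x. 0 + c *\<^sub>R x)) (\<lambda>_. ennreal (\<bar>c\<bar> ^ DIM('n))). F x)"
    using c lborel_affine[of c "0::'n"] by simp
  also have "\<dots> = (\<bar>c\<bar> ^ DIM('n)) *\<^sub>R (LINT x|lborel. F (c *\<^sub>R x))"
    using c by (simp add: integral_density integral_distr)
  finally show ?thesis using c by (simp add: scaleR_conv_of_real)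
qed

lemma norm_FT_le_nn:
  fixes g :: "'n::euclidean_space \<Rightarrow> complex"
  assumes "integrable lborel g"
  shows "ennreal (norm (FT g y)) \<le> (\<integral>\<^sup>+ \<xi>. ennreal (norm (g \<xi>)) \<partial>lborel)"
proof -
  have "ennreal (norm (FT g y)) \<le> ennreal (LINT \<xi>|lborel. norm (g \<xi>))"
    by (rule ennreal_leI[OF norm_FT_le])
  also have "\<dots> = (\<integral>\<^sup>+ \<xi>. ennreal (norm (g \<xi>)) \<partial>lborel)"
    using assms by (intro nn_integral_eq_integral[symmetric]) auto
  finally show ?thesis .
qed

lemma integrable_mult_FT:
  fixes g h :: "'n::euclidean_space \<Rightarrow> complex"
  assumes g: "integrable lborel g" and h: "integrable lborel h"
  shows "integrable lborel (\<lambda>y. g y * FT h (x + y))"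
proof (rule Bochner_Integration.integrable_bound)
  have [measurable]: "g \<in> borel_measurable borel" "h \<in> borel_measurable borel" using g h by auto
  show "integrable lborel (\<lambda>y. g y * of_real (LINT \<xi>|lborel. norm (h \<xi>)))"
    using g by simp
  show "AE y in lborel. norm (g y * FT h (x + y)) \<le> norm (g y * of_real (LINT \<xi>|lborel. norm (h \<xi>)))"
    unfolding norm_mult norm_of_real
    by (intro AE_I2 mult_left_mono order_trans[OF norm_FT_le abs_ge_self]) auto
  show "(\<lambda>y. g y * FT h (x + y)) \<in> borel_measurable lborel" by measurable
qed

lemma FT_multiplication_formula:
  fixes g h :: "'n::euclidean_space \<Rightarrow> complex"
  assumes g: "integrable lborel g" and h: "integrable lborel h"
  shows "(LINT y|lborel. h y * FT g y) = (LINT \<xi>|lborel. g \<xi> * FT h \<xi>)"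
proof -
  have [measurable]: "g \<in> borel_measurable borel" "h \<in> borel_measurable borel" using g h by auto
  have int: "integrable (lborel \<Otimes>\<^sub>M lborel) (\<lambda>(y, \<xi>). h y * (g \<xi> * cis (y \<bullet> \<xi>)))"
  proof (rule lborel_pair.Fubini_integrable)
    show "(\<lambda>(y, \<xi>). h y * (g \<xi> * cis (y \<bullet> \<xi>))) \<in> borel_measurable (lborel \<Otimes>\<^sub>M lborel)"
      by measurable
    show "integrable lborel (\<lambda>y. LINT \<xi>|lborel. norm (case (y, \<xi>) of (y, \<xi>) \<Rightarrow> h y * (g \<xi> * cis (y \<bullet> \<xi>))))"
      using h by (simp add: norm_mult)
    show "AE y in lborel. integrable lborel (\<lambda>\<xi>. case (y, \<xi>) of (y, \<xi>) \<Rightarrow> h y * (g \<xi> * cis (y \<bullet> \<xi>)))"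
      using integrable_cis[OF g] by auto
  qed
  have "(LINT y|lborel. h y * FT g y) = (LINT y|lborel. LINT \<xi>|lborel. h y * (g \<xi> * cis (y \<bullet> \<xi>)))"
    unfolding FT_def by simp
  also have "\<dots> = (LINT \<xi>|lborel. LINT y|lborel. h y * (g \<xi> * cis (y \<bullet> \<xi>)))"
    using lborel_pair.Fubini_integral[OF int] by simp
  also have "\<dots> = (LINT \<xi>|lborel. LINT y|lborel. g \<xi> * (h y * cis (\<xi> \<bullet> y)))"
    by (simp add: mult_ac inner_commute)
  also have "\<dots> = (LINT \<xi>|lborel. g \<xi> * FT h \<xi>)"
    unfolding FT_def by simp
  finally show ?thesis .
qed

lemma FT_modulate: "FT (\<lambda>y. h y * cis (x \<bullet> y)) z = FT h (x + z)"
  unfolding FT_def by (simp add: inner_add_left cis_mult[symmetric] mult_ac)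

lemma FT_reflect:
  fixes g :: "'n::euclidean_space \<Rightarrow> complex"
  assumes [measurable]: "g \<in> borel_measurable borel"
  shows "FT (\<lambda>y. g (- y)) z = FT g (- z)"
proof -
  have "FT g (- z) = (LINT y|density (distr lborel borel (\<lambda>x. 0 + (-1) *\<^sub>R x)) (\<lambda>_. ennreal (\<bar>-1::real\<bar> ^ DIM('n))). g y * cis (- (z \<bullet> y)))"
    using lborel_affine[of "-1" "0::'n"] unfolding FT_def by simp
  also have "\<dots> = FT (\<lambda>y. g (- y)) z"
    unfolding FT_def by (subst integral_density; simp add: integral_distr)
  finally show ?thesis by simp
qed

lemma integrable_reflect:
  fixes g :: "'n::euclidean_space \<Rightarrow> complex"
  assumes g: "integrable lborel g"
  shows "integrable lborel (\<lambda>y. g (- y))"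
proof -
  have [measurable]: "g \<in> borel_measurable borel" using g by auto
  have "(\<integral>\<^sup>+ y. ennreal (norm (g (0 - y))) \<partial>lborel) = (\<integral>\<^sup>+ y. ennreal (norm (g y)) \<partial>lborel)"
    by (rule nn_integral_reflect) measurable
  then show ?thesis using g by (simp add: integrable_iff_bounded)
qed

lemma cnj_FT:
  fixes g :: "'n::euclidean_space \<Rightarrow> complex"
  assumes [measurable]: "g \<in> borel_measurable borel"
  shows "cnj (FT g z) = FT (\<lambda>y. cnj (g (- y))) z"
proof -
  have m: "(\<lambda>y. cnj (g y)) \<in> borel_measurable borel"
    using borel_measurable_continuous_onI[of cnj] by (intro measurable_compose[OF assms]) (auto intro: continuous_intros)
  have "FT (\<lambda>y. cnj (g (- y))) z = FT (\<lambda>y. cnj (g y)) (- z)"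
    by (rule FT_reflect[OF m])
  also have "\<dots> = cnj (FT g z)"
    unfolding FT_def Bochner_Integration.integral_cnj[symmetric] by (simp add: cis_cnj)
  finally show ?thesis by simp
qed

text \<open>Schur's test: the product of the two values of \<open>u\<close> is at most the sum of
  their squares, and in each half the kernel is integrated over the other variable. The lost factor
  2 is harmless.\<close>

lemma nn_integral_convolution_le:
  fixes u k :: "'n::euclidean_space \<Rightarrow> real"
  assumes [measurable]: "u \<in> borel_measurable borel" "k \<in> borel_measurable borel"
    and nn: "\<And>x. 0 \<le> u x" "\<And>x. 0 \<le> k x"
  shows "(\<integral>\<^sup>+ x. (\<integral>\<^sup>+ y. ennreal (u x * u (- y) * k (x + y)) \<partial>lborel) \<partial>lborel)
    \<le> 2 * ((\<integral>\<^sup>+ x. ennreal (k x) \<partial>lborel) * (\<integral>\<^sup>+ x. ennreal (u x ^ 2) \<partial>lborel))"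
proof -
  let ?K = "\<integral>\<^sup>+ x. ennreal (k x) \<partial>lborel" and ?U = "\<integral>\<^sup>+ x. ennreal (u x ^ 2) \<partial>lborel"
  have pt: "ennreal (u x * u (- y) * k (x + y))
      \<le> ennreal (u x ^ 2) * ennreal (k (x + y)) + ennreal (u (- y) ^ 2) * ennreal (k (x + y))" for x y
  proof -
    have "u x * u (- y) \<le> u x ^ 2 + u (- y) ^ 2"
      using sum_squares_bound[of "u x" "u (- y)"] mult_nonneg_nonneg[OF nn(1)[of x] nn(1)[of "- y"]] by linarith
    from mult_right_mono[OF this nn(2)[of "x + y"]]
    have "ennreal (u x * u (- y) * k (x + y)) \<le> ennreal ((u x ^ 2 + u (- y) ^ 2) * k (x + y))"
      by (intro ennreal_leI)
    then show ?thesis using nn by (simp add: ennreal_mult distrib_right)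
  qed
  have k1: "(\<integral>\<^sup>+ y. ennreal (k (x + y)) \<partial>lborel) = ?K" for x :: 'n
    using nn_integral_lborel_affine[of "\<lambda>y. ennreal (k y)" 1 x] by simp
  have u1: "(\<integral>\<^sup>+ y. ennreal (u (- y) ^ 2) \<partial>lborel) = ?U"
    using nn_integral_reflect[of "\<lambda>y. ennreal (u y ^ 2)" 0] by simp
  have A: "(\<integral>\<^sup>+ x. (\<integral>\<^sup>+ y. ennreal (u x ^ 2) * ennreal (k (x + y)) \<partial>lborel) \<partial>lborel) = ?K * ?U"
    by (simp add: nn_integral_cmult k1 nn_integral_multc mult.commute)
  have "(\<integral>\<^sup>+ x. (\<integral>\<^sup>+ y. ennreal (u (- y) ^ 2) * ennreal (k (x + y)) \<partial>lborel) \<partial>lborel)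
      = (\<integral>\<^sup>+ y. (\<integral>\<^sup>+ x. ennreal (u (- y) ^ 2) * ennreal (k (x + y)) \<partial>lborel) \<partial>lborel)"
    by (rule lborel_pair.Fubini') measurable
  also have "\<dots> = (\<integral>\<^sup>+ y. ennreal (u (- y) ^ 2) * ?K \<partial>lborel)"
    using k1 by (simp add: nn_integral_cmult add.commute)
  also have "\<dots> = ?K * ?U" by (subst nn_integral_multc) (simp_all add: u1 mult.commute)
  finally have B: "(\<integral>\<^sup>+ x. (\<integral>\<^sup>+ y. ennreal (u (- y) ^ 2) * ennreal (k (x + y)) \<partial>lborel) \<partial>lborel) = ?K * ?U" .
  have "(\<integral>\<^sup>+ x. (\<integral>\<^sup>+ y. ennreal (u x * u (- y) * k (x + y)) \<partial>lborel) \<partial>lborel)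
    \<le> (\<integral>\<^sup>+ x. (\<integral>\<^sup>+ y. ennreal (u x ^ 2) * ennreal (k (x + y)) + ennreal (u (- y) ^ 2) * ennreal (k (x + y)) \<partial>lborel) \<partial>lborel)"
    by (intro nn_integral_mono pt)
  also have "\<dots> = (\<integral>\<^sup>+ x. (\<integral>\<^sup>+ y. ennreal (u x ^ 2) * ennreal (k (x + y)) \<partial>lborel)
      + (\<integral>\<^sup>+ y. ennreal (u (- y) ^ 2) * ennreal (k (x + y)) \<partial>lborel) \<partial>lborel)"
    by (intro nn_integral_cong nn_integral_add) measurable
  also have "\<dots> = (\<integral>\<^sup>+ x. (\<integral>\<^sup>+ y. ennreal (u x ^ 2) * ennreal (k (x + y)) \<partial>lborel) \<partial>lborel)
      + (\<integral>\<^sup>+ x. (\<integral>\<^sup>+ y. ennreal (u (- y) ^ 2) * ennreal (k (x + y)) \<partial>lborel) \<partial>lborel)"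
    by (intro nn_integral_add) measurable
  also have "\<dots> = 2 * (?K * ?U)" unfolding A B by (simp add: mult_2)
  finally show ?thesis .
qed

text \<open>Without Fourier inversion, Plancherel's inequality is obtained by weighting \<open>|FT g|\<^sup>2\<close> with an integrable
  \<open>\<phi> \<ge> 0\<close>, which turns the integral into a convolution form with kernel \<open>FT \<phi>\<close>, and dilating \<open>\<phi>\<close> to a constant.\<close>

lemma FT_weighted_L2:
  fixes g \<phi> :: "'n::euclidean_space \<Rightarrow> complex"
  assumes g: "integrable lborel g" and \<phi>: "integrable lborel \<phi>"
    and pos: "\<And>y. \<phi> y = of_real (w y)" "\<And>y. 0 \<le> w y"
  shows "(\<integral>\<^sup>+ y. ennreal (w y * norm (FT g y) ^ 2) \<partial>lborel)
    \<le> 2 * ((\<integral>\<^sup>+ y. ennreal (norm (FT \<phi> y)) \<partial>lborel) * square_mass g)"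
proof -
  have [measurable]: "g \<in> borel_measurable borel" "\<phi> \<in> borel_measurable borel" using g \<phi> by auto
  define M where "M = (LINT \<xi>|lborel. norm (g \<xi>))"
  define g' where "g' y = cnj (g (- y))" for y
  have g': "integrable lborel g'" unfolding g'_def using integrable_reflect[OF g] by simp
  \<comment> \<open>The product \<open>h * FT g\<close> is the weighted squared modulus. The
    multiplication formula moves the transform from \<open>g\<close> to \<open>h\<close>; since
    \<open>h\<close> is \<phi> times \<open>FT g'\<close>, a second use moves it onto a modulated
    \<phi>, which produces the kernel \<open>FT \<phi> (\<xi> + \<eta>)\<close>.\<close>
  define h where "h y = \<phi> y * cnj (FT g y)" for y
  have h_eq: "h y = \<phi> y * FT g' y" for y unfolding h_def g'_def by (simp add: cnj_FT)
  have [measurable]: "g' \<in> borel_measurable borel" using g' by auto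
  have hm: "h \<in> borel_measurable lborel" unfolding h_eq[abs_def] by measurable
  have h: "integrable lborel h"
  proof (rule Bochner_Integration.integrable_bound)
    show "integrable lborel (\<lambda>y. \<phi> y * of_real M)" using \<phi> by simp
    show "AE y in lborel. norm (h y) \<le> norm (\<phi> y * of_real M)"
      using norm_FT_le[of g] unfolding h_def norm_mult complex_mod_cnj
      by (auto intro!: mult_left_mono simp: M_def intro: order_trans[OF _ abs_ge_self])
  qed (fact hm)
  have hF: "h y * FT g y = of_real (w y * norm (FT g y) ^ 2)" for y
    unfolding h_def pos(1) by (simp add: complex_norm_square mult_ac del: of_real_power)
  have wi: "integrable lborel (\<lambda>y. h y * FT g y)"
  proof (rule Bochner_Integration.integrable_bound)
    show "integrable lborel (\<lambda>y. h y * of_real M)" using h by simp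
    show "AE y in lborel. norm (h y * FT g y) \<le> norm (h y * of_real M)"
      using norm_FT_le[of g] unfolding norm_mult
      by (auto intro!: mult_left_mono simp: M_def intro: order_trans[OF _ abs_ge_self])
  qed (use hm in measurable)
  have wr: "integrable lborel (\<lambda>y. w y * norm (FT g y) ^ 2)"
    using integrable_Re[OF wi] unfolding hF Re_complex_of_real .
  have "(\<integral>\<^sup>+ y. ennreal (w y * norm (FT g y) ^ 2) \<partial>lborel) = ennreal (LINT y|lborel. w y * norm (FT g y) ^ 2)"
    using wr by (intro nn_integral_eq_integral) (auto simp: pos(2))
  also have "(LINT y|lborel. w y * norm (FT g y) ^ 2) = norm (LINT y|lborel. h y * FT g y)"
    unfolding hF by (simp add: pos(2) integral_nonneg_AE del: of_real_mult of_real_power)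
  also have "\<dots> = norm (LINT \<xi>|lborel. g \<xi> * FT h \<xi>)"
    by (simp add: FT_multiplication_formula[OF g h])
  also have "ennreal \<dots> \<le> (\<integral>\<^sup>+ \<xi>. ennreal (norm (g \<xi> * FT h \<xi>)) \<partial>lborel)"
    using integrable_mult_FT[OF g h, of 0] by (intro integral_norm_bound_ennreal) simp
  also have "\<dots> \<le> (\<integral>\<^sup>+ \<xi>. (\<integral>\<^sup>+ \<eta>. ennreal (norm (g \<xi>) * norm (g (- \<eta>)) * norm (FT \<phi> (\<xi> + \<eta>))) \<partial>lborel) \<partial>lborel)"
  proof (rule nn_integral_mono)
    fix \<xi> :: 'n
    have \<phi>c: "integrable lborel (\<lambda>y. \<phi> y * cis (\<xi> \<bullet> y))" by (rule integrable_cis[OF \<phi>])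
    have "FT h \<xi> = (LINT y|lborel. (\<phi> y * cis (\<xi> \<bullet> y)) * FT g' y)"
      unfolding FT_def[of h] h_eq by (simp add: mult_ac)
    also have "\<dots> = (LINT \<eta>|lborel. g' \<eta> * FT \<phi> (\<xi> + \<eta>))"
      unfolding FT_multiplication_formula[OF g' \<phi>c] FT_modulate ..
    finally have e: "FT h \<xi> = (LINT \<eta>|lborel. g' \<eta> * FT \<phi> (\<xi> + \<eta>))" .
    have "integrable lborel (\<lambda>\<eta>. g' \<eta> * FT \<phi> (\<xi> + \<eta>))"
      by (rule integrable_mult_FT[OF g' \<phi>])
    then have "ennreal (norm (FT h \<xi>)) \<le> (\<integral>\<^sup>+ \<eta>. ennreal (norm (g' \<eta> * FT \<phi> (\<xi> + \<eta>))) \<partial>lborel)"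
      unfolding e by (rule integral_norm_bound_ennreal)
    then have "ennreal (norm (g \<xi>)) * ennreal (norm (FT h \<xi>))
        \<le> ennreal (norm (g \<xi>)) * (\<integral>\<^sup>+ \<eta>. ennreal (norm (g' \<eta> * FT \<phi> (\<xi> + \<eta>))) \<partial>lborel)"
      by (rule mult_left_mono) simp
    also have "\<dots> = (\<integral>\<^sup>+ \<eta>. ennreal (norm (g \<xi>)) * ennreal (norm (g' \<eta> * FT \<phi> (\<xi> + \<eta>))) \<partial>lborel)"
      by (rule nn_integral_cmult[symmetric]) measurable
    finally show "ennreal (norm (g \<xi> * FT h \<xi>))
        \<le> (\<integral>\<^sup>+ \<eta>. ennreal (norm (g \<xi>) * norm (g (- \<eta>)) * norm (FT \<phi> (\<xi> + \<eta>))) \<partial>lborel)"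
      by (simp add: norm_mult ennreal_mult g'_def mult.assoc)
  qed
  also have "\<dots> \<le> 2 * ((\<integral>\<^sup>+ y. ennreal (norm (FT \<phi> y)) \<partial>lborel) * square_mass g)"
    by (rule nn_integral_convolution_le) auto
  finally show ?thesis .
qed

section \<open>Integrability of the zeroth cutoff and of its transform\<close>

lemma integrable_jbr_powr_bound:
  fixes u :: "'n::euclidean_space \<Rightarrow> complex"
  assumes "\<tau> > real DIM('n)" and [measurable]: "u \<in> borel_measurable borel"
    and le: "\<And>x. norm (u x) \<le> C * jbr x powr (-\<tau>)"
  shows "integrable lborel u"
proof -
  have C: "0 \<le> C" using order_trans[OF norm_ge_zero le[of 0]] by (simp add: jbr_def zero_le_mult_iff)
  have "(\<integral>\<^sup>+ x. ennreal (norm (u x)) \<partial>lborel) \<le> (\<integral>\<^sup>+ x. ennreal C * ennreal (jbr x powr (-\<tau>)) \<partial>(lborel :: 'n measure))"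
    using le C by (intro nn_integral_mono) (simp add: ennreal_mult[symmetric] ennreal_leI)
  also have "\<dots> = ennreal C * (\<integral>\<^sup>+ x. ennreal (jbr x powr (-\<tau>)) \<partial>(lborel :: 'n measure))"
    by (rule nn_integral_cmult) measurable
  also have "\<dots> < \<infinity>" using nn_integral_jbr_powr_finite[OF assms(1)] by (simp add: ennreal_mult_less_top)
  finally show ?thesis by (simp add: integrable_iff_bounded)
qed

text \<open>Each coordinate power of the weight is absorbed by differentiating n + 1 times along
  that coordinate. The chains \<open>G b\<close> differ from direction to direction and share only
  their first member \<open>g\<close>.\<close>

lemma wt_norm_FT_le:
  fixes y :: "'n::euclidean_space"
  assumes R: "R \<ge> 0"
    and G: "\<And>b k. b \<in> Basis \<Longrightarrow> dir_deriv b (G b k) (G b (Suc k))"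
    and I: "\<And>b k. b \<in> Basis \<Longrightarrow> k \<le> Suc DIM('n) \<Longrightarrow> integrable lborel (G b k)"
    and G0: "\<And>b. b \<in> Basis \<Longrightarrow> G b 0 = g"
  shows "wt R y * norm (FT g y) = norm (FT g y) + (\<Sum>b\<in>Basis. R ^ Suc DIM('n) * norm (FT (G b (Suc DIM('n))) y))"
proof -
  have "(R * \<bar>y \<bullet> b\<bar>) ^ Suc DIM('n) * norm (FT g y) = R ^ Suc DIM('n) * norm (FT (G b (Suc DIM('n))) y)"
    if b: "b \<in> Basis" for b
    using norm_FT_iterated_dir_deriv[of b "G b" "Suc DIM('n)" y] G[OF b] I[OF b] G0[OF b]
    by (simp add: power_mult_distrib mult_ac)
  then show ?thesis unfolding wt_def by (simp add: distrib_right sum_distrib_right del: power_Suc)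
qed

lemma integrable_cutoff:
  fixes b :: "'n::euclidean_space"
  assumes b: "b \<in> Basis" and L: "real DIM('n) < 2 * real L"
  shows "integrable lborel (cutoff L 0 b k)"
proof -
  have L0: "L > 0" using L by (cases L) auto
  define C where "C = fact k * (6 * 4 ^ L * (12 * real L) ^ k)"
  show ?thesis
  proof (rule integrable_jbr_powr_bound[OF L])
    show "cutoff L 0 b k \<in> borel_measurable borel" by (rule borel_measurable_cutoff[OF b L0])
    fix x :: 'n
    have "norm (cutoff L 0 b k x) \<le> C / (jbr x ^ 2) ^ L / jbr x ^ k"
      using cutoff_bound(2)[OF b L0, of 0 k x] by (simp add: C_def)
    also have "\<dots> \<le> C / (jbr x ^ 2) ^ L / 1"
      using jbr_ge_one[of x] by (intro divide_left_mono) (auto simp: C_def one_le_power)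
    also have "\<dots> = C * jbr x powr (- (2 * real L))"
      using powr_realpow[OF jbr_pos[of x], of "2 * L"]
      by (simp add: powr_minus divide_inverse power_mult)
    finally show "norm (cutoff L 0 b k x) \<le> C * jbr x powr - (2 * real L)" .
  qed
qed

text \<open>The zeroth cutoff serves as the weight \<phi> in Plancherel's inequality. Its
  derivatives up to order n + 1 are integrable, so its transform is dominated by a multiple of
  \<open>1 / wt 1\<close>.\<close>

lemma nn_integral_FT_cutoff_finite:
  fixes b :: "'n::euclidean_space"
  assumes b: "b \<in> Basis" and L: "real DIM('n) < 2 * real L"
  shows "(\<integral>\<^sup>+ y. ennreal (norm (FT (cutoff L 0 b 0) y)) \<partial>lborel) < \<infinity>"
proof -
  have L0: "L > 0" using L by (cases L) auto
  define N where "N = Suc DIM('n)"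
  define g where "g = cutoff L 0 b 0"
  have g0: "cutoff L 0 b' 0 = g" for b' by (simp add: g_def cutoff_0[abs_def])
  have [measurable]: "g \<in> borel_measurable borel" unfolding g_def by (rule borel_measurable_cutoff[OF b L0])
  define K where "K = (LINT x|lborel. norm (g x)) + (\<Sum>b\<in>(Basis :: 'n set). LINT x|lborel. norm (cutoff L 0 b N x))"
  have K: "0 \<le> K" unfolding K_def by (intro add_nonneg_nonneg sum_nonneg) auto
  have w: "wt 1 y * norm (FT g y) \<le> K" for y
  proof -
    have "wt 1 y * norm (FT g y) = norm (FT g y) + (\<Sum>b\<in>Basis. 1 ^ Suc DIM('n) * norm (FT (cutoff L 0 b (Suc DIM('n))) y))"
      by (rule wt_norm_FT_le) (auto intro: dir_deriv_cutoff L0 integrable_cutoff L g0)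
    also have "\<dots> \<le> K" unfolding K_def N_def power_one mult_1_left
      by (intro add_mono sum_mono norm_FT_le)
    finally show ?thesis .
  qed
  obtain C where C: "C \<ge> 0" "(\<integral>\<^sup>+ y. ennreal (1 / wt 1 y) \<partial>(lborel :: 'n measure)) = ennreal C"
  proof (rule nn_integral_inverse_wt[where 'n='n])
    fix C :: real assume "0 \<le> C" "\<And>R. 0 < R \<Longrightarrow> (\<integral>\<^sup>+ y. ennreal (1 / wt R y) \<partial>(lborel :: 'n measure)) = ennreal (C / R ^ DIM('n))"
    from this(1) this(2)[of 1] show ?thesis by (intro that) auto
  qed
  have "(\<integral>\<^sup>+ y. ennreal (norm (FT g y)) \<partial>lborel) \<le> (\<integral>\<^sup>+ y. ennreal K * ennreal (1 / wt 1 y) \<partial>(lborel :: 'n measure))"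
  proof (rule nn_integral_mono)
    fix y :: 'n
    have "0 < wt 1 y" using wt_ge_one[of 1 y] by simp
    then have "norm (FT g y) \<le> K * (1 / wt 1 y)" using w[of y] by (simp add: field_simps)
    then show "ennreal (norm (FT g y)) \<le> ennreal K * ennreal (1 / wt 1 y)"
      using K \<open>0 < wt 1 y\<close> by (simp add: ennreal_mult[symmetric] ennreal_leI)
  qed
  also have "\<dots> = ennreal K * ennreal C" unfolding C(2)[symmetric] by (rule nn_integral_cmult) measurable
  also have "\<dots> < \<infinity>" by (simp add: ennreal_mult_less_top)
  finally show ?thesis by (simp add: g_def)
qed

lemma Plancherel_bound:
  obtains C :: real where "C > 0"
    "\<And>g :: 'n::euclidean_space \<Rightarrow> complex. integrable lborel g \<Longrightarrow>
      square_mass (FT g) \<le> ennreal C * square_mass g"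
proof -
  obtain b :: 'n where b: "b \<in> Basis" using nonempty_Basis by blast
  define L where "L = Suc DIM('n)"
  define \<phi> where "\<phi> = cutoff L 0 b 0"
  have L: "real DIM('n) < 2 * real L" "L > 0" by (auto simp: L_def)
  define w where "w y = 1 / (1 + (jbr y ^ 2) ^ L)" for y :: 'n
  have \<phi>w: "\<phi> y = of_real (w y)" for y
    by (simp add: \<phi>_def cutoff_0 dycut_def w_def)
  have w0: "0 \<le> w y" for y by (simp add: w_def)
  have \<phi>m [measurable]: "\<phi> \<in> borel_measurable borel" unfolding \<phi>_def by (rule borel_measurable_cutoff[OF b L(2)])
  have \<phi>i: "integrable lborel \<phi>" unfolding \<phi>_def by (rule integrable_cutoff[OF b L(1)])
  have wm [measurable]: "w \<in> borel_measurable borel" unfolding w_def[abs_def] by measurable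
  define K where "K = enn2real (\<integral>\<^sup>+ y. ennreal (norm (FT \<phi> y)) \<partial>lborel)"
  have K: "(\<integral>\<^sup>+ y. ennreal (norm (FT \<phi> y)) \<partial>lborel) = ennreal K" "K \<ge> 0"
    using nn_integral_FT_cutoff_finite[OF b L(1)] by (auto simp: K_def \<phi>_def)
  have scaled: "(\<integral>\<^sup>+ y. ennreal (w (e *\<^sub>R y) * norm (FT g y) ^ 2) \<partial>lborel)
      \<le> ennreal (2 * K) * square_mass g"
    if g: "integrable lborel g" and e: "e > 0" for g and e :: real
  proof -
    define \<psi> where "\<psi> y = \<phi> (e *\<^sub>R y)" for y
    have "(\<integral>\<^sup>+ y. ennreal (norm (\<phi> (0 + e *\<^sub>R y))) \<partial>lborel) < \<infinity>"
      using e \<phi>i by (subst nn_integral_lborel_affine) (auto simp: integrable_iff_bounded ennreal_mult_less_top)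
    then have \<psi>: "integrable lborel \<psi>"
      unfolding \<psi>_def[abs_def] by (simp add: integrable_iff_bounded)
    \<comment> \<open>Dilating \<phi> dilates its transform inversely and preserves the L^1 norm of
      the transform; this makes the bound uniform in \<open>e\<close>.\<close>
    have "FT \<psi> z = FT \<phi> (0 + (1 / e) *\<^sub>R z) / e ^ DIM('n)" for z
    proof -
      have "FT \<psi> z = (LINT y|lborel. (\<lambda>y. \<phi> y * cis (((1 / e) *\<^sub>R z) \<bullet> y)) (e *\<^sub>R y))"
        using e by (simp add: FT_def \<psi>_def)
      then show ?thesis using e by (subst (asm) lborel_integral_scale) (auto simp: FT_def)
    qed
    then have "(\<integral>\<^sup>+ y. ennreal (norm (FT \<psi> y)) \<partial>lborel)
        = (\<integral>\<^sup>+ y. ennreal (1 / e ^ DIM('n)) * ennreal (norm (FT \<phi> (0 + (1 / e) *\<^sub>R y))) \<partial>lborel)"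
      using e by (simp add: norm_divide ennreal_mult[symmetric] norm_power)
    also have "\<dots> = ennreal (1 / e ^ DIM('n)) * (ennreal (1 / \<bar>1 / e\<bar> ^ DIM('n)) * ennreal K)"
      unfolding K(1)[symmetric] using e
      by (subst nn_integral_cmult, simp, subst nn_integral_lborel_affine) auto
    also have "\<dots> = ennreal K"
      using e K(2) by (simp add: ennreal_mult[symmetric] power_divide)
    finally have "(\<integral>\<^sup>+ y. ennreal (norm (FT \<psi> y)) \<partial>lborel) = ennreal K" .
    then have "(\<integral>\<^sup>+ y. ennreal (w (e *\<^sub>R y) * norm (FT g y) ^ 2) \<partial>lborel)
       \<le> 2 * (ennreal K * square_mass g)"
      using FT_weighted_L2[OF g \<psi>, of "\<lambda>y. w (e *\<^sub>R y)"] w0 by (simp add: \<psi>_def \<phi>w)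
    also have "\<dots> = ennreal (2 * K) * square_mass g"
      using K(2) by (simp add: ennreal_mult mult.assoc)
    finally show ?thesis .
  qed
  show thesis
  \<comment> \<open>The weighted bound has constant 2 K. As \<open>e\<close> tends to 0 the weight
    tends to \<open>w 0 = 1/2\<close>, and Fatou's lemma costs one more factor 2. The added 1
    secures positivity.\<close>
  proof (rule that[of "4 * K + 1"])
    show "4 * K + 1 > 0" using K(2) by simp
    fix g :: "'n \<Rightarrow> complex" assume g: "integrable lborel g"
    have [measurable]: "g \<in> borel_measurable borel" using g by auto
    let ?I = "\<integral>\<^sup>+ y. ennreal (norm (g y) ^ 2) \<partial>lborel"
    define u where "u k y = ennreal (w ((1 / real (Suc k)) *\<^sub>R y) * norm (FT g y) ^ 2)" for k y
    have lim: "(\<lambda>k. u k y) \<longlonglongrightarrow> ennreal (1/2 * norm (FT g y) ^ 2)" for y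
    proof -
      have "1 + (1 + norm y ^ 2) ^ L \<noteq> 0" for y :: 'n
        using zero_less_power[of "1 + norm y ^ 2" L] by (simp add: add_pos_nonneg less_imp_neq[symmetric])
      then have c: "continuous_on UNIV w" unfolding w_def[abs_def] jbr_square
        by (intro continuous_intros) auto
      have "(\<lambda>k. (1 / real (Suc k)) *\<^sub>R y) \<longlonglongrightarrow> 0 *\<^sub>R y"
        using LIMSEQ_Suc[OF lim_1_over_n[where 'a=real]] by (intro tendsto_scaleR) auto
      from continuous_on_tendsto_compose[OF c this]
      have "(\<lambda>k. w ((1 / real (Suc k)) *\<^sub>R y)) \<longlonglongrightarrow> 1/2"
        by (simp add: w_def jbr_def)
      then show ?thesis unfolding u_def by (intro tendsto_ennrealI tendsto_mult tendsto_const)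
    qed
    have "(\<integral>\<^sup>+ y. ennreal (1/2 * norm (FT g y) ^ 2) \<partial>lborel) = (\<integral>\<^sup>+ y. liminf (\<lambda>k. u k y) \<partial>lborel)"
      by (intro nn_integral_cong lim_imp_Liminf[symmetric] lim) simp
    also have "\<dots> \<le> liminf (\<lambda>k. \<integral>\<^sup>+ y. u k y \<partial>lborel)"
      by (rule nn_integral_liminf) (simp add: u_def)
    also have "\<dots> \<le> liminf (\<lambda>k. ennreal (2 * K) * ?I)"
      by (intro Liminf_mono always_eventually allI) (auto simp: u_def intro!: scaled[OF g])
    also have "\<dots> = ennreal (2 * K) * ?I" by (simp add: Liminf_const)
    finally have le: "(\<integral>\<^sup>+ y. ennreal (1/2 * norm (FT g y) ^ 2) \<partial>lborel) \<le> ennreal (2 * K) * ?I" .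
    have "square_mass (FT g) = (\<integral>\<^sup>+ y. ennreal 2 * ennreal (1/2 * norm (FT g y) ^ 2) \<partial>lborel)"
      by (intro nn_integral_cong) (subst ennreal_mult[symmetric]; simp)
    also have "\<dots> = ennreal 2 * (\<integral>\<^sup>+ y. ennreal (1/2 * norm (FT g y) ^ 2) \<partial>lborel)"
      by (rule nn_integral_cmult) measurable
    also have "\<dots> \<le> ennreal 2 * (ennreal (2 * K) * ?I)" by (rule mult_left_mono[OF le]) simp
    also have "\<dots> = ennreal (4 * K) * ?I"
      unfolding mult.assoc[symmetric] using K(2) by (subst ennreal_mult[symmetric]) auto
    also have "\<dots> \<le> ennreal (4 * K + 1) * ?I" by (intro mult_right_mono ennreal_leI) auto
    finally show "square_mass (FT g) \<le> ennreal (4 * K + 1) * ?I" .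
  qed
qed

section \<open>The Hausdorff--Young inequality in bilinear form\<close>

lemma nn_integral_powr_le:
  fixes a c :: real
  assumes "a > -1" "c \<ge> 0"
  shows "(\<integral>\<^sup>+ l. (if 0 < l \<and> l \<le> c then ennreal (l powr a) else 0) \<partial>lborel) \<le> ennreal (c powr (a + 1) / (a + 1))"
proof -
  have "((\<lambda>l. if l \<in> {0..c} then l powr a else 0) has_integral (c powr (a + 1) / (a + 1))) UNIV"
    unfolding has_integral_restrict_UNIV by (rule has_integral_powr_from_0[OF assms])
  then have "(\<integral>\<^sup>+ l. ennreal (if l \<in> {0..c} then l powr a else 0) \<partial>lborel) = ennreal (c powr (a + 1) / (a + 1))"
    by (intro nn_integral_has_integral_lborel) auto
  moreover have "(\<integral>\<^sup>+ l. (if 0 < l \<and> l \<le> c then ennreal (l powr a) else 0) \<partial>lborel)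
      \<le> (\<integral>\<^sup>+ l. ennreal (if l \<in> {0..c} then l powr a else 0) \<partial>lborel)"
    by (intro nn_integral_mono) auto
  ultimately show ?thesis by simp
qed

lemma nn_integral_layer:
  fixes c :: real
  assumes "c \<ge> 0"
  shows "(\<integral>\<^sup>+ l. (if 0 < l \<and> l < c then 1 else 0) \<partial>lborel) = ennreal c"
proof -
  have "(\<integral>\<^sup>+ l. (if 0 < l \<and> l < c then 1 else 0) \<partial>lborel) = (\<integral>\<^sup>+ l. indicator {0<..<c} l \<partial>lborel)"
    by (intro nn_integral_cong) (auto simp: indicator_def)
  then show ?thesis using assms by simp
qed

text \<open>Layer cake in \<open>h\<close>: at height \<open>l\<close> the function \<open>g\<close> is split where \<open>norm g\<close> crosses \<open>1 / l\<close>, the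
  large part being estimated by the \<open>L\<^sup>1\<close>--\<open>L\<^sup>\<infinity>\<close> bound and the small part by Plancherel.\<close>

lemma FT_bilinear_strict:
  fixes g :: "'n::euclidean_space \<Rightarrow> complex" and h :: "'n \<Rightarrow> real"
  assumes s: "1 < s" "s < 2" and C: "C > 0"
    and Pl: "\<And>g :: 'n \<Rightarrow> complex. integrable lborel g \<Longrightarrow>
      square_mass (FT g) \<le> ennreal C * square_mass g"
    and g: "integrable lborel g" and h [measurable]: "h \<in> borel_measurable borel" and h0: "\<And>y. 0 \<le> h y"
  defines "G \<equiv> \<integral>\<^sup>+ x. ennreal (norm (g x) powr s) \<partial>lborel" and "H \<equiv> \<integral>\<^sup>+ y. ennreal (h y powr s) \<partial>lborel"
  shows "FT_pairing g h
    \<le> G * H + (ennreal (C / (2 - s)) * G + ennreal (1 / s) * H)"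
proof -
  let ?D = "\<lambda>(l :: real) y. if 0 < l \<and> l < h y then 1 else 0 :: ennreal"
  let ?D'' = "\<lambda>l y. if 0 < l \<and> l < h y then ennreal (l powr (s - 1)) else 0"
  let ?B = "\<lambda>l x. if norm (g x) * l > 1 then ennreal (norm (g x)) else 0"
  let ?S = "\<lambda>l x. if 0 < l \<and> norm (g x) * l \<le> 1 then ennreal C * ennreal (l powr (1 - s)) * ennreal (norm (g x) ^ 2) else 0"
  have [measurable]: "g \<in> borel_measurable borel" using g by auto
  define gs where "gs l x = (if norm (g x) * l \<le> 1 then g x else 0)" for l :: real and x
  define gb where "gb l x = (if norm (g x) * l > 1 then g x else 0)" for l :: real and x
  have gs: "integrable lborel (gs l)" for l
    by (rule Bochner_Integration.integrable_bound[OF g]) (auto simp: gs_def[abs_def])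
  have gb: "integrable lborel (gb l)" for l
    by (rule Bochner_Integration.integrable_bound[OF g]) (auto simp: gb_def[abs_def])
  define B where "B l = (\<integral>\<^sup>+ x. ?B l x \<partial>lborel)" for l :: real
  define S where "S l = (\<integral>\<^sup>+ x. (if norm (g x) * l \<le> 1 then ennreal (norm (g x) ^ 2) else 0) \<partial>lborel)" for l :: real
  define D where "D l = (\<integral>\<^sup>+ y. ?D l y \<partial>lborel)" for l :: real
  let ?S' = "\<lambda>l. if 0 < l then ennreal (l powr (1 - s)) * (ennreal C * S l) else 0"
  let ?D' = "\<lambda>l. if 0 < l then ennreal (l powr (s - 1)) * D l else 0"
  have [measurable]: "B \<in> borel_measurable borel" "S \<in> borel_measurable borel" "D \<in> borel_measurable borel"
    unfolding B_def[abs_def] S_def[abs_def] D_def[abs_def] by measurable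
  have split: "ennreal (norm (FT g y)) \<le> B l + ennreal (norm (FT (gs l) y))" for l y
  proof -
    have "g x = gb l x + gs l x" for x by (auto simp: gb_def gs_def)
    then have "FT g y = FT (gb l) y + FT (gs l) y"
      unfolding FT_def
      by (subst Bochner_Integration.integral_add[symmetric]) (auto intro!: integrable_cis gb gs simp: distrib_right)
    then have "ennreal (norm (FT g y)) \<le> ennreal (norm (FT (gb l) y)) + ennreal (norm (FT (gs l) y))"
      by (simp add: ennreal_plus[symmetric] norm_triangle_ineq del: ennreal_plus)
    also have "ennreal (norm (FT (gb l) y)) \<le> (\<integral>\<^sup>+ x. ennreal (norm (gb l x)) \<partial>lborel)"
      by (rule norm_FT_le_nn[OF gb])
    also have "\<dots> = B l" unfolding B_def by (intro nn_integral_cong) (auto simp: gb_def)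
    finally show ?thesis by (simp add: add_right_mono)
  qed
  have level: "(\<integral>\<^sup>+ y. ennreal (norm (FT g y)) * ?D l y \<partial>lborel)
      \<le> B l * D l + (if 0 < l then ennreal (l powr (1 - s)) * (ennreal C * S l) + ennreal (l powr (s - 1)) * D l else 0)" for l
  proof (cases "0 < l")
    case True
    have "ennreal (norm (FT g y)) * ?D l y
      \<le> B l * ?D l y + (ennreal (l powr (1 - s)) * ennreal (norm (FT (gs l) y) ^ 2)
         + ennreal (l powr (s - 1)) * ?D l y)" for y
    proof (cases "0 < l \<and> l < h y")
      case True
      define t where "t = norm (FT (gs l) y)"
      \<comment> \<open>Arithmetic-geometric mean inequality. The factor
        \<open>l powr (1 - s)\<close> is chosen so that integration in \<open>l\<close> produces
        exactly s-th powers: of \<open>norm (g x)\<close> from l up to its reciprocal, and of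
        \<open>h y\<close> from l up to \<open>h y\<close>.\<close>
      have "l powr (1 - s) * t ^ 2 + l powr (s - 1) \<ge> t"
      proof -
        define v where "v = l powr ((1 - s) / 2)"
        have v: "v > 0" "l powr (1 - s) = v ^ 2" "l powr (s - 1) = (1 / v) ^ 2"
          using True by (auto simp: v_def powr_realpow[symmetric] powr_powr power2_eq_square powr_add[symmetric] powr_minus_divide[symmetric])
        have "2 * (v * t) * (1 / v) \<le> (v * t) ^ 2 + (1 / v) ^ 2" by (rule sum_squares_bound)
        moreover have "(v * t) * (1 / v) = t" using v by simp
        moreover have "t \<ge> 0" by (simp add: t_def)
        ultimately show ?thesis using v by (simp add: power_mult_distrib)
      qed
      then have "ennreal t \<le> ennreal (l powr (1 - s)) * ennreal (t ^ 2) + ennreal (l powr (s - 1))"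
        by (simp add: ennreal_mult[symmetric] ennreal_plus[symmetric] ennreal_leI del: ennreal_plus)
      then have "B l + ennreal t \<le> B l + (ennreal (l powr (1 - s)) * ennreal (t ^ 2) + ennreal (l powr (s - 1)))"
        by (rule add_left_mono)
      then show ?thesis using order_trans[OF split[of y l]] True by (simp add: t_def)
    qed auto
    then have "(\<integral>\<^sup>+ y. ennreal (norm (FT g y)) * ?D l y \<partial>lborel)
      \<le> (\<integral>\<^sup>+ y. B l * ?D l y + (ennreal (l powr (1 - s)) * ennreal (norm (FT (gs l) y) ^ 2)
         + ennreal (l powr (s - 1)) * ?D l y) \<partial>lborel)"
      by (rule nn_integral_mono)
    also have "\<dots> = B l * D l + (ennreal (l powr (1 - s)) * square_mass (FT (gs l)) + ennreal (l powr (s - 1)) * D l)"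
    proof -
      have [measurable]: "gs l \<in> borel_measurable borel" using gs by auto
      show ?thesis unfolding D_def by (simp add: nn_integral_add nn_integral_cmult)
    qed
    also have "square_mass (FT (gs l)) \<le> ennreal C * S l"
    proof -
      have "(\<integral>\<^sup>+ x. ennreal (norm (gs l x) ^ 2) \<partial>lborel) = S l"
        unfolding S_def by (intro nn_integral_cong) (auto simp: gs_def)
      then show ?thesis using Pl[OF gs[of l]] by simp
    qed
    finally show ?thesis using True by (simp add: add_left_mono add_right_mono mult_left_mono)
  qed (simp add: D_def)
  have "FT_pairing g h
     = (\<integral>\<^sup>+ y. (\<integral>\<^sup>+ l. ennreal (norm (FT g y)) * ?D l y \<partial>lborel) \<partial>lborel)"
    by (simp add: nn_integral_cmult nn_integral_layer h0)
  also have "\<dots> = (\<integral>\<^sup>+ l. (\<integral>\<^sup>+ y. ennreal (norm (FT g y)) * ?D l y \<partial>lborel) \<partial>lborel)"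
    by (rule lborel_pair.Fubini') measurable
  also have "\<dots> \<le> (\<integral>\<^sup>+ l. B l * D l + (if 0 < l then ennreal (l powr (1 - s)) * (ennreal C * S l) + ennreal (l powr (s - 1)) * D l else 0) \<partial>lborel)"
    by (rule nn_integral_mono) (rule level)
  also have "\<dots> = (\<integral>\<^sup>+ l. B l * D l + (?S' l + ?D' l) \<partial>lborel)"
    by (intro nn_integral_cong) auto
  also have "\<dots> = (\<integral>\<^sup>+ l. B l * D l \<partial>lborel) + ((\<integral>\<^sup>+ l. ?S' l \<partial>lborel) + (\<integral>\<^sup>+ l. ?D' l \<partial>lborel))"
    by (subst nn_integral_add, measurable, subst nn_integral_add, measurable)
  also have "\<dots> \<le> G * H + (ennreal (C / (2 - s)) * G + ennreal (1 / s) * H)"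
  proof (intro add_mono)
    have "(\<integral>\<^sup>+ l. B l * D l \<partial>lborel)
      = (\<integral>\<^sup>+ l. (\<integral>\<^sup>+ x. (\<integral>\<^sup>+ y. ?B l x * ?D l y \<partial>lborel) \<partial>lborel) \<partial>lborel)"
      unfolding B_def D_def by (simp add: nn_integral_multc nn_integral_cmult)
    also have "\<dots> = (\<integral>\<^sup>+ x. (\<integral>\<^sup>+ l. (\<integral>\<^sup>+ y. ?B l x * ?D l y \<partial>lborel) \<partial>lborel) \<partial>lborel)"
      by (rule lborel_pair.Fubini') measurable
    also have "\<dots> = (\<integral>\<^sup>+ x. (\<integral>\<^sup>+ y. (\<integral>\<^sup>+ l. ?B l x * ?D l y \<partial>lborel) \<partial>lborel) \<partial>lborel)"
      by (intro nn_integral_cong lborel_pair.Fubini') measurable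
    also have "\<dots> \<le> (\<integral>\<^sup>+ x. (\<integral>\<^sup>+ y. ennreal (norm (g x) powr s) * ennreal (h y powr s) \<partial>lborel) \<partial>lborel)"
    proof (intro nn_integral_mono)
      fix x y :: 'n
      define t where "t = norm (g x)"
      show "(\<integral>\<^sup>+ l. ?B l x * ?D l y \<partial>lborel)
          \<le> ennreal (norm (g x) powr s) * ennreal (h y powr s)"
        unfolding t_def[symmetric]
      \<comment> \<open>The integrand lives on 1/t < l < \<open>h y\<close>. This range is empty
        unless \<open>t * h y > 1\<close>, and then \<open>t * h y\<close> is at most its s-th
        power.\<close>
      proof (cases "t * h y > 1")
        case True
        have "(\<integral>\<^sup>+ l. (if t * l > 1 then ennreal t else 0) * ?D l y \<partial>lborel)
          \<le> (\<integral>\<^sup>+ l. ennreal t * ?D l y \<partial>lborel)"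
          by (intro nn_integral_mono) auto
        also have "\<dots> = ennreal t * ennreal (h y)"
          by (subst nn_integral_cmult) (auto simp: nn_integral_layer h0)
        also have "\<dots> = ennreal (t * h y)" by (simp add: ennreal_mult h0 t_def)
        also have "t * h y = (t * h y) powr 1" using True by simp
        also have "\<dots> \<le> (t * h y) powr s" using True s by (intro powr_mono) auto
        also have "\<dots> = t powr s * h y powr s" using h0 by (simp add: powr_mult t_def)
        finally show "(\<integral>\<^sup>+ l. (if t * l > 1 then ennreal t else 0) * ?D l y \<partial>lborel)
          \<le> ennreal (t powr s) * ennreal (h y powr s)" by (simp add: ennreal_mult ennreal_leI)
      next
        case False
        have "(if t * l > 1 then ennreal t else 0) * ?D l y = 0" for l
          using False mult_left_mono[of l "h y" t] by (auto simp: t_def)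
        then have "(\<integral>\<^sup>+ l. (if t * l > 1 then ennreal t else 0) * ?D l y \<partial>lborel) = (\<integral>\<^sup>+ (l :: real). 0 \<partial>lborel)"
          by (intro nn_integral_cong)
        also have "\<dots> \<le> ennreal (t powr s) * ennreal (h y powr s)" by simp
        finally show "(\<integral>\<^sup>+ l. (if t * l > 1 then ennreal t else 0) * ?D l y \<partial>lborel)
          \<le> ennreal (t powr s) * ennreal (h y powr s)" .
      qed
    qed
    also have "\<dots> = G * H" unfolding G_def H_def by (simp add: nn_integral_multc nn_integral_cmult)
    finally show "(\<integral>\<^sup>+ l. B l * D l \<partial>lborel) \<le> G * H" .
  next
    have "(\<integral>\<^sup>+ l. ?S' l \<partial>lborel)
      = (\<integral>\<^sup>+ l. (\<integral>\<^sup>+ x. ?S l x \<partial>lborel) \<partial>lborel)"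
    proof (rule nn_integral_cong)
      fix l :: real
      have "ennreal (l powr (1 - s)) * (ennreal C * S l) = (\<integral>\<^sup>+ x. (ennreal C * ennreal (l powr (1 - s))) * (if norm (g x) * l \<le> 1 then ennreal (norm (g x) ^ 2) else 0) \<partial>lborel)"
        unfolding S_def by (subst nn_integral_cmult) (auto simp: mult_ac)
      then show "?S' l
        = (\<integral>\<^sup>+ x. ?S l x \<partial>lborel)"
        by (auto intro!: nn_integral_cong)
    qed
    also have "\<dots> = (\<integral>\<^sup>+ x. (\<integral>\<^sup>+ l. ?S l x \<partial>lborel) \<partial>lborel)"
      by (rule lborel_pair.Fubini') measurable
    also have "\<dots> \<le> (\<integral>\<^sup>+ x. ennreal (C / (2 - s)) * ennreal (norm (g x) powr s) \<partial>lborel)"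
    proof (rule nn_integral_mono)
      fix x :: 'n
      define t where "t = norm (g x)"
      show "(\<integral>\<^sup>+ l. ?S l x \<partial>lborel)
        \<le> ennreal (C / (2 - s)) * ennreal (norm (g x) powr s)"
        unfolding t_def[symmetric]
      proof (cases "t = 0")
        case False
        then have t: "t > 0" by (simp add: t_def)
        have "(\<integral>\<^sup>+ l. (if 0 < l \<and> t * l \<le> 1 then ennreal C * ennreal (l powr (1 - s)) * ennreal (t ^ 2) else 0) \<partial>lborel)
          = (\<integral>\<^sup>+ l. (ennreal C * ennreal (t ^ 2)) * (if 0 < l \<and> l \<le> 1 / t then ennreal (l powr (1 - s)) else 0) \<partial>lborel)"
          using t by (intro nn_integral_cong) (auto simp: field_simps)
        also have "\<dots> = (ennreal C * ennreal (t ^ 2)) * (\<integral>\<^sup>+ l. (if 0 < l \<and> l \<le> 1 / t then ennreal (l powr (1 - s)) else 0) \<partial>lborel)"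
          by (rule nn_integral_cmult) measurable
        \<comment> \<open>Convergence at l = 0 is where \<open>s < 2\<close> enters: the exponent 1
          - s exceeds -1.\<close>
        also have "\<dots> \<le> (ennreal C * ennreal (t ^ 2)) * ennreal ((1 / t) powr (1 - s + 1) / (1 - s + 1))"
          using s t by (intro mult_left_mono nn_integral_powr_le) auto
        also have "\<dots> = ennreal (C / (2 - s) * (t ^ 2 * (1 / t) powr (2 - s)))"
          using C s t by (simp add: ennreal_mult[symmetric])
        also have "t ^ 2 * (1 / t) powr (2 - s) = t powr s"
        proof -
          have "(1 / t) powr (2 - s) = t powr (s - 2)"
            using t powr_minus_divide[of t "2 - s"] by (simp add: powr_divide)
          moreover have "t ^ 2 = t powr 2" using t by simp
          ultimately have "t ^ 2 * (1 / t) powr (2 - s) = t powr (2 + (s - 2))"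
            by (simp only: powr_add)
          then show ?thesis by simp
        qed
        also have "ennreal (C / (2 - s) * t powr s) = ennreal (C / (2 - s)) * ennreal (t powr s)"
          using C s by (intro ennreal_mult) auto
        finally show "(\<integral>\<^sup>+ l. (if 0 < l \<and> t * l \<le> 1 then ennreal C * ennreal (l powr (1 - s)) * ennreal (t ^ 2) else 0) \<partial>lborel)
          \<le> ennreal (C / (2 - s)) * ennreal (t powr s)" .
      qed (simp cong: if_cong)
    qed
    also have "\<dots> = ennreal (C / (2 - s)) * G" unfolding G_def by (rule nn_integral_cmult) measurable
    finally show "(\<integral>\<^sup>+ l. ?S' l \<partial>lborel) \<le> ennreal (C / (2 - s)) * G" .
  next
    have "(\<integral>\<^sup>+ l. ?D' l \<partial>lborel)
      = (\<integral>\<^sup>+ l. (\<integral>\<^sup>+ y. ?D'' l y \<partial>lborel) \<partial>lborel)"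
    proof (rule nn_integral_cong)
      fix l :: real
      have "ennreal (l powr (s - 1)) * D l = (\<integral>\<^sup>+ y. ennreal (l powr (s - 1)) * ?D l y \<partial>lborel)"
        unfolding D_def by (subst nn_integral_cmult) auto
      then show "?D' l
        = (\<integral>\<^sup>+ y. ?D'' l y \<partial>lborel)"
        by (auto intro!: nn_integral_cong)
    qed
    also have "\<dots> = (\<integral>\<^sup>+ y. (\<integral>\<^sup>+ l. ?D'' l y \<partial>lborel) \<partial>lborel)"
      by (rule lborel_pair.Fubini') measurable
    also have "\<dots> \<le> (\<integral>\<^sup>+ y. ennreal (1 / s) * ennreal (h y powr s) \<partial>lborel)"
    proof (rule nn_integral_mono)
      fix y :: 'n
      have "(\<integral>\<^sup>+ l. ?D'' l y \<partial>lborel)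
        \<le> (\<integral>\<^sup>+ l. (if 0 < l \<and> l \<le> h y then ennreal (l powr (s - 1)) else 0) \<partial>lborel)"
        by (intro nn_integral_mono) auto
      also have "\<dots> \<le> ennreal (h y powr (s - 1 + 1) / (s - 1 + 1))"
        using s h0 by (intro nn_integral_powr_le) auto
      also have "\<dots> = ennreal (1 / s) * ennreal (h y powr s)" using s by (simp add: ennreal_mult[symmetric])
      finally show "(\<integral>\<^sup>+ l. ?D'' l y \<partial>lborel) \<le> ennreal (1 / s) * ennreal (h y powr s)" .
    qed
    also have "\<dots> = ennreal (1 / s) * H" unfolding H_def by (rule nn_integral_cmult) measurable
    finally show "(\<integral>\<^sup>+ l. ?D' l \<partial>lborel) \<le> ennreal (1 / s) * H" .
  qed
  finally show ?thesis .
qed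

text \<open>The interpolated constant C / (2 - s) degenerates at s = 2, so the endpoints are treated
  directly: the trivial bound on the transform for s = 1, Plancherel's inequality for s = 2.
  Normalisation is forced because the interpolated estimate is not homogeneous in \<open>g\<close>
  and \<open>h\<close>.\<close>

lemma FT_bilinear_normalized:
  assumes s: "1 \<le> s" "s \<le> 2"
  obtains K :: real where "K > 0"
    "\<And>(g :: 'n::euclidean_space \<Rightarrow> complex) h. integrable lborel g \<Longrightarrow> h \<in> borel_measurable borel \<Longrightarrow> (\<And>y. 0 \<le> h y) \<Longrightarrow>
      power_mass s (\<lambda>x. norm (g x)) \<le> 1 \<Longrightarrow> power_mass s h \<le> 1 \<Longrightarrow>
      FT_pairing g h \<le> ennreal K"
proof -
  obtain C :: real where C: "C > 0"
    "\<And>g :: 'n \<Rightarrow> complex. integrable lborel g \<Longrightarrow>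
      square_mass (FT g) \<le> ennreal C * square_mass g"
    using Plancherel_bound[where 'n='n] by blast
  consider "s = 1" | "s = 2" | "1 < s" "s < 2" using s by linarith
  then show thesis
  proof cases
    case 1
    show thesis
    proof (rule that[of 1])
      fix g :: "'n \<Rightarrow> complex" and h :: "'n \<Rightarrow> real"
      assume g: "integrable lborel g" and [measurable]: "h \<in> borel_measurable borel" and h0: "\<And>y. 0 \<le> h y"
        and G: "power_mass s (\<lambda>x. norm (g x)) \<le> 1" and H: "power_mass s h \<le> 1"
      have "FT_pairing g h \<le> (\<integral>\<^sup>+ y. ennreal (h y) \<partial>lborel)"
      proof (rule nn_integral_mono)
        fix y
        have "ennreal (norm (FT g y)) \<le> 1"
          by (rule order_trans[OF norm_FT_le_nn[OF g]]) (use G in \<open>simp add: 1\<close>)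
        from mult_right_mono[OF this, of "ennreal (h y)"]
        show "ennreal (norm (FT g y)) * ennreal (h y) \<le> ennreal (h y)" by simp
      qed
      also have "\<dots> \<le> 1" using H h0 by (simp add: 1)
      finally show "FT_pairing g h \<le> ennreal 1" by simp
    qed simp
  next
    case 2
    show thesis
    proof (rule that[of "C + 1"])
      show "C + 1 > 0" using C by simp
      fix g :: "'n \<Rightarrow> complex" and h :: "'n \<Rightarrow> real"
      assume g: "integrable lborel g" and [measurable]: "h \<in> borel_measurable borel" and h0: "\<And>y. 0 \<le> h y"
        and G: "power_mass s (\<lambda>x. norm (g x)) \<le> 1" and H: "power_mass s h \<le> 1"
      have [measurable]: "g \<in> borel_measurable borel" using g by auto
      have "FT_pairing g h
          \<le> (\<integral>\<^sup>+ y. ennreal (norm (FT g y) ^ 2) + ennreal (h y ^ 2) \<partial>lborel)"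
      proof (rule nn_integral_mono)
        fix y
        have "norm (FT g y) * h y \<le> norm (FT g y) ^ 2 + h y ^ 2"
          using sum_squares_bound[of "norm (FT g y)" "h y"] mult_nonneg_nonneg[OF norm_ge_zero[of "FT g y"] h0[of y]]
          by linarith
        then show "ennreal (norm (FT g y)) * ennreal (h y) \<le> ennreal (norm (FT g y) ^ 2) + ennreal (h y ^ 2)"
          using h0 by (simp add: ennreal_mult[symmetric] ennreal_plus[symmetric] ennreal_leI del: ennreal_plus)
      qed
      also have "\<dots> = square_mass (FT g) + (\<integral>\<^sup>+ y. ennreal (h y ^ 2) \<partial>lborel)"
        by (rule nn_integral_add) measurable
      also have "\<dots> \<le> ennreal C * 1 + 1"
      proof (rule add_mono)
        show "(\<integral>\<^sup>+ y. ennreal (h y ^ 2) \<partial>lborel) \<le> 1" using H h0 by (simp add: 2)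
        have "square_mass g \<le> 1" using G by (simp add: 2)
        then show "square_mass (FT g) \<le> ennreal C * 1"
          by (intro order_trans[OF C(2)[OF g]] mult_left_mono) auto
      qed
      finally show "FT_pairing g h \<le> ennreal (C + 1)"
        using C by simp
    qed
  next
    case 3
    show thesis
    proof (rule that[of "1 + (C / (2 - s) + 1 / s)"])
      have nn: "0 \<le> C / (2 - s)" "0 \<le> 1 / s" using C 3 by auto
      then show "1 + (C / (2 - s) + 1 / s) > 0" by linarith
      fix g :: "'n \<Rightarrow> complex" and h :: "'n \<Rightarrow> real"
      assume g: "integrable lborel g" and h: "h \<in> borel_measurable borel" "\<And>y. 0 \<le> h y"
        and G: "power_mass s (\<lambda>x. norm (g x)) \<le> 1" and H: "power_mass s h \<le> 1"
      have "FT_pairing g h \<le> 1 * 1 + (ennreal (C / (2 - s)) * 1 + ennreal (1 / s) * 1)"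
        by (rule order_trans[OF FT_bilinear_strict[OF 3 C(1) C(2) g h]])
          (assumption, intro add_mono mult_mono G H order_refl zero_le)
      also have "\<dots> = ennreal (1 + (C / (2 - s) + 1 / s))"
      proof -
        have "1 * 1 + (ennreal a * 1 + ennreal b * 1) = ennreal (1 + (a + b))" if "0 \<le> a" "0 \<le> b" for a b :: real
          using that by simp
        then show ?thesis using nn .
      qed
      finally show "FT_pairing g h \<le> ennreal (1 + (C / (2 - s) + 1 / s))" .
    qed
  qed
qed

lemma nn_integral_powr_scale:
  assumes c: "c > 0" and [measurable]: "f \<in> borel_measurable M" and f0: "\<And>x. 0 \<le> f x"
    and le: "(\<integral>\<^sup>+ x. ennreal (f x powr s) \<partial>M) \<le> ennreal (c powr s)"
  shows "(\<integral>\<^sup>+ x. ennreal ((f x / c) powr s) \<partial>M) \<le> 1"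
proof -
  have "(\<integral>\<^sup>+ x. ennreal ((f x / c) powr s) \<partial>M) = (\<integral>\<^sup>+ x. ennreal (1 / c powr s) * ennreal (f x powr s) \<partial>M)"
    using c f0 by (intro nn_integral_cong) (simp add: powr_divide ennreal_mult[symmetric])
  also have "\<dots> = ennreal (1 / c powr s) * (\<integral>\<^sup>+ x. ennreal (f x powr s) \<partial>M)"
    by (rule nn_integral_cmult) measurable
  also have "\<dots> \<le> ennreal (1 / c powr s) * ennreal (c powr s)"
    by (rule mult_left_mono[OF le]) simp
  also have "\<dots> = 1" using c by (simp add: ennreal_mult[symmetric])
  finally show ?thesis .
qed

text \<open>Scaling to norm 1 divides by norm bounds \<open>A\<close> and \<open>B\<close> that may
  vanish. Estimates are therefore proved for A + e and B + e, and this lemma lets \<open>e\<close>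
  tend to 0.\<close>

lemma ennreal_le_of_tendsto_right:
  fixes f :: "real \<Rightarrow> real"
  assumes "\<And>e. e > 0 \<Longrightarrow> X \<le> ennreal (f e)" and "isCont f 0"
  shows "X \<le> ennreal (f 0)"
proof (rule LIMSEQ_le_const)
  have "(\<lambda>n. f (1 / real (Suc n))) \<longlonglongrightarrow> f 0"
    using LIMSEQ_Suc[OF lim_1_over_n[where 'a=real]] by (rule isCont_tendsto_compose[OF assms(2)])
  then show "(\<lambda>n. ennreal (f (1 / real (Suc n)))) \<longlonglongrightarrow> ennreal (f 0)"
    by (rule tendsto_ennrealI)
  show "\<exists>N. \<forall>n\<ge>N. X \<le> ennreal (f (1 / real (Suc n)))" using assms(1) by auto
qed

lemma FT_bilinear:
  assumes s: "1 \<le> s" "s \<le> 2"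
  obtains K :: real where "K > 0"
    "\<And>(g :: 'n::euclidean_space \<Rightarrow> complex) h A B. integrable lborel g \<Longrightarrow> h \<in> borel_measurable borel \<Longrightarrow> (\<And>y. 0 \<le> h y) \<Longrightarrow>
      0 \<le> A \<Longrightarrow> 0 \<le> B \<Longrightarrow>
      power_mass s (\<lambda>x. norm (g x)) \<le> ennreal (A powr s) \<Longrightarrow>
      power_mass s h \<le> ennreal (B powr s) \<Longrightarrow>
      FT_pairing g h \<le> ennreal (K * A * B)"
proof -
  obtain K :: real where K: "K > 0"
    "\<And>(g :: 'n \<Rightarrow> complex) h. integrable lborel g \<Longrightarrow> h \<in> borel_measurable borel \<Longrightarrow> (\<And>y. 0 \<le> h y) \<Longrightarrow>
      power_mass s (\<lambda>x. norm (g x)) \<le> 1 \<Longrightarrow> power_mass s h \<le> 1 \<Longrightarrow>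
      FT_pairing g h \<le> ennreal K"
    using FT_bilinear_normalized[OF s, where 'n='n] by blast
  have pos: "FT_pairing g h \<le> ennreal (K * A * B)"
    if g: "integrable lborel g" and h [measurable]: "h \<in> borel_measurable borel" and h0: "\<And>y. 0 \<le> h y"
      and A: "0 < A" and B: "0 < B"
      and G: "power_mass s (\<lambda>x. norm (g x)) \<le> ennreal (A powr s)"
      and H: "power_mass s h \<le> ennreal (B powr s)"
    for g :: "'n \<Rightarrow> complex" and h A B
  proof -
    have [measurable]: "g \<in> borel_measurable borel" using g by auto
    have FTs: "FT (\<lambda>x. g x / of_real A) y = FT g y / of_real A" for y
      unfolding FT_def by simp
    have "(\<integral>\<^sup>+ x. ennreal (norm (g x / of_real A) powr s) \<partial>lborel) \<le> 1"
      using nn_integral_powr_scale[OF A _ _ G] A by (simp add: norm_divide)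
    moreover have "(\<integral>\<^sup>+ y. ennreal ((h y / B) powr s) \<partial>lborel) \<le> 1"
      using B h0 H by (intro nn_integral_powr_scale) auto
    ultimately have le: "(\<integral>\<^sup>+ y. ennreal (norm (FT (\<lambda>x. g x / of_real A) y)) * ennreal (h y / B) \<partial>lborel) \<le> ennreal K"
      using g h0 B by (intro K(2)) auto
    have "FT_pairing g h
      = (\<integral>\<^sup>+ y. ennreal (A * B) * (ennreal (norm (FT (\<lambda>x. g x / of_real A) y)) * ennreal (h y / B)) \<partial>lborel)"
      unfolding FTs using A B h0 by (intro nn_integral_cong) (simp add: ennreal_mult[symmetric] norm_divide)
    also have "\<dots> = ennreal (A * B) * (\<integral>\<^sup>+ y. ennreal (norm (FT (\<lambda>x. g x / of_real A) y)) * ennreal (h y / B) \<partial>lborel)"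
      by (rule nn_integral_cmult) measurable
    also have "\<dots> \<le> ennreal (A * B) * ennreal K" by (rule mult_left_mono[OF le]) simp
    also have "\<dots> = ennreal (K * A * B)" using A B K by (simp add: ennreal_mult[symmetric] mult_ac)
    finally show ?thesis .
  qed
  show thesis
  proof (rule that[OF K(1)])
    fix g :: "'n \<Rightarrow> complex" and h :: "'n \<Rightarrow> real" and A B :: real
    assume g: "integrable lborel g" and h: "h \<in> borel_measurable borel" "\<And>y. 0 \<le> h y" and AB: "0 \<le> A" "0 \<le> B"
      and G: "power_mass s (\<lambda>x. norm (g x)) \<le> ennreal (A powr s)"
      and H: "power_mass s h \<le> ennreal (B powr s)"
    have "FT_pairing g h \<le> ennreal (K * (A + e) * (B + e))" if e: "e > 0" for e
    proof (rule pos[OF g h])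
      show "0 < A + e" "0 < B + e" using AB e by auto
      show "power_mass s (\<lambda>x. norm (g x)) \<le> ennreal ((A + e) powr s)"
        using AB e s by (intro order_trans[OF G] ennreal_leI powr_mono2) auto
      show "power_mass s h \<le> ennreal ((B + e) powr s)"
        using AB e s by (intro order_trans[OF H] ennreal_leI powr_mono2) auto
    qed
    then have "FT_pairing g h \<le> ennreal (K * (A + 0) * (B + 0))"
      by (rule ennreal_le_of_tendsto_right) (assumption, intro continuous_intros)
    then show "FT_pairing g h \<le> ennreal (K * A * B)" by simp
  qed
qed

section \<open>Inequalities for the \<open>Lnorm\<close> functional\<close>

text \<open>Removes the root and the passage through \<open>enn2real\<close> from
  \<open>Lnorm\<close>, so that all later estimates compare integrals. Exponents below 1 are
  included, as \<open>r\<close> may be one.\<close>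

lemma Lnorm_le_finite:
  assumes "p \<noteq> top" "0 < p" "0 \<le> B"
  shows "Lnorm p f \<le> ennreal B \<longleftrightarrow>
    (\<integral>\<^sup>+ x. ennreal (norm (f x) powr enn2real p) \<partial>lebesgue) \<le> ennreal (B powr enn2real p)"
proof -
  define P where "P = enn2real p"
  have P: "P > 0" using assms by (simp add: P_def enn2real_positive_iff top.not_eq_extremum)
  define I where "I = (\<integral>\<^sup>+ x. ennreal (norm (f x) powr P) \<partial>lebesgue)"
  show ?thesis
  proof (cases "I = top")
    case True
    then show ?thesis using assms(1) by (simp add: Lnorm_def Let_def I_def P_def top_unique)
  next
    case False
    define i where "i = enn2real I"
    have i: "I = ennreal i" "0 \<le> i" using False by (simp_all add: i_def top.not_eq_extremum)
    have L: "Lnorm p f = ennreal (i powr (1 / P))"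
      using assms(1) False by (simp add: Lnorm_def Let_def I_def P_def i_def)
    have "i powr (1 / P) \<le> B \<longleftrightarrow> i \<le> B powr P"
    proof
      assume "i powr (1 / P) \<le> B"
      then have "(i powr (1 / P)) powr P \<le> B powr P" using P by (intro powr_mono2) auto
      then show "i \<le> B powr P" using P i by (simp add: powr_powr)
    next
      assume "i \<le> B powr P"
      then have "i powr (1 / P) \<le> (B powr P) powr (1 / P)" using P i by (intro powr_mono2) auto
      then show "i powr (1 / P) \<le> B" using P assms by (simp add: powr_powr)
    qed
    then show ?thesis unfolding L using i assms by (simp add: I_def[symmetric] P_def[symmetric])
  qed
qed

text \<open>The infimum in the essential supremum is attained: the bounds B + 1/(k + 1) hold almost
  everywhere for all k simultaneously.\<close>

lemma Lnorm_top_le: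
  assumes "0 \<le> B"
  shows "Lnorm top f \<le> ennreal B \<longleftrightarrow> (AE x in lebesgue. norm (f x) \<le> B)"
proof
  assume "AE x in lebesgue. norm (f x) \<le> B"
  then have "AE x in lebesgue. ennreal (norm (f x)) \<le> ennreal B" by (auto intro: ennreal_leI)
  then show "Lnorm top f \<le> ennreal B" by (auto simp: Lnorm_def intro: Inf_lower)
next
  assume L: "Lnorm top f \<le> ennreal B"
  have "AE x in lebesgue. norm (f x) \<le> B + 1 / real (Suc k)" for k
  proof -
    have "Lnorm top f < ennreal (B + 1 / real (Suc k))"
      using assms by (intro order_le_less_trans[OF L]) (simp add: ennreal_less_iff)
    then obtain c where c: "AE x in lebesgue. ennreal (norm (f x)) \<le> c" "c < ennreal (B + 1 / real (Suc k))"
      by (auto simp: Lnorm_def Inf_less_iff)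
    from c(1) show ?thesis
    proof (rule AE_mp, intro AE_I2 impI)
      fix x assume "ennreal (norm (f x)) \<le> c"
      then have "ennreal (norm (f x)) \<le> ennreal (B + 1 / real (Suc k))" using c(2) by order
      then show "norm (f x) \<le> B + 1 / real (Suc k)" using assms by (subst (asm) ennreal_le_iff) auto
    qed
  qed
  then have "AE x in lebesgue. \<forall>k. norm (f x) \<le> B + 1 / real (Suc k)" by (simp add: AE_all_countable)
  then show "AE x in lebesgue. norm (f x) \<le> B"
  proof (rule AE_mp, intro AE_I2 impI)
    fix x assume *: "\<forall>k. norm (f x) \<le> B + 1 / real (Suc k)"
    have "(\<lambda>k. B + 1 / real (Suc k)) \<longlonglongrightarrow> B + 0"
      by (intro tendsto_intros LIMSEQ_Suc[OF lim_1_over_n[where 'a=real]])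
    then show "norm (f x) \<le> B" using * by (intro LIMSEQ_le_const[of _ B]) auto
  qed
qed

lemma Lnorm_mono_AE:
  assumes "AE x in lebesgue. norm (f x) \<le> norm (g x)" and p: "0 < p"
  shows "Lnorm p f \<le> Lnorm p g"
proof (cases "Lnorm p g")
  case (real B)
  have "Lnorm p f \<le> ennreal B"
  proof (cases "p = top")
    case True
    have "AE x in lebesgue. norm (g x) \<le> B" using real True Lnorm_top_le[of B g] by simp
    with assms(1) have "AE x in lebesgue. norm (f x) \<le> B" by eventually_elim simp
    then show ?thesis using True real Lnorm_top_le[of B f] by simp
  next
    case False
    have "(\<integral>\<^sup>+ x. ennreal (norm (f x) powr enn2real p) \<partial>lebesgue) \<le> (\<integral>\<^sup>+ x. ennreal (norm (g x) powr enn2real p) \<partial>lebesgue)"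
      using assms(1) by (intro nn_integral_mono_AE) (auto intro!: ennreal_leI powr_mono2 elim!: eventually_mono)
    also have "\<dots> \<le> ennreal (B powr enn2real p)" using real False p Lnorm_le_finite[of p B g] by simp
    finally show ?thesis using real False p by (subst Lnorm_le_finite) auto
  qed
  then show ?thesis by (simp add: real)
qed simp

text \<open>Young's inequality with the weights R/P and R/Q, which add up to 1, applied to the
  normalised factors; convexity of the power R plays no part, so r < 1 is covered. If
  \<open>p\<close> or \<open>q\<close> is infinite, \<open>r\<close> equals the other exponent and
  the bounded factor is pulled out.\<close>

lemma Lnorm_Hoelder_pos:
  fixes u v :: "'n::euclidean_space \<Rightarrow> real"
  assumes p: "0 < p" and q: "0 < q" and r: "0 < r" "inverse r = inverse q + inverse p"
    and [measurable]: "u \<in> borel_measurable lebesgue" "v \<in> borel_measurable lebesgue"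
    and u0: "\<And>x. 0 \<le> u x" and v0: "\<And>x. 0 \<le> v x"
    and A: "A > 0" and B: "B > 0"
    and u: "Lnorm p (\<lambda>x. of_real (u x)) \<le> ennreal A" and v: "Lnorm q (\<lambda>x. of_real (v x)) \<le> ennreal B"
  shows "Lnorm r (\<lambda>x. of_real (u x * v x)) \<le> ennreal (A * B)"
proof -
  \<comment> \<open>Stated for arbitrary functions because either factor can be the bounded
    one.\<close>
  have bdd: "Lnorm r' (\<lambda>x. of_real (u' x * v' x)) \<le> ennreal (A' * B')"
    if "0 < r'" "AE x in lebesgue. u' x \<le> A'" "Lnorm r' (\<lambda>x. of_real (v' x)) \<le> ennreal B'"
      "A' > 0" "B' > 0" "\<And>x. 0 \<le> u' x" "\<And>x. 0 \<le> v' x" "v' \<in> borel_measurable lebesgue"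
    for r' u' v' A' B'
  proof (cases "r' = top")
    case True
    have "AE x in lebesgue. v' x \<le> B'" using that True Lnorm_top_le[of B' "\<lambda>x. of_real (v' x)"] by simp
    with that(2) have "AE x in lebesgue. norm (complex_of_real (u' x * v' x)) \<le> A' * B'"
      by eventually_elim (use that in \<open>simp add: norm_mult mult_mono del: of_real_mult\<close>)
    then show ?thesis using True that by (simp add: Lnorm_top_le)
  next
    case False
    let ?R = "enn2real r'"
    have [measurable]: "v' \<in> borel_measurable lebesgue" by (fact that)
    have "(\<integral>\<^sup>+ x. ennreal (norm (complex_of_real (u' x * v' x)) powr ?R) \<partial>lebesgue)
       \<le> (\<integral>\<^sup>+ x. ennreal (A' powr ?R) * ennreal (v' x powr ?R) \<partial>lebesgue)"
    proof (rule nn_integral_mono_AE, rule AE_mp[OF that(2)], intro AE_I2 impI)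
      fix x assume "u' x \<le> A'"
      then have "(u' x * v' x) powr ?R \<le> (A' * v' x) powr ?R"
        using that by (intro powr_mono2 mult_right_mono) auto
      then show "ennreal (norm (complex_of_real (u' x * v' x)) powr ?R) \<le> ennreal (A' powr ?R) * ennreal (v' x powr ?R)"
        using that by (simp add: ennreal_mult[symmetric] powr_mult ennreal_leI del: of_real_mult)
    qed
    also have "\<dots> = ennreal (A' powr ?R) * (\<integral>\<^sup>+ x. ennreal (v' x powr ?R) \<partial>lebesgue)"
      by (rule nn_integral_cmult) measurable
    also have "\<dots> \<le> ennreal (A' powr ?R) * ennreal (B' powr ?R)"
      using that False Lnorm_le_finite[of r' B' "\<lambda>x. of_real (v' x)"] by (intro mult_left_mono) auto
    also have "\<dots> = ennreal ((A' * B') powr ?R)" using that by (simp add: ennreal_mult[symmetric] powr_mult)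
    finally show ?thesis using that False by (subst Lnorm_le_finite) auto
  qed
  show ?thesis
  proof (cases "p = top \<or> q = top")
    case True
    then show ?thesis
    proof
      assume pt: "p = top"
      have "inverse r = inverse q" using r(2) pt by simp
      then have "r = q" by (metis divide_ennreal_def mult_1 one_divide_one_divide_ennreal)
      moreover have "AE x in lebesgue. u x \<le> A"
        using u pt A u0 Lnorm_top_le[of A "\<lambda>x. of_real (u x)"] by simp
      ultimately show ?thesis using bdd[of q u A v B] q v A B u0 v0 assms(6) by simp
    next
      assume qt: "q = top"
      have "inverse r = inverse p" using r(2) qt by simp
      then have "r = p" by (metis divide_ennreal_def mult_1 one_divide_one_divide_ennreal)
      moreover have "AE x in lebesgue. v x \<le> B"
        using v qt B v0 Lnorm_top_le[of B "\<lambda>x. of_real (v x)"] by simp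
      ultimately show ?thesis using bdd[of p v B u A] p u A B u0 v0 assms(5) by (simp add: mult.commute)
    qed
  next
    case False
    define P Q R where "P = enn2real p" and "Q = enn2real q" and "R = enn2real r"
    have P: "P > 0" "p = ennreal P" and Q: "Q > 0" "q = ennreal Q"
      using False p q by (auto simp: P_def Q_def enn2real_positive_iff top.not_eq_extremum)
    have "r \<noteq> top" using r P Q by auto
    then have R: "R > 0" "r = ennreal R"
      using r by (auto simp: R_def enn2real_positive_iff top.not_eq_extremum)
    have eq: "1 / R = 1 / Q + 1 / P"
    proof -
      have "ennreal (1 / R) = ennreal (1 / Q + 1 / P)"
        using r(2) P Q R by (simp add: inverse_ennreal inverse_eq_divide)
      then show ?thesis using P Q R by (subst (asm) ennreal_inj) auto
    qed
    define \<alpha> \<beta> where "\<alpha> = R / P" and "\<beta> = R / Q"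
    have ab: "0 \<le> \<alpha>" "0 \<le> \<beta>" "\<alpha> + \<beta> = 1" "0 < \<alpha>" "0 < \<beta>"
      using P Q R eq by (auto simp: \<alpha>_def \<beta>_def field_simps)
    have U: "(\<integral>\<^sup>+ x. ennreal ((u x / A) powr P) \<partial>lebesgue) \<le> 1"
      using u A p False u0 Lnorm_le_finite[of p A "\<lambda>x. of_real (u x)"]
      by (intro nn_integral_powr_scale) (auto simp: P_def)
    have V: "(\<integral>\<^sup>+ x. ennreal ((v x / B) powr Q) \<partial>lebesgue) \<le> 1"
      using v B q False v0 Lnorm_le_finite[of q B "\<lambda>x. of_real (v x)"]
      by (intro nn_integral_powr_scale) (auto simp: Q_def)
    have pt: "(u x * v x) powr R \<le> (A * B) powr R * (\<alpha> * (u x / A) powr P + \<beta> * (v x / B) powr Q)" for x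
    proof (cases "u x = 0 \<or> v x = 0")
      case True
      have "0 \<le> (A * B) powr R * (\<alpha> * (u x / A) powr P + \<beta> * (v x / B) powr Q)"
        using ab by (intro mult_nonneg_nonneg add_nonneg_nonneg) auto
      then show ?thesis using True R by auto
    next
      case False
      then have pos: "u x > 0" "v x > 0" using u0[of x] v0[of x] by auto
      have "((u x / A) powr P) powr \<alpha> * ((v x / B) powr Q) powr \<beta> \<le> \<alpha> * (u x / A) powr P + \<beta> * (v x / B) powr Q"
        using ab pos A B by (intro Youngs_inequality_0) auto
      moreover have "((u x / A) powr P) powr \<alpha> * ((v x / B) powr Q) powr \<beta> = (u x / A) powr R * (v x / B) powr R"
        using P Q by (simp add: powr_powr \<alpha>_def \<beta>_def)
      moreover have "(u x * v x) powr R = (A * B) powr R * ((u x / A) powr R * (v x / B) powr R)"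
        using pos A B by (simp add: powr_mult[symmetric])
      ultimately show ?thesis by (simp add: mult_left_mono)
    qed
    have "(\<integral>\<^sup>+ x. ennreal (norm (complex_of_real (u x * v x)) powr R) \<partial>lebesgue)
      \<le> (\<integral>\<^sup>+ x. ennreal ((A * B) powr R) * (ennreal \<alpha> * ennreal ((u x / A) powr P) + ennreal \<beta> * ennreal ((v x / B) powr Q)) \<partial>lebesgue)"
    proof (rule nn_integral_mono)
      fix x
      have "ennreal ((u x * v x) powr R) \<le> ennreal ((A * B) powr R * (\<alpha> * (u x / A) powr P + \<beta> * (v x / B) powr Q))"
        by (rule ennreal_leI[OF pt])
      also have "\<dots> = ennreal ((A * B) powr R) * (ennreal \<alpha> * ennreal ((u x / A) powr P) + ennreal \<beta> * ennreal ((v x / B) powr Q))"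
        using ab by (simp add: ennreal_mult)
      finally show "ennreal (norm (complex_of_real (u x * v x)) powr R) \<le> \<dots>" using u0 v0 by (simp add: norm_mult)
    qed
    also have "\<dots> = ennreal ((A * B) powr R) * (ennreal \<alpha> * (\<integral>\<^sup>+ x. ennreal ((u x / A) powr P) \<partial>lebesgue)
        + ennreal \<beta> * (\<integral>\<^sup>+ x. ennreal ((v x / B) powr Q) \<partial>lebesgue))"
      by (simp add: nn_integral_cmult nn_integral_add)
    also have "\<dots> \<le> ennreal ((A * B) powr R) * (ennreal \<alpha> * 1 + ennreal \<beta> * 1)"
      by (intro mult_left_mono add_mono U V) auto
    also have "\<dots> = ennreal ((A * B) powr R)"
      using ab by (simp add: ennreal_plus[symmetric] del: ennreal_plus)
    finally show ?thesis
      using A B r \<open>r \<noteq> top\<close> by (subst Lnorm_le_finite) (auto simp: R_def)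
  qed
qed

lemma Lnorm_Hoelder:
  fixes u v :: "'n::euclidean_space \<Rightarrow> real"
  assumes p: "0 < p" and q: "0 < q" and r: "0 < r" "inverse r = inverse q + inverse p"
    and uv: "u \<in> borel_measurable lebesgue" "v \<in> borel_measurable lebesgue" "\<And>x. 0 \<le> u x" "\<And>x. 0 \<le> v x"
    and A: "A \<ge> 0" and B: "B \<ge> 0"
    and u: "Lnorm p (\<lambda>x. of_real (u x)) \<le> ennreal A" and v: "Lnorm q (\<lambda>x. of_real (v x)) \<le> ennreal B"
  shows "Lnorm r (\<lambda>x. of_real (u x * v x)) \<le> ennreal (A * B)"
proof -
  have "Lnorm r (\<lambda>x. of_real (u x * v x)) \<le> ennreal ((A + e) * (B + e))" if e: "e > 0" for e
    using A B e
    by (intro Lnorm_Hoelder_pos[OF p q r uv] order_trans[OF u] order_trans[OF v] ennreal_leI) auto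
  then have "Lnorm r (\<lambda>x. of_real (u x * v x)) \<le> ennreal ((A + 0) * (B + 0))"
    by (rule ennreal_le_of_tendsto_right) (assumption, intro continuous_intros)
  then show ?thesis by simp
qed

lemma Lnorm_scale:
  assumes p: "0 < p" and K: "0 \<le> K" and B: "0 \<le> B" and f: "Lnorm p f \<le> ennreal B" and [measurable]: "f \<in> borel_measurable lebesgue"
  shows "Lnorm p (\<lambda>x. of_real K * f x) \<le> ennreal (K * B)"
proof (cases "p = top")
  case True
  have "AE x in lebesgue. norm (f x) \<le> B" using f True B Lnorm_top_le by auto
  then have "AE x in lebesgue. norm (of_real K * f x) \<le> K * B"
    by eventually_elim (use K in \<open>simp add: norm_mult mult_left_mono\<close>)
  then show ?thesis using K B True Lnorm_top_le[of "K * B" "\<lambda>x. of_real K * f x"] by simp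
next
  case False
  let ?P = "enn2real p"
  have "(\<integral>\<^sup>+ x. ennreal (norm (of_real K * f x) powr ?P) \<partial>lebesgue)
    = (\<integral>\<^sup>+ x. ennreal (K powr ?P) * ennreal (norm (f x) powr ?P) \<partial>lebesgue)"
    using K by (intro nn_integral_cong) (simp add: norm_mult powr_mult ennreal_mult)
  also have "\<dots> = ennreal (K powr ?P) * (\<integral>\<^sup>+ x. ennreal (norm (f x) powr ?P) \<partial>lebesgue)"
    by (rule nn_integral_cmult) measurable
  also have "\<dots> \<le> ennreal (K powr ?P) * ennreal (B powr ?P)"
    using f Lnorm_le_finite[OF False p B, of f] by (intro mult_left_mono) auto
  also have "\<dots> = ennreal ((K * B) powr ?P)" using K B by (simp add: ennreal_mult powr_mult)
  finally show ?thesis using K B False p by (subst Lnorm_le_finite) auto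
qed

text \<open>Jensen's inequality by integrating the tangent-line form of Young's inequality at the
  level \<open>c\<close> with c^t = J/M, which balances the two terms to M c. J = 0 is separate
  because the level would vanish.\<close>

lemma nn_integral_powr_Jensen:
  assumes t: "1 \<le> t" and M: "0 < M" "emeasure N (space N) \<le> ennreal M"
    and [measurable]: "f \<in> borel_measurable N" and f0: "\<And>y. 0 \<le> f y" and J: "0 \<le> J"
    and le: "(\<integral>\<^sup>+ y. ennreal (f y powr t) \<partial>N) \<le> ennreal J"
  shows "(\<integral>\<^sup>+ y. ennreal (f y) \<partial>N) \<le> ennreal (M * (J / M) powr (1 / t))"
proof (cases "J = 0")
  case True
  then have "(\<integral>\<^sup>+ y. ennreal (f y powr t) \<partial>N) = 0" using le by simp
  then have "AE y in N. ennreal (f y powr t) = 0" by (subst (asm) nn_integral_0_iff_AE) auto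
  then have "AE y in N. ennreal (f y) = 0"
    by eventually_elim (metis ennreal_0 ennreal_eq_zero_iff f0 order.refl powr_ge_zero powr_eq_0_iff)
  then have "(\<integral>\<^sup>+ y. ennreal (f y) \<partial>N) = 0" by (subst nn_integral_0_iff_AE) auto
  then show ?thesis by simp
next
  case False
  define c where "c = (J / M) powr (1 / t)"
  have c: "c > 0" using False J M by (simp add: c_def)
  have ct: "c powr t = J / M" using False J M t by (simp add: c_def powr_powr)
  have pt: "f y \<le> c powr (1 - t) / t * f y powr t + (1 - 1 / t) * c" for y
  proof (cases "f y = 0")
    case True then show ?thesis using c t by simp
  next
    case False
    then have fy: "f y > 0" using f0[of y] by simp
    have "(f y powr t * c powr (1 - t)) powr (1 / t) * c powr (1 - 1 / t)
        \<le> 1 / t * (f y powr t * c powr (1 - t)) + (1 - 1 / t) * c"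
      using t c fy by (intro Youngs_inequality_0) auto
    moreover have "(f y powr t * c powr (1 - t)) powr (1 / t) * c powr (1 - 1 / t) = f y"
    proof -
      have "(f y powr t * c powr (1 - t)) powr (1 / t) = f y * c powr (1 / t - 1)"
        using t c fy by (simp add: powr_mult powr_powr diff_divide_distrib)
      then show ?thesis using c by (simp add: mult.assoc powr_add[symmetric])
    qed
    ultimately show ?thesis by (simp add: mult_ac)
  qed
  have k0: "0 \<le> c powr (1 - t) / t" "0 \<le> (1 - 1 / t) * c" using t c by auto
  have "(\<integral>\<^sup>+ y. ennreal (f y) \<partial>N) \<le> (\<integral>\<^sup>+ y. ennreal (c powr (1 - t) / t) * ennreal (f y powr t) + ennreal ((1 - 1 / t) * c) \<partial>N)"
  proof (rule nn_integral_mono)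
    fix y
    show "ennreal (f y) \<le> ennreal (c powr (1 - t) / t) * ennreal (f y powr t) + ennreal ((1 - 1 / t) * c)"
      unfolding ennreal_mult[OF k0(1) powr_ge_zero, symmetric]
        ennreal_plus[OF mult_nonneg_nonneg[OF k0(1) powr_ge_zero] k0(2), symmetric]
      by (rule ennreal_leI[OF pt])
  qed
  also have "\<dots> = ennreal (c powr (1 - t) / t) * (\<integral>\<^sup>+ y. ennreal (f y powr t) \<partial>N) + ennreal ((1 - 1 / t) * c) * emeasure N (space N)"
    by (subst nn_integral_add) (auto simp: nn_integral_cmult)
  also have "\<dots> \<le> ennreal (c powr (1 - t) / t) * ennreal J + ennreal ((1 - 1 / t) * c) * ennreal M"
    by (intro add_mono mult_left_mono le M) auto
  also have "\<dots> = ennreal (c powr (1 - t) / t * J + (1 - 1 / t) * c * M)"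
    unfolding ennreal_mult[OF k0(1) J, symmetric] ennreal_mult[OF k0(2) less_imp_le[OF M(1)], symmetric]
      ennreal_plus[OF mult_nonneg_nonneg[OF k0(1) J] mult_nonneg_nonneg[OF k0(2) less_imp_le[OF M(1)]], symmetric] ..
  also have "c powr (1 - t) / t * J + (1 - 1 / t) * c * M = M * c"
  proof -
    have "J = M * c powr t" using ct M by simp
    then have "c powr (1 - t) * J = M * (c powr (1 - t) * c powr t)" by simp
    also have "c powr (1 - t) * c powr t = c" using c by (simp add: powr_add[symmetric])
    finally show ?thesis using t by (simp add: field_simps)
  qed
  finally show ?thesis by (simp add: c_def)
qed

lemma sigma_finite_lebesgue: "sigma_finite_measure (lebesgue :: 'n::euclidean_space measure)"
proof
  obtain A :: "'n set set" where A: "countable A" "A \<subseteq> sets lborel" "\<Union>A = space lborel" "\<forall>a\<in>A. emeasure lborel a \<noteq> \<infinity>"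
    using lborel.sigma_finite_countable by blast
  show "\<exists>A::'n set set. countable A \<and> A \<subseteq> sets lebesgue \<and> \<Union>A = space lebesgue \<and> (\<forall>a\<in>A. emeasure lebesgue a \<noteq> \<infinity>)"
    using A by (intro exI[of _ A]) (auto simp: emeasure_completion)
qed

text \<open>Minkowski's integral inequality in the only form used: all slices in \<open>y\<close>
  have norm at most \<open>B\<close> and \<open>N\<close> has finite mass, so Jensen with exponent
  p/s (at least 1) and Fubini suffice. It is applied once to the symbol with exponent
  \<open>p\<close>, once to translates of \<open>f\<close> with exponent \<open>q\<close>.\<close>

lemma Lnorm_integral_powr:
  fixes g :: "'n::euclidean_space \<Rightarrow> 'b \<Rightarrow> real"
  assumes s: "1 \<le> s" "ennreal s \<le> p" and N: "finite_measure N" and M: "0 < M" "emeasure N (space N) \<le> ennreal M"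
    and meas [measurable]: "(\<lambda>(x, y). g x y) \<in> borel_measurable (lebesgue \<Otimes>\<^sub>M N)"
    and g0: "\<And>x y. 0 \<le> g x y" and B: "0 \<le> B"
    and L: "\<And>y. y \<in> space N \<Longrightarrow> Lnorm p (\<lambda>x. of_real (g x y)) \<le> ennreal B"
  defines "I \<equiv> \<lambda>x. \<integral>\<^sup>+ y. ennreal (g x y powr s) \<partial>N"
  shows "AE x in lebesgue. I x < top"
    and "Lnorm p (\<lambda>x. of_real (enn2real (I x) powr (1 / s))) \<le> ennreal (M powr (1 / s) * B)"
    and "(\<lambda>x. enn2real (I x) powr (1 / s)) \<in> borel_measurable lebesgue"
proof -
  interpret N: finite_measure N by fact
  interpret leb: sigma_finite_measure "lebesgue :: 'n measure" by (rule sigma_finite_lebesgue)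
  interpret pair: pair_sigma_finite "lebesgue :: 'n measure" N ..
  have gx [measurable]: "g x \<in> borel_measurable N" for x
    using measurable_Pair2[OF meas, of x] by simp
  have Im [measurable]: "I \<in> borel_measurable lebesgue" unfolding I_def by measurable
  show "(\<lambda>x. enn2real (I x) powr (1 / s)) \<in> borel_measurable lebesgue" by measurable
  have p0: "0 < p" using s by (metis ennreal_less_zero_iff less_le_trans less_numeral_extra(1) order_less_le_trans)
  show "AE x in lebesgue. I x < top"
    and "Lnorm p (\<lambda>x. of_real (enn2real (I x) powr (1 / s))) \<le> ennreal (M powr (1 / s) * B)"
  proof (atomize (full), cases "p = top")
    case True
    have "AE x in lebesgue. g x y \<le> B" if "y \<in> space N" for y
      using L[OF that] True B g0 by (simp add: Lnorm_top_le)
    then have "AE y in N. AE x in lebesgue. g x y \<le> B" by (rule AE_I2)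
    then have "AE x in lebesgue. AE y in N. g x y \<le> B"
      by (subst pair.AE_commute) measurable
    then have le: "AE x in lebesgue. I x \<le> ennreal (B powr s * M)"
    proof eventually_elim
      case (elim x)
      have "I x \<le> (\<integral>\<^sup>+ y. ennreal (B powr s) \<partial>N)"
        unfolding I_def using elim s g0 by (intro nn_integral_mono_AE) (auto intro!: ennreal_leI powr_mono2 elim!: eventually_mono)
      also have "\<dots> \<le> ennreal (B powr s) * ennreal M" using M by (simp add: mult_left_mono)
      finally show ?case using M by (simp add: ennreal_mult)
    qed
    then have "AE x in lebesgue. norm (complex_of_real (enn2real (I x) powr (1 / s))) \<le> M powr (1 / s) * B"
    proof eventually_elim
      case (elim x)
      have "enn2real (I x) \<le> B powr s * M" using enn2real_mono[OF elim] M B by simp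
      then have "enn2real (I x) powr (1 / s) \<le> (B powr s * M) powr (1 / s)"
        using s by (intro powr_mono2) auto
      also have "\<dots> = M powr (1 / s) * B" using s B M by (simp add: powr_mult powr_powr)
      finally show ?case by simp
    qed
    then have "Lnorm p (\<lambda>x. of_real (enn2real (I x) powr (1 / s))) \<le> ennreal (M powr (1 / s) * B)"
      unfolding True by (intro Lnorm_top_le[THEN iffD2]) (use M B in auto)
    moreover have "AE x in lebesgue. I x < top"
      using le by eventually_elim (auto intro: order_le_less_trans)
    ultimately show "(AE x in lebesgue. I x < top) \<and> Lnorm p (\<lambda>x. of_real (enn2real (I x) powr (1 / s))) \<le> ennreal (M powr (1 / s) * B)"
      by blast
  next
    case False
    define P where "P = enn2real p"
    have pP: "p = ennreal P" using False by (simp add: P_def top.not_eq_extremum)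
    have sP: "s \<le> P" using s(2) s(1) unfolding pP by (simp add: ennreal_le_iff2)
    have P: "P > 0" using sP s by simp
    define J where "J x = (\<integral>\<^sup>+ y. ennreal (g x y powr P) \<partial>N)" for x
    have [measurable]: "J \<in> borel_measurable lebesgue" unfolding J_def[abs_def] by measurable
    have "(\<integral>\<^sup>+ x. J x \<partial>lebesgue) = (\<integral>\<^sup>+ y. (\<integral>\<^sup>+ x. ennreal (g x y powr P) \<partial>lebesgue) \<partial>N)"
      unfolding J_def by (rule pair.Fubini'[symmetric]) measurable
    also have "\<dots> \<le> (\<integral>\<^sup>+ y. ennreal (B powr P) \<partial>N)"
    proof (rule nn_integral_mono)
      fix y assume "y \<in> space N"
      from L[OF this, unfolded Lnorm_le_finite[OF False p0 B]]
      show "(\<integral>\<^sup>+ x. ennreal (g x y powr P) \<partial>lebesgue) \<le> ennreal (B powr P)" using g0 by (simp add: P_def)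
    qed
    also have "\<dots> \<le> ennreal (B powr P) * ennreal M" using M by (simp add: mult_left_mono)
    finally have J_le: "(\<integral>\<^sup>+ x. J x \<partial>lebesgue) \<le> ennreal (B powr P) * ennreal M" .
    have IJ: "I x \<le> ennreal (M * (j / M) powr (1 / (P / s)))" if "J x = ennreal j" "0 \<le> j" for x j
      unfolding I_def
    proof (rule nn_integral_powr_Jensen)
      show "(\<integral>\<^sup>+ y. ennreal ((g x y powr s) powr (P / s)) \<partial>N) \<le> ennreal j"
        using that s g0 unfolding J_def by (simp add: powr_powr)
    qed (use that s sP M in auto)
    have "(\<integral>\<^sup>+ x. J x \<partial>lebesgue) \<noteq> \<infinity>"
      using J_le by (metis ennreal_mult_eq_top_iff ennreal_neq_top infinity_ennreal_def top.extremum_unique)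
    then have Jfin: "AE x in lebesgue. J x \<noteq> \<infinity>" by (intro nn_integral_PInf_AE) auto
    then have 1: "AE x in lebesgue. I x < top"
    proof eventually_elim
      case (elim x)
      then show ?case using IJ[of x "enn2real (J x)"] by (auto simp: top.not_eq_extremum intro: order_le_less_trans)
    qed
    have "(\<integral>\<^sup>+ x. ennreal (norm (complex_of_real (enn2real (I x) powr (1 / s))) powr P) \<partial>lebesgue)
      \<le> (\<integral>\<^sup>+ x. ennreal (M powr (P / s - 1)) * J x \<partial>lebesgue)"
      using Jfin
    proof (intro nn_integral_mono_AE, eventually_elim)
      case (elim x)
      define j where "j = enn2real (J x)"
      have j: "J x = ennreal j" "0 \<le> j" using elim by (auto simp: j_def top.not_eq_extremum)
      have "enn2real (I x) \<le> M * (j / M) powr (1 / (P / s))"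
        using enn2real_mono[OF IJ[OF j]] M j by simp
      then have "enn2real (I x) powr (P / s) \<le> (M * (j / M) powr (1 / (P / s))) powr (P / s)"
        using P s by (intro powr_mono2) auto
      also have "\<dots> = M powr (P / s) * (j / M)"
        using P s M j by (simp add: powr_mult powr_powr)
      also have "\<dots> = M powr (P / s - 1) * j" using M by (simp add: powr_diff)
      finally have "ennreal (enn2real (I x) powr (P / s)) \<le> ennreal (M powr (P / s - 1) * j)" by (rule ennreal_leI)
      then show ?case using j by (simp add: powr_powr ennreal_mult)
    qed
    also have "\<dots> = ennreal (M powr (P / s - 1)) * (\<integral>\<^sup>+ x. J x \<partial>lebesgue)"
      by (rule nn_integral_cmult) measurable
    also have "\<dots> \<le> ennreal (M powr (P / s - 1)) * (ennreal (B powr P) * ennreal M)"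
      by (rule mult_left_mono[OF J_le]) simp
    also have "\<dots> = ennreal (M powr (P / s - 1) * (B powr P * M))" using M by (simp add: ennreal_mult)
    also have "M powr (P / s - 1) * (B powr P * M) = (M powr (1 / s) * B) powr P"
      using M B s by (simp add: powr_mult powr_powr powr_diff)
    finally have 2: "Lnorm p (\<lambda>x. of_real (enn2real (I x) powr (1 / s))) \<le> ennreal (M powr (1 / s) * B)"
      using False p0 B by (subst Lnorm_le_finite) (auto simp: P_def)
    from 1 2 show "(AE x in lebesgue. I x < top) \<and> Lnorm p (\<lambda>x. of_real (enn2real (I x) powr (1 / s))) \<le> ennreal (M powr (1 / s) * B)"
      by blast
  qed
qed

lemma sum_powr_le:
  fixes t :: "'i \<Rightarrow> real"
  assumes I: "finite I" and t: "\<And>i. i \<in> I \<Longrightarrow> 0 \<le> t i" and P: "0 \<le> P"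
  shows "(\<Sum>i\<in>I. t i) powr P \<le> real (card I) powr P * (\<Sum>i\<in>I. t i powr P)"
proof (cases "I = {}")
  case False
  define m where "m = Max (t ` I)"
  have "m \<in> t ` I" unfolding m_def using I False by (intro Max_in) auto
  then obtain k where k: "k \<in> I" "m = t k" by auto
  have "(\<Sum>i\<in>I. t i) \<le> real (card I) * m"
    using I by (intro sum_bounded_above) (auto simp: m_def)
  then have "(\<Sum>i\<in>I. t i) powr P \<le> (real (card I) * m) powr P"
    using t P by (intro powr_mono2 sum_nonneg) auto
  also have "\<dots> = real (card I) powr P * t k powr P" using k t by (simp add: powr_mult)
  also have "t k powr P \<le> (\<Sum>i\<in>I. t i powr P)" using k I by (intro member_le_sum) auto
  finally show ?thesis by (simp add: mult_left_mono)
qed simp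

text \<open>A crude triangle inequality: one factor \<open>card I\<close> comes from bounding the
  sum by its largest term, the other from n \<le> n^P. The index set will depend on the dimension
  alone.\<close>

lemma Lnorm_sum_norm:
  fixes f :: "'i \<Rightarrow> 'n::euclidean_space \<Rightarrow> complex"
  assumes p: "1 \<le> p" and I: "finite I" "I \<noteq> {}" and B: "0 \<le> B"
    and m: "\<And>i. i \<in> I \<Longrightarrow> f i \<in> borel_measurable lebesgue"
    and L: "\<And>i. i \<in> I \<Longrightarrow> Lnorm p (f i) \<le> ennreal B"
  shows "Lnorm p (\<lambda>x. of_real (\<Sum>i\<in>I. norm (f i x))) \<le> ennreal (real (card I) ^ 2 * B)"
proof -
  define n where "n = real (card I)"
  have n: "n \<ge> 1" using I by (simp add: n_def Suc_le_eq card_gt_0_iff)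
  have p0: "0 < p" using p by (meson less_le_trans zero_less_one)
  show ?thesis unfolding n_def[symmetric]
  proof (cases "p = top")
    case True
    have "AE x in lebesgue. \<forall>i\<in>I. norm (f i x) \<le> B"
      using L True B I by (intro AE_finite_allI) (auto simp: Lnorm_top_le)
    then have "AE x in lebesgue. norm (complex_of_real (\<Sum>i\<in>I. norm (f i x))) \<le> n ^ 2 * B"
    proof eventually_elim
      case (elim x)
      have "(\<Sum>i\<in>I. norm (f i x)) \<le> n * B" unfolding n_def using elim by (intro sum_bounded_above) auto
      also have "n * B \<le> n ^ 2 * B" using n B by (intro mult_right_mono) (auto simp: power2_eq_square)
      finally show ?case by (simp add: sum_nonneg del: of_real_sum)
    qed
    then show "Lnorm p (\<lambda>x. of_real (\<Sum>i\<in>I. norm (f i x))) \<le> ennreal (n ^ 2 * B)"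
      using True B n by (simp add: Lnorm_top_le del: of_real_sum)
  next
    case False
    define P where "P = enn2real p"
    have pP: "p = ennreal P" using False by (simp add: P_def top.not_eq_extremum)
    have P: "P \<ge> 1" using p unfolding pP by simp
    have "(\<integral>\<^sup>+ x. ennreal (norm (complex_of_real (\<Sum>i\<in>I. norm (f i x))) powr P) \<partial>lebesgue)
      \<le> (\<integral>\<^sup>+ x. ennreal (n powr P) * (\<Sum>i\<in>I. ennreal (norm (f i x) powr P)) \<partial>lebesgue)"
    proof (rule nn_integral_mono)
      fix x
      have "norm (complex_of_real (\<Sum>i\<in>I. norm (f i x))) powr P \<le> n powr P * (\<Sum>i\<in>I. norm (f i x) powr P)"
        using sum_powr_le[OF I(1), of "\<lambda>i. norm (f i x)" P] P by (simp add: n_def sum_nonneg del: of_real_sum)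
      then show "ennreal (norm (complex_of_real (\<Sum>i\<in>I. norm (f i x))) powr P) \<le> ennreal (n powr P) * (\<Sum>i\<in>I. ennreal (norm (f i x) powr P))"
        by (simp add: ennreal_mult[symmetric] sum_nonneg ennreal_leI del: of_real_sum)
    qed
    also have "\<dots> = ennreal (n powr P) * (\<Sum>i\<in>I. (\<integral>\<^sup>+ x. ennreal (norm (f i x) powr P) \<partial>lebesgue))"
      using m by (subst nn_integral_cmult) (auto simp: nn_integral_sum simp del: sum_ennreal)
    also have "\<dots> \<le> ennreal (n powr P) * (\<Sum>i\<in>I. ennreal (B powr P))"
      using L[unfolded Lnorm_le_finite[OF False p0 B]] by (intro mult_left_mono sum_mono) (auto simp: P_def)
    also have "\<dots> = ennreal (n powr P * (n * B powr P))"
      using n by (simp add: n_def ennreal_mult ennreal_of_nat_eq_real_of_nat)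
    also have "\<dots> \<le> ennreal (n powr P * (n powr P * B powr P))"
      using n P powr_mono[of 1 P n] by (intro ennreal_leI mult_left_mono mult_right_mono) auto
    also have "n powr P * (n powr P * B powr P) = (n ^ 2 * B) powr P"
      using n B by (simp add: powr_mult power2_eq_square)
    finally show "Lnorm p (\<lambda>x. of_real (\<Sum>i\<in>I. norm (f i x))) \<le> ennreal (n ^ 2 * B)"
      using False p0 B n by (subst Lnorm_le_finite) (auto simp: P_def)
  qed
qed

section \<open>Measurability and the Leibniz rule\<close>

text \<open>The second variable is replaced by the first point of a dense sequence within 1/(k + 1)
  of it; that choice takes countably many values. Fubini needs the resulting joint measurability,
  whereas \<open>LpS\<close> grants measurability in \<open>x\<close> only at fixed \<xi>.\<close>

lemma borel_measurable_Caratheodory: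
  fixes f :: "'a \<Rightarrow> 'b::{metric_space, second_countable_topology} \<Rightarrow> complex"
  assumes m: "\<And>y. (\<lambda>x. f x y) \<in> borel_measurable M"
    and c: "\<And>x. continuous_on UNIV (f x)"
  shows "(\<lambda>(x, y). f x y) \<in> borel_measurable (M \<Otimes>\<^sub>M borel)"
proof -
  obtain D :: "'b set" where D: "countable D" "\<And>X. open X \<Longrightarrow> X \<noteq> {} \<Longrightarrow> \<exists>d\<in>D. d \<in> X"
    by (rule countable_dense_setE) blast
  have Dne: "D \<noteq> {}" using D(2)[of UNIV] by auto
  define d where "d = from_nat_into D"
  define ix where "ix k y = (LEAST i. dist (d i) y < 1 / real (Suc k))" for k y
  have ix: "dist (d (ix k y)) y < 1 / real (Suc k)" for k y
  proof -
    obtain e where "e \<in> D" "e \<in> ball y (1 / real (Suc k))" using D(2)[of "ball y (1 / real (Suc k))"] by auto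
    moreover obtain i where "d i = e" using \<open>e \<in> D\<close> D(1) unfolding d_def by (metis from_nat_into_surj)
    ultimately have "dist (d i) y < 1 / real (Suc k)" by (simp add: dist_commute)
    then show ?thesis unfolding ix_def by (rule LeastI)
  qed
  show ?thesis
  proof (rule borel_measurable_LIMSEQ_metric)
    fix k :: nat
    have "(\<lambda>z. f (fst z) (d (ix k (snd z)))) \<in> borel_measurable (M \<Otimes>\<^sub>M borel)"
    proof (rule measurable_compose_countable[where f="\<lambda>i z. f (fst z) (d i)"])
      show "(\<lambda>z. f (fst z) (d i)) \<in> borel_measurable (M \<Otimes>\<^sub>M borel)" for i :: nat
        by (rule measurable_compose[OF measurable_fst m])
      have "(\<lambda>y. ix k y) \<in> borel \<rightarrow>\<^sub>M count_space UNIV" unfolding ix_def by measurable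
      then show "(\<lambda>z. ix k (snd z)) \<in> M \<Otimes>\<^sub>M borel \<rightarrow>\<^sub>M count_space UNIV"
        by (rule measurable_compose[OF measurable_snd])
    qed
    then show "(\<lambda>z. f (fst z) (d (ix k (snd z)))) \<in> borel_measurable (M \<Otimes>\<^sub>M borel)" .
  next
    fix z :: "'a \<times> 'b"
    have "(\<lambda>k. dist (d (ix k (snd z))) (snd z)) \<longlonglongrightarrow> 0"
      by (rule tendsto_sandwich[OF _ _ tendsto_const LIMSEQ_Suc[OF lim_1_over_n[where 'a=real]]])
        (auto intro!: always_eventually less_imp_le[OF ix[simplified]])
    then have "(\<lambda>k. d (ix k (snd z))) \<longlonglongrightarrow> snd z" by (subst tendsto_dist_iff)
    then have "(\<lambda>k. f (fst z) (d (ix k (snd z)))) \<longlonglongrightarrow> f (fst z) (snd z)"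
      by (rule continuous_on_tendsto_compose[OF c]) auto
    then show "(\<lambda>k. f (fst z) (d (ix k (snd z)))) \<longlonglongrightarrow> (case z of (x, y) \<Rightarrow> f x y)"
      by (simp add: case_prod_beta)
  qed
qed

section \<open>Iterated partial derivatives of a symbol\<close>

lemma dir_deriv_dpart:
  assumes u: "smooth_fun u" and ds: "set ds \<subseteq> Basis"
  shows "dir_deriv b (dpart ds u) (dpart (b # ds) u)"
  unfolding dir_deriv_def
proof
  fix x
  have "dpart ds u differentiable (at x)" using u ds by (simp add: smooth_fun_def)
  then have "(dpart ds u has_derivative frechet_derivative (dpart ds u) (at x)) (at x)"
    by (simp add: frechet_derivative_works[symmetric])
  then have d: "(dpart ds u has_derivative frechet_derivative (dpart ds u) (at x)) (at (x + 0 *\<^sub>R b))" by simp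
  have "((\<lambda>t::real. x + t *\<^sub>R b) has_derivative (\<lambda>t. t *\<^sub>R b)) (at 0)"
    by (auto intro!: derivative_eq_intros)
  from diff_chain_at[OF this d]
  have "((\<lambda>t. dpart ds u (x + t *\<^sub>R b)) has_derivative (\<lambda>t. frechet_derivative (dpart ds u) (at x) (t *\<^sub>R b))) (at 0)"
    by (simp add: o_def)
  moreover have "frechet_derivative (dpart ds u) (at x) (t *\<^sub>R b) = t *\<^sub>R frechet_derivative (dpart ds u) (at x) b" for t
    using d by (simp add: has_derivative_bounded_linear linear_simps)
  ultimately show "((\<lambda>t. dpart ds u (x + t *\<^sub>R b)) has_vector_derivative dpart (b # ds) u x) (at 0)"
    by (simp add: has_vector_derivative_def pdir_def)
qed

lemma continuous_on_dpart:
  assumes "smooth_fun u" "set ds \<subseteq> Basis"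
  shows "continuous_on S (dpart ds u)"
  using assms by (auto simp: smooth_fun_def intro!: continuous_at_imp_continuous_on differentiable_imp_continuous_within)

lemma borel_measurable_dpart_param:
  assumes a: "\<And>\<xi>. (\<lambda>x. a x \<xi>) \<in> borel_measurable M" and sm: "\<And>x. smooth_fun (a x)" and ds: "set ds \<subseteq> Basis"
  shows "(\<lambda>x. dpart ds (a x) \<xi>) \<in> borel_measurable M"
  using ds
proof (induction ds arbitrary: \<xi>)
  case (Cons b ds)
  have [measurable]: "(\<lambda>x. dpart ds (a x) \<xi>) \<in> borel_measurable M" for \<xi> using Cons by simp
  show ?case
  proof (rule borel_measurable_LIMSEQ_metric)
    fix x
    show "(\<lambda>k. real (Suc k) *\<^sub>R (dpart ds (a x) (\<xi> + (1 / real (Suc k)) *\<^sub>R b) - dpart ds (a x) \<xi>)) \<longlonglongrightarrow> dpart (b # ds) (a x) \<xi>"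
      by (rule dir_deriv_tendsto[OF dir_deriv_dpart[OF sm]]) (use Cons.prems in auto)
  qed measurable
qed (use a in simp)

lemma borel_measurable_dpart_pair:
  assumes a: "\<And>\<xi>. (\<lambda>x. a x \<xi>) \<in> borel_measurable M" and sm: "\<And>x. smooth_fun (a x)" and ds: "set ds \<subseteq> Basis"
  shows "(\<lambda>(x, \<xi>). dpart ds (a x) \<xi>) \<in> borel_measurable (M \<Otimes>\<^sub>M borel)"
  by (rule borel_measurable_Caratheodory[OF borel_measurable_dpart_param[OF a sm ds] continuous_on_dpart[OF sm ds]])

text \<open>The iterated Leibniz rule in recursive form, which avoids binomial coefficients:
  \<open>leibniz k U V i j\<close> is the \<open>k\<close>-th derivative of \<open>U i * V j\<close> when \<open>U\<close> and \<open>V\<close> are sequences of successive derivatives.\<close>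

primrec leibniz :: "nat \<Rightarrow> (nat \<Rightarrow> 'n \<Rightarrow> complex) \<Rightarrow> (nat \<Rightarrow> 'n \<Rightarrow> complex) \<Rightarrow> nat \<Rightarrow> nat \<Rightarrow> 'n \<Rightarrow> complex" where
  "leibniz 0 U V i j = (\<lambda>x. U i x * V j x)"
| "leibniz (Suc k) U V i j = (\<lambda>x. leibniz k U V (Suc i) j x + leibniz k U V i (Suc j) x)"

lemma dir_deriv_leibniz:
  assumes U: "\<And>k. dir_deriv b (U k) (U (Suc k))" and V: "\<And>k. dir_deriv b (V k) (V (Suc k))"
  shows "dir_deriv b (leibniz k U V i j) (leibniz (Suc k) U V i j)"
proof (induction k arbitrary: i j)
  case 0
  show ?case unfolding dir_deriv_def
  proof
    fix x
    have "((\<lambda>t. U i (x + t *\<^sub>R b)) has_vector_derivative U (Suc i) x) (at 0)"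
      "((\<lambda>t. V j (x + t *\<^sub>R b)) has_vector_derivative V (Suc j) x) (at 0)"
      using U V by (auto simp: dir_deriv_def)
    from has_vector_derivative_mult[OF this]
    show "((\<lambda>t. leibniz 0 U V i j (x + t *\<^sub>R b)) has_vector_derivative leibniz (Suc 0) U V i j x) (at 0)"
      by (simp add: add.commute)
  qed
next
  case (Suc k)
  show ?case unfolding dir_deriv_def
  proof
    fix x
    have "((\<lambda>t. leibniz k U V (Suc i) j (x + t *\<^sub>R b)) has_vector_derivative leibniz (Suc k) U V (Suc i) j x) (at 0)"
      "((\<lambda>t. leibniz k U V i (Suc j) (x + t *\<^sub>R b)) has_vector_derivative leibniz (Suc k) U V i (Suc j) x) (at 0)"
      using Suc by (auto simp only: dir_deriv_def)
    from has_vector_derivative_add[OF this]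
    show "((\<lambda>t. leibniz (Suc k) U V i j (x + t *\<^sub>R b)) has_vector_derivative leibniz (Suc (Suc k)) U V i j x) (at 0)"
      by simp
  qed
qed

lemma norm_leibniz_le:
  assumes "\<And>l q. l + q = k + i + j \<Longrightarrow> i \<le> l \<Longrightarrow> j \<le> q \<Longrightarrow> norm (U l x * V q x) \<le> X"
  shows "norm (leibniz k U V i j x) \<le> 2 ^ k * X"
  using assms
proof (induction k arbitrary: i j)
  case (Suc k)
  have "norm (leibniz (Suc k) U V i j x) \<le> norm (leibniz k U V (Suc i) j x) + norm (leibniz k U V i (Suc j) x)"
    by (simp add: norm_triangle_ineq)
  also have "\<dots> \<le> 2 ^ k * X + 2 ^ k * X"
    by (intro add_mono Suc.IH Suc.prems) auto
  also have "\<dots> = 2 ^ Suc k * X" by simp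
  finally show ?case .
qed simp

lemma borel_measurable_leibniz:
  assumes "\<And>k. U k \<in> borel_measurable M" "\<And>k. V k \<in> borel_measurable M"
  shows "leibniz k U V i j \<in> borel_measurable M"
  using assms by (induction k arbitrary: i j) auto

text \<open>Decay of order 2 L on both sides of t = 1 dominates every power between -2 L and 2 L.
  With t the ratio of the bracket to 2^j, powers of the bracket can be exchanged for powers of 2^j
  as if the cutoff were supported on its shell.\<close>

lemma min_power_le_powr:
  fixes t :: real
  assumes t: "t > 0" and e: "\<bar>e\<bar> \<le> 2 * real L"
    and x: "x \<le> c * (t ^ 2) ^ L" "x \<le> c / (t ^ 2) ^ L" and c: "c \<ge> 0"
  shows "x \<le> c * t powr e"
proof (cases "t \<ge> 1")
  case True
  have "c / (t ^ 2) ^ L = c * t powr (- (2 * real L))"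
    using powr_realpow[OF t, of "2 * L"] by (simp add: powr_minus divide_inverse power_mult)
  moreover have "t powr (- (2 * real L)) \<le> t powr e" using True e by (intro powr_mono) auto
  ultimately show ?thesis using x(2) c by (smt (verit) mult_left_mono)
next
  case False
  have "c * (t ^ 2) ^ L = c * t powr (2 * real L)"
    using powr_realpow[OF t, of "2 * L"] by (simp add: power_mult)
  moreover have "t powr (2 * real L) \<le> t powr e" using False e t by (intro powr_mono') auto
  ultimately show ?thesis using x(1) c by (smt (verit) mult_left_mono)
qed

text \<open>The constant of \<open>cutoff_bound\<close> at order \<open>N\<close>, which for L > 0
  majorises the constants of all lower orders.\<close>

definition cutC :: "nat \<Rightarrow> nat \<Rightarrow> real" where
  "cutC L N = fact N * (6 * 4 ^ L * (12 * real L) ^ N)"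

lemma cutC_pos: "L > 0 \<Longrightarrow> 0 < cutC L N" by (simp add: cutC_def)

lemma cutoff_decay:
  fixes b :: "'n::euclidean_space"
  assumes b: "b \<in> Basis" and L: "L > 0" and q: "q \<le> N" and e: "\<bar>e\<bar> \<le> 2 * real L"
  shows "norm (cutoff L j b q \<xi>) \<le> cutC L N * (jbr \<xi> / 2 ^ j) powr e * jbr \<xi> powr (- real q)"
proof -
  define t where "t = jbr \<xi> / 2 ^ j"
  have t: "t > 0" by (simp add: t_def)
  have t2: "jbr \<xi> ^ 2 / 4 ^ j = t ^ 2"
  proof -
    have "(4::real) ^ j = (2 ^ j) ^ 2" by (simp add: power2_eq_square power_mult_distrib[symmetric])
    then show ?thesis by (simp add: t_def power_divide)
  qed
  define c where "c = fact q * (6 * 4 ^ L * (12 * real L) ^ q)"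
  have cC: "0 \<le> c" "c \<le> cutC L N"
    unfolding c_def cutC_def using L q by (auto intro!: mult_mono power_increasing fact_mono)
  have J: "jbr \<xi> powr (- real q) = 1 / jbr \<xi> ^ q" by (simp add: powr_minus powr_realpow divide_inverse)
  have Jp: "jbr \<xi> ^ q > 0" by simp
  have "norm (cutoff L j b q \<xi>) * jbr \<xi> ^ q \<le> c * (t ^ 2) ^ L" "norm (cutoff L j b q \<xi>) * jbr \<xi> ^ q \<le> c / (t ^ 2) ^ L"
    using cutoff_bound[OF b L, of j q \<xi>] unfolding t2 c_def[symmetric] pos_le_divide_eq[OF Jp] by auto
  from min_power_le_powr[OF t e this cC(1)]
  have "norm (cutoff L j b q \<xi>) * jbr \<xi> ^ q \<le> c * t powr e" .
  also have "\<dots> \<le> cutC L N * t powr e" using cC by (intro mult_right_mono) auto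
  finally show ?thesis unfolding J t_def[symmetric] using Jp by (simp add: field_simps)
qed

section \<open>Dyadic pieces of the operator\<close>

text \<open>Multiplying the l-th derivative by the power \<rho> l of the bracket undoes the gain
  built into the symbol class, so all summands have the same order \<open>m\<close>. Pure
  derivatives up to order n + 1 are those that \<open>wt\<close> calls for.\<close>

definition msize :: "real \<Rightarrow> ('n::euclidean_space \<Rightarrow> complex) \<Rightarrow> 'n \<Rightarrow> real" where
  "msize \<rho> u \<xi> = (\<Sum>(b, l)\<in>Basis \<times> {..Suc DIM('n)}. norm (dpart (replicate l b) u \<xi>) * jbr \<xi> powr (\<rho> * real l))"

abbreviation weighted_msize :: "real \<Rightarrow> real \<Rightarrow> ('n::euclidean_space \<Rightarrow> complex) \<Rightarrow> 'n \<Rightarrow> real" where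
  "weighted_msize \<rho> \<sigma> u \<xi> \<equiv> msize \<rho> u \<xi> * jbr \<xi> powr (- \<sigma>)"

text \<open>The weight has the scale 2^(-j \<rho>) at which the kernel of the j-th piece
  concentrates.\<close>

abbreviation weighted_shift :: "real \<Rightarrow> nat \<Rightarrow> ('n::euclidean_space \<Rightarrow> complex) \<Rightarrow> 'n \<Rightarrow> 'n \<Rightarrow> real" where
  "weighted_shift \<rho> j f x z \<equiv> norm (f (x - z)) / wt (2 powr (real j * \<rho>)) z"

abbreviation dyadic_psido :: "nat \<Rightarrow> nat \<Rightarrow> ('n::euclidean_space \<Rightarrow> complex) \<Rightarrow> ('n \<Rightarrow> complex) \<Rightarrow> 'n \<Rightarrow> complex" where
  "dyadic_psido L j u f x \<equiv>
    (LINT \<xi>|lborel. u \<xi> * dycut L j (of_real (jbr \<xi> ^ 2)) * cis (x \<bullet> \<xi>) * FT (\<lambda>y. f (- y)) \<xi>)"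

lemma msize_nonneg: "0 \<le> msize \<rho> u \<xi>"
  unfolding msize_def by (intro sum_nonneg) auto

lemma dpart_le_msize:
  fixes u :: "'n::euclidean_space \<Rightarrow> complex"
  assumes "b \<in> Basis" "l \<le> Suc DIM('n)"
  shows "norm (dpart (replicate l b) u \<xi>) * jbr \<xi> powr (\<rho> * real l) \<le> msize \<rho> u \<xi>"
  unfolding msize_def
  using member_le_sum[of "(b, l)" "Basis \<times> {..Suc DIM('n)}" "\<lambda>(b, l). norm (dpart (replicate l b) u \<xi>) * jbr \<xi> powr (\<rho> * real l)"] assms
  by auto

lemma borel_measurable_msize [measurable]:
  fixes u :: "'n::euclidean_space \<Rightarrow> complex"
  assumes "smooth_fun u"
  shows "msize \<rho> u \<in> borel_measurable borel"
proof -
  have [measurable]: "dpart (replicate l b) u \<in> borel_measurable borel" if "b \<in> Basis" for b l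
    using that by (intro borel_measurable_continuous_onI continuous_on_dpart[OF assms]) (auto simp: set_replicate_conv_if)
  show ?thesis unfolding msize_def[abs_def] case_prod_beta
  proof (intro borel_measurable_sum borel_measurable_times)
    fix i :: "'n \<times> nat" assume "i \<in> Basis \<times> {..Suc DIM('n)}"
    then have "fst i \<in> Basis" by auto
    then show "(\<lambda>\<xi>. norm (dpart (replicate (snd i) (fst i)) u \<xi>)) \<in> borel_measurable borel" by measurable
    show "(\<lambda>\<xi>. jbr \<xi> powr (\<rho> * real (snd i))) \<in> borel_measurable borel" by measurable
  qed
qed

definition piece :: "nat \<Rightarrow> nat \<Rightarrow> ('n::euclidean_space \<Rightarrow> complex) \<Rightarrow> 'n \<Rightarrow> nat \<Rightarrow> 'n \<Rightarrow> complex" where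
  "piece L j u b k = leibniz k (\<lambda>l. dpart (replicate l b) u) (cutoff L j b) 0 0"

lemma piece_0: "piece L j u b 0 \<xi> = u \<xi> * dycut L j (of_real (jbr \<xi> ^ 2))"
  by (simp add: piece_def cutoff_0 del: of_real_power)

lemma dir_deriv_piece:
  fixes u :: "'n::euclidean_space \<Rightarrow> complex"
  assumes u: "smooth_fun u" and b: "b \<in> Basis" and L: "L > 0"
  shows "dir_deriv b (piece L j u b k) (piece L j u b (Suc k))"
  unfolding piece_def
proof (rule dir_deriv_leibniz)
  fix l
  show "dir_deriv b (cutoff L j b l) (cutoff L j b (Suc l))" by (rule dir_deriv_cutoff[OF b L])
  show "dir_deriv b (dpart (replicate l b) u) (dpart (replicate (Suc l) b) u)"
    unfolding replicate_Suc by (rule dir_deriv_dpart[OF u]) (use b in auto)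
qed

lemma borel_measurable_piece:
  fixes u :: "'n::euclidean_space \<Rightarrow> complex"
  assumes u: "smooth_fun u" and b: "b \<in> Basis" and L: "L > 0"
  shows "piece L j u b k \<in> borel_measurable borel"
  unfolding piece_def
  using b by (intro borel_measurable_leibniz borel_measurable_cutoff[OF b L] borel_measurable_continuous_onI continuous_on_dpart[OF u])
    (auto simp: set_replicate_conv_if)

text \<open>A derivative falling on the cutoff gains a full power of the bracket, one falling on
  \<open>u\<close> only the power \<rho> \<le> 1, so the latter is the worst case in the Leibniz
  rule. The exponent \<open>e\<close> is left free within the decay of the cutoff: one choice gives
  the sharp bound, another plain integrability.\<close>

lemma piece_le_gen:
  fixes u :: "'n::euclidean_space \<Rightarrow> complex"
  assumes b: "b \<in> Basis" and L: "L > 0" and \<rho>: "0 \<le> \<rho>" "\<rho> \<le> 1"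
    and k: "k \<le> Suc DIM('n)" and e: "\<bar>e\<bar> \<le> 2 * real L"
  shows "norm (piece L j u b k \<xi>) \<le> 2 ^ k * (cutC L (Suc DIM('n)) * 2 powr (- real j * e) * (msize \<rho> u \<xi> * jbr \<xi> powr (e - \<rho> * real k)))"
  unfolding piece_def
proof (rule norm_leibniz_le)
  fix l q assume lq: "l + q = k + 0 + 0"
  define C where "C = cutC L (Suc DIM('n))"
  have C: "C > 0" unfolding C_def by (rule cutC_pos[OF L])
  define J where "J = jbr \<xi>"
  have J: "J \<ge> 1" "J > 0" using jbr_ge_one[of \<xi>] by (auto simp: J_def)
  define d where "d = norm (dpart (replicate l b) u \<xi>)"
  have d0: "0 \<le> d" by (simp add: d_def)
  have m: "d * J powr (\<rho> * real l) \<le> msize \<rho> u \<xi>" unfolding d_def J_def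
    by (rule dpart_le_msize[OF b]) (use lq k in auto)
  have "norm (cutoff L j b q \<xi>) \<le> C * (J / 2 ^ j) powr e * J powr (- real q)"
    unfolding C_def J_def by (rule cutoff_decay[OF b L _ e]) (use lq k in auto)
  also have "(J / 2 ^ j) powr e = 2 powr (- real j * e) * J powr e"
    using J by (simp add: powr_divide powr_realpow[symmetric] powr_powr powr_minus_divide)
  finally have c: "norm (cutoff L j b q \<xi>) \<le> C * (2 powr (- real j * e) * J powr e) * J powr (- real q)" .
  have "norm (dpart (replicate l b) u \<xi> * cutoff L j b q \<xi>)
      \<le> d * (C * (2 powr (- real j * e) * J powr e) * J powr (- real q))"
    unfolding norm_mult d_def[symmetric] by (rule mult_left_mono[OF c d0])
  also have "\<dots> = C * 2 powr (- real j * e) * (d * J powr (e - real q))"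
    using J by (simp add: powr_diff powr_minus divide_inverse mult_ac)
  also have "\<dots> \<le> C * 2 powr (- real j * e) * (d * J powr (\<rho> * real l + (e - \<rho> * real k)))"
  proof -
    have "\<rho> * real q \<le> 1 * real q" using \<rho> by (intro mult_right_mono) auto
    moreover have "\<rho> * real k = \<rho> * real l + \<rho> * real q" using lq by (metis add_0_right distrib_left of_nat_add)
    ultimately have "e - real q \<le> \<rho> * real l + (e - \<rho> * real k)" by linarith
    then show ?thesis using J C d0 by (intro mult_left_mono powr_mono) auto
  qed
  also have "\<dots> = C * 2 powr (- real j * e) * ((d * J powr (\<rho> * real l)) * J powr (e - \<rho> * real k))"
    unfolding powr_add by (simp add: mult.assoc)
  also have "\<dots> \<le> C * 2 powr (- real j * e) * (msize \<rho> u \<xi> * J powr (e - \<rho> * real k))"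
    using C by (intro mult_left_mono mult_right_mono m) auto
  finally show "norm (dpart (replicate l b) u \<xi> * cutoff L j b q \<xi>)
    \<le> cutC L (Suc DIM('n)) * 2 powr (- real j * e) * (msize \<rho> u \<xi> * jbr \<xi> powr (e - \<rho> * real k))"
    by (simp add: C_def J_def)
qed

lemma piece_bound:
  fixes u :: "'n::euclidean_space \<Rightarrow> complex"
  assumes b: "b \<in> Basis" and L: "L > 0" and \<rho>: "0 \<le> \<rho>" "\<rho> \<le> 1"
    and k: "k \<le> Suc DIM('n)" and \<sigma>: "\<bar>\<sigma>\<bar> + 2 * real (Suc DIM('n)) \<le> 2 * real L"
  shows "(2 powr (real j * \<rho>)) ^ k * norm (piece L j u b k \<xi>)
    \<le> 2 ^ k * cutC L (Suc DIM('n)) * 2 powr (real j * \<sigma>) * weighted_msize \<rho> \<sigma> u \<xi>"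
proof -
  \<comment> \<open>This choice turns the power of the bracket into -\<sigma> and that of 2^j into
    \<sigma> - \<rho> k, whose second part cancels against the prefactor.\<close>
  define e where "e = \<rho> * real k - \<sigma>"
  have "\<rho> * real k \<le> 1 * real (Suc DIM('n))" using \<rho> k by (intro mult_mono) auto
  moreover have "0 \<le> \<rho> * real k" using \<rho> by simp
  ultimately have e: "\<bar>e\<bar> \<le> 2 * real L" using \<sigma> unfolding e_def by linarith
  have pk: "(2 powr (real j * \<rho>)) ^ k = 2 powr (real j * \<rho> * real k)"
    by (simp add: powr_realpow[symmetric] powr_powr)
  have "2 powr (real j * \<rho> * real k) * norm (piece L j u b k \<xi>)
    \<le> 2 powr (real j * \<rho> * real k) * (2 ^ k * (cutC L (Suc DIM('n)) * 2 powr (- real j * e) * (msize \<rho> u \<xi> * jbr \<xi> powr (e - \<rho> * real k))))"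
    by (intro mult_left_mono piece_le_gen b L \<rho> k e) auto
  also have "2 powr (real j * \<rho> * real k) * (2 ^ k * (cutC L (Suc DIM('n)) * 2 powr (- real j * e) * (msize \<rho> u \<xi> * jbr \<xi> powr (e - \<rho> * real k))))
     = 2 ^ k * cutC L (Suc DIM('n)) * (2 powr (real j * \<rho> * real k) * 2 powr (- real j * e)) * (msize \<rho> u \<xi> * jbr \<xi> powr (e - \<rho> * real k))"
    by (simp only: mult_ac)
  also have "2 powr (real j * \<rho> * real k) * 2 powr (- real j * e) = 2 powr (real j * \<sigma>)"
    unfolding powr_add[symmetric] e_def by (simp add: algebra_simps)
  also have "e - \<rho> * real k = - \<sigma>" by (simp add: e_def)
  finally show ?thesis unfolding pk .
qed

lemma integrable_piece:
  fixes u :: "'n::euclidean_space \<Rightarrow> complex"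
  assumes u: "smooth_fun u" and b: "b \<in> Basis" and L: "L > 0" and \<rho>: "0 \<le> \<rho>" "\<rho> \<le> 1" and s: "1 \<le> s"
    and k: "k \<le> Suc DIM('n)" and \<sigma>: "\<bar>\<sigma>\<bar> + 2 * real (Suc DIM('n)) \<le> 2 * real L"
    and fin: "power_mass s (weighted_msize \<rho> \<sigma> u) < \<infinity>"
  shows "integrable lborel (piece L j u b k)"
proof -
  define N where "N = Suc DIM('n)"
  \<comment> \<open>The cutoff pays for an extra factor of order -N with N = n + 1, which is
    integrable. Its product with \<open>w\<close> is at most its sum with \<open>w powr s\<close>.
    The resulting constant grows with \<open>j\<close>, which does no harm to mere
    integrability.\<close>
  define e where "e = - \<sigma> - real N"
  have e: "\<bar>e\<bar> \<le> 2 * real L" using \<sigma> of_nat_0_le_iff[of N] unfolding e_def N_def[symmetric] by linarith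
  define K where "K = 2 ^ k * (cutC L N * 2 powr (- real j * e))"
  have K: "0 \<le> K" using cutC_pos[OF L, of N] by (simp add: K_def)
  define w where "w \<xi> = msize \<rho> u \<xi> * jbr \<xi> powr (- \<sigma>)" for \<xi>
  have w0: "0 \<le> w \<xi>" for \<xi> by (simp add: w_def msize_nonneg)
  have [measurable]: "w \<in> borel_measurable borel" unfolding w_def[abs_def] using u by measurable
  have pt: "norm (piece L j u b k \<xi>) \<le> K * (jbr \<xi> powr (- real N) + w \<xi> powr s)" for \<xi>
  proof -
    have J: "jbr \<xi> \<ge> 1" by (rule jbr_ge_one)
    have "norm (piece L j u b k \<xi>) \<le> K * (msize \<rho> u \<xi> * jbr \<xi> powr (e - \<rho> * real k))"
      using piece_le_gen[OF b L \<rho> k e, of j u \<xi>] by (simp add: K_def N_def mult.assoc)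
    also have "\<dots> \<le> K * (msize \<rho> u \<xi> * jbr \<xi> powr e)"
      using K J \<rho> by (intro mult_left_mono powr_mono) (auto simp: msize_nonneg)
    also have "msize \<rho> u \<xi> * jbr \<xi> powr e = w \<xi> * jbr \<xi> powr (- real N)"
      unfolding w_def e_def by (simp add: powr_diff powr_minus divide_inverse)
    also have "w \<xi> * jbr \<xi> powr (- real N) \<le> jbr \<xi> powr (- real N) + w \<xi> powr s"
    proof (cases "w \<xi> \<le> 1")
      case True
      then have "w \<xi> * jbr \<xi> powr (- real N) \<le> 1 * jbr \<xi> powr (- real N)" by (intro mult_right_mono) auto
      then show ?thesis by (simp add: add_increasing2)
    next
      case False
      have "jbr \<xi> powr (- real N) \<le> jbr \<xi> powr 0" using J by (intro powr_mono) auto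
      then have "w \<xi> * jbr \<xi> powr (- real N) \<le> w \<xi> * 1" using w0 J by (intro mult_left_mono) auto
      also have "\<dots> = w \<xi> powr 1" using False by simp
      also have "\<dots> \<le> w \<xi> powr s" using False s by (intro powr_mono) auto
      finally show ?thesis by (simp add: add_increasing)
    qed
    finally show ?thesis using K by (simp add: mult_left_mono)
  qed
  have "(\<integral>\<^sup>+ \<xi>. ennreal (norm (piece L j u b k \<xi>)) \<partial>lborel)
    \<le> (\<integral>\<^sup>+ \<xi>. ennreal K * (ennreal (jbr \<xi> powr (- real N)) + ennreal (w \<xi> powr s)) \<partial>lborel)"
  proof (rule nn_integral_mono)
    fix \<xi> :: 'n
    show "ennreal (norm (piece L j u b k \<xi>)) \<le> ennreal K * (ennreal (jbr \<xi> powr (- real N)) + ennreal (w \<xi> powr s))"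
      using ennreal_leI[OF pt[of \<xi>]] K by (simp add: ennreal_mult)
  qed
  also have "\<dots> = ennreal K * ((\<integral>\<^sup>+ \<xi>. ennreal (jbr \<xi> powr (- real N)) \<partial>(lborel :: 'n measure)) + (\<integral>\<^sup>+ \<xi>. ennreal (w \<xi> powr s) \<partial>lborel))"
    by (simp add: nn_integral_cmult nn_integral_add)
  also have "\<dots> < \<infinity>"
    using fin nn_integral_jbr_powr_finite[where 'n='n, of "real N"] by (simp add: ennreal_mult_less_top w_def N_def)
  finally show ?thesis
    using borel_measurable_piece[OF u b L] by (simp add: integrable_iff_bounded)
qed

text \<open>Kernel representation without Fourier inversion: the multiplication formula moves the
  transform from \<open>f\<close> to the modulated symbol, and modulation becomes translation by
  \<open>x\<close>.\<close>

lemma multiplier_norm_le: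
  fixes g f :: "'n::euclidean_space \<Rightarrow> complex"
  assumes g: "integrable lborel g" and f: "integrable lborel f"
  shows "ennreal (norm (LINT \<xi>|lborel. g \<xi> * cis (x \<bullet> \<xi>) * FT (\<lambda>y. f (- y)) \<xi>))
    \<le> (\<integral>\<^sup>+ z. ennreal (norm (FT g z) * norm (f (x - z))) \<partial>lborel)"
proof -
  have [measurable]: "g \<in> borel_measurable borel" "f \<in> borel_measurable borel" using g f by auto
  have f': "integrable lborel (\<lambda>y. f (- y))" by (rule integrable_reflect[OF f])
  have "(LINT \<xi>|lborel. g \<xi> * cis (x \<bullet> \<xi>) * FT (\<lambda>y. f (- y)) \<xi>) = (LINT y|lborel. f (- y) * FT g (x + y))"
    unfolding FT_multiplication_formula[OF f' integrable_cis[OF g]] FT_modulate ..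
  also have "ennreal (norm \<dots>) \<le> (\<integral>\<^sup>+ y. ennreal (norm (f (- y) * FT g (x + y))) \<partial>lborel)"
    by (rule integral_norm_bound_ennreal[OF integrable_mult_FT[OF f' g]])
  also have "\<dots> = (\<integral>\<^sup>+ y. (\<lambda>z. ennreal (norm (FT g z) * norm (f (x - z)))) (x + 1 *\<^sub>R y) \<partial>lborel)"
    by (simp add: norm_mult mult.commute)
  also have "\<dots> = (\<integral>\<^sup>+ z. ennreal (norm (FT g z) * norm (f (x - z))) \<partial>lborel)"
    by (subst nn_integral_lborel_affine) auto
  finally show ?thesis .
qed

text \<open>The weight \<open>wt R\<close> with R = 2^(j \<rho>) is inserted next to the transform
  of the symbol piece and divided out of \<open>f\<close>. Its cost R^(n + 1) is exactly what n + 1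
  derivatives of the piece gain, so each term is a bilinear Hausdorff--Young pairing of size 2^(j
  \<sigma>) A H.\<close>

lemma dyadic_bound:
  assumes s: "1 \<le> s" "s \<le> 2" and L: "L > 0" and \<rho>: "0 \<le> \<rho>" "\<rho> \<le> 1"
    and \<sigma>: "\<bar>\<sigma>\<bar> + 2 * real (Suc DIM('n::euclidean_space)) \<le> 2 * real L"
  obtains C :: real where "C > 0"
    "\<And>(u :: 'n \<Rightarrow> complex) f j x A H. smooth_fun u \<Longrightarrow> integrable lborel f \<Longrightarrow> 0 \<le> A \<Longrightarrow> 0 \<le> H \<Longrightarrow>
      power_mass s (weighted_msize \<rho> \<sigma> u) \<le> ennreal (A powr s) \<Longrightarrow>
      power_mass s (weighted_shift \<rho> j f x) \<le> ennreal (H powr s) \<Longrightarrow>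
      norm (dyadic_psido L j u f x)
        \<le> C * 2 powr (real j * \<sigma>) * A * H"
proof -
  obtain K :: real where K: "K > 0"
    "\<And>(g :: 'n \<Rightarrow> complex) h A B. integrable lborel g \<Longrightarrow> h \<in> borel_measurable borel \<Longrightarrow> (\<And>y. 0 \<le> h y) \<Longrightarrow>
      0 \<le> A \<Longrightarrow> 0 \<le> B \<Longrightarrow>
      power_mass s (\<lambda>x. norm (g x)) \<le> ennreal (A powr s) \<Longrightarrow>
      power_mass s h \<le> ennreal (B powr s) \<Longrightarrow>
      FT_pairing g h \<le> ennreal (K * A * B)"
    using FT_bilinear[OF s, where 'n='n] by blast
  define N where "N = Suc DIM('n)"
  define c where "c = cutC L N"
  have c: "c > 0" unfolding c_def by (rule cutC_pos[OF L])
  show thesis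
  \<comment> \<open>The 1 stands for the undifferentiated piece; each of the n directions adds the
    2^N terms of the Leibniz rule at order N.\<close>
  proof (rule that[of "K * c * (1 + real DIM('n) * 2 ^ N)"])
    show "0 < K * c * (1 + real DIM('n) * 2 ^ N)" using K(1) c by (simp add: add_pos_nonneg)
    fix u f :: "'n \<Rightarrow> complex" and j x A H
    assume u: "smooth_fun u" and f: "integrable lborel f" and A: "0 \<le> A" and H: "0 \<le> H"
      and iA: "power_mass s (weighted_msize \<rho> \<sigma> u) \<le> ennreal (A powr s)"
      and iH: "power_mass s (weighted_shift \<rho> j f x) \<le> ennreal (H powr s)"
    have [measurable]: "f \<in> borel_measurable borel" using f by auto
    define R where "R = 2 powr (real j * \<rho>)"
    have R: "R > 0" by (simp add: R_def)
    define S where "S = 2 powr (real j * \<sigma>)"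
    have S: "S > 0" by (simp add: S_def)
    define h where "h z = norm (f (x - z)) / wt R z" for z
    have wR: "wt R z > 0" for z :: 'n using wt_ge_one[of R z] R by simp
    have h0: "0 \<le> h z" for z using wR[of z] by (simp add: h_def)
    have [measurable]: "h \<in> borel_measurable borel" unfolding h_def[abs_def] by measurable
    have iA': "power_mass s (weighted_msize \<rho> \<sigma> u) < \<infinity>"
      using iA by (auto intro: order_le_less_trans)
    have int: "integrable lborel (piece L j u b k)" if "b \<in> Basis" "k \<le> N" for b k
      using that integrable_piece[OF u _ L \<rho> s(1) _ \<sigma> iA'] by (simp add: N_def)
    have FTh: "FT_pairing (piece L j u b k) h \<le> ennreal (K * (2 ^ k * c * S * A / R ^ k) * H)"
      if b: "b \<in> Basis" and k: "k \<le> N" for b k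
    proof (rule K(2)[OF int[OF b k]])
      show "0 \<le> 2 ^ k * c * S * A / R ^ k" using c S A R by auto
      show "power_mass s h \<le> ennreal (H powr s)" using iH by (simp add: h_def R_def)
      have q0: "0 \<le> 2 ^ k * c * S / R ^ k" using c S R by auto
      have "(\<integral>\<^sup>+ \<xi>. ennreal (norm (piece L j u b k \<xi>) powr s) \<partial>lborel)
        \<le> (\<integral>\<^sup>+ \<xi>. ennreal ((2 ^ k * c * S / R ^ k) powr s) * ennreal (weighted_msize \<rho> \<sigma> u \<xi> powr s) \<partial>lborel)"
      proof (rule nn_integral_mono)
        fix \<xi> :: 'n
        have "R ^ k * norm (piece L j u b k \<xi>) \<le> 2 ^ k * c * S * weighted_msize \<rho> \<sigma> u \<xi>"
          using piece_bound[OF b L \<rho> _ \<sigma>, of k j u \<xi>] k by (simp add: R_def c_def S_def N_def)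
        then have "norm (piece L j u b k \<xi>) \<le> (2 ^ k * c * S / R ^ k) * weighted_msize \<rho> \<sigma> u \<xi>"
          using R by (simp add: field_simps)
        then have "norm (piece L j u b k \<xi>) powr s \<le> ((2 ^ k * c * S / R ^ k) * weighted_msize \<rho> \<sigma> u \<xi>) powr s"
          using s by (intro powr_mono2) auto
        also have "\<dots> = (2 ^ k * c * S / R ^ k) powr s * weighted_msize \<rho> \<sigma> u \<xi> powr s"
          by (rule powr_mult)
        finally show "ennreal (norm (piece L j u b k \<xi>) powr s)
          \<le> ennreal ((2 ^ k * c * S / R ^ k) powr s) * ennreal (weighted_msize \<rho> \<sigma> u \<xi> powr s)"
          by (simp add: ennreal_mult[symmetric] ennreal_leI)
      qed
      also have "\<dots> = ennreal ((2 ^ k * c * S / R ^ k) powr s) * power_mass s (weighted_msize \<rho> \<sigma> u)"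
        using u by (intro nn_integral_cmult) measurable
      also have "\<dots> \<le> ennreal ((2 ^ k * c * S / R ^ k) powr s) * ennreal (A powr s)"
        by (rule mult_left_mono[OF iA]) simp
      also have "\<dots> = ennreal ((2 ^ k * c * S / R ^ k * A) powr s)"
        using q0 A by (simp only: ennreal_mult[symmetric] powr_ge_zero powr_mult)
      finally show "(\<integral>\<^sup>+ \<xi>. ennreal (norm (piece L j u b k \<xi>) powr s) \<partial>lborel) \<le> ennreal ((2 ^ k * c * S * A / R ^ k) powr s)"
        by simp
    qed (auto simp: h0 H)
    obtain b0 :: 'n where b0: "b0 \<in> Basis" using nonempty_Basis by blast
    define g where "g = piece L j u b0 0"
    have g0: "piece L j u b 0 = g" for b by (auto simp: g_def piece_0)
    have gi: "integrable lborel g" using int[OF b0, of 0] by (simp add: g_def)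
    have [measurable]: "g \<in> borel_measurable borel" using gi by auto
    have pm [measurable]: "piece L j u b k \<in> borel_measurable borel" if "b \<in> Basis" for b k
      by (rule borel_measurable_piece[OF u that L])
    have "ennreal (norm (dyadic_psido L j u f x))
      \<le> (\<integral>\<^sup>+ z. ennreal (norm (FT g z) * norm (f (x - z))) \<partial>lborel)"
      using multiplier_norm_le[OF gi f, of x] unfolding g_def piece_0 .
    also have "\<dots> = (\<integral>\<^sup>+ z. ennreal (norm (FT g z)) * ennreal (h z)
        + (\<Sum>b\<in>Basis. ennreal (R ^ N) * (ennreal (norm (FT (piece L j u b N) z)) * ennreal (h z))) \<partial>lborel)"
    proof (rule nn_integral_cong)
      fix z :: 'n
      have "norm (FT g z) * norm (f (x - z)) = (wt R z * norm (FT g z)) * h z"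
        using wR[of z] by (simp add: h_def)
      also have "wt R z * norm (FT g z) = norm (FT g z) + (\<Sum>b\<in>Basis. R ^ Suc DIM('n) * norm (FT (piece L j u b (Suc DIM('n))) z))"
        using R by (intro wt_norm_FT_le) (auto intro!: dir_deriv_piece u L int simp: g0 N_def)
      also have "\<dots> * h z = norm (FT g z) * h z + (\<Sum>b\<in>Basis. R ^ N * (norm (FT (piece L j u b N) z) * h z))"
        by (simp add: distrib_right sum_distrib_right mult.assoc N_def del: power_Suc)
      finally have "ennreal (norm (FT g z) * norm (f (x - z)))
        = ennreal (norm (FT g z) * h z + (\<Sum>b\<in>Basis. R ^ N * (norm (FT (piece L j u b N) z) * h z)))" by simp
      also have "\<dots> = ennreal (norm (FT g z) * h z) + ennreal (\<Sum>b\<in>Basis. R ^ N * (norm (FT (piece L j u b N) z) * h z))"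
        using R h0 by (intro ennreal_plus sum_nonneg mult_nonneg_nonneg) auto
      also have "ennreal (\<Sum>b\<in>Basis. R ^ N * (norm (FT (piece L j u b N) z) * h z))
          = (\<Sum>b\<in>Basis. ennreal (R ^ N * (norm (FT (piece L j u b N) z) * h z)))"
        using R h0 by (intro sum_ennreal[symmetric] mult_nonneg_nonneg) auto
      also have "\<dots> = (\<Sum>b\<in>Basis. ennreal (R ^ N) * (ennreal (norm (FT (piece L j u b N) z)) * ennreal (h z)))"
        using R h0 by (intro sum.cong refl) (simp add: ennreal_mult)
      finally show "ennreal (norm (FT g z) * norm (f (x - z))) = ennreal (norm (FT g z)) * ennreal (h z)
        + (\<Sum>b\<in>Basis. ennreal (R ^ N) * (ennreal (norm (FT (piece L j u b N) z)) * ennreal (h z)))"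
        using h0 by (simp add: ennreal_mult)
    qed
    also have "\<dots> = FT_pairing g h
        + (\<Sum>b\<in>Basis. ennreal (R ^ N) * FT_pairing (piece L j u b N) h)"
    proof -
      have m: "(\<lambda>z. ennreal (norm (FT (piece L j u b N) z)) * ennreal (h z)) \<in> borel_measurable lborel" if "b \<in> Basis" for b
        using that by measurable
      have mR: "(\<lambda>z. ennreal (R ^ N) * (ennreal (norm (FT (piece L j u b N) z)) * ennreal (h z))) \<in> borel_measurable lborel" if "b \<in> Basis" for b
        using that by measurable
      have "(\<integral>\<^sup>+ z. (\<Sum>b\<in>Basis. ennreal (R ^ N) * (ennreal (norm (FT (piece L j u b N) z)) * ennreal (h z))) \<partial>lborel)
         = (\<Sum>b\<in>Basis. (\<integral>\<^sup>+ z. ennreal (R ^ N) * (ennreal (norm (FT (piece L j u b N) z)) * ennreal (h z)) \<partial>lborel))"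
        by (intro nn_integral_sum mR)
      also have "\<dots> = (\<Sum>b\<in>Basis. ennreal (R ^ N) * FT_pairing (piece L j u b N) h)"
        by (intro sum.cong refl nn_integral_cmult m)
      finally show ?thesis
        by (subst nn_integral_add) (auto intro!: borel_measurable_sum mR)
    qed
    also have "\<dots> \<le> ennreal (K * c * S * A * H) + (\<Sum>b\<in>(Basis :: 'n set). ennreal (K * c * S * A * H * 2 ^ N))"
    proof (intro add_mono sum_mono)
      show "FT_pairing g h \<le> ennreal (K * c * S * A * H)"
        using FTh[OF b0, of 0] by (simp add: g_def mult_ac)
      fix b :: 'n assume b: "b \<in> Basis"
      have "ennreal (R ^ N) * FT_pairing (piece L j u b N) h
        \<le> ennreal (R ^ N) * ennreal (K * (2 ^ N * c * S * A / R ^ N) * H)"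
        by (intro mult_left_mono FTh[OF b]) auto
      also have "\<dots> = ennreal (R ^ N * (K * (2 ^ N * c * S * A / R ^ N) * H))"
        using K(1) c S A H R by (intro ennreal_mult[symmetric]) auto
      also have "R ^ N * (K * (2 ^ N * c * S * A / R ^ N) * H) = K * c * S * A * H * 2 ^ N" using R by simp
      finally show "ennreal (R ^ N) * FT_pairing (piece L j u b N) h \<le> ennreal (K * c * S * A * H * 2 ^ N)" .
    qed
    also have "\<dots> = ennreal (K * c * (1 + real DIM('n) * 2 ^ N) * S * A * H)"
    proof -
      have nn: "0 \<le> K * c * S * A * H" using K(1) c S A H by simp
      have "(\<Sum>b\<in>(Basis :: 'n set). ennreal (K * c * S * A * H * 2 ^ N)) = ennreal (\<Sum>b\<in>(Basis :: 'n set). K * c * S * A * H * 2 ^ N)"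
        using nn by (intro sum_ennreal) auto
      also have "ennreal (K * c * S * A * H) + \<dots> = ennreal (K * c * S * A * H + (\<Sum>b\<in>(Basis :: 'n set). K * c * S * A * H * 2 ^ N))"
        using nn by (intro ennreal_plus[symmetric] sum_nonneg) auto
      finally show ?thesis by (simp add: algebra_simps)
    qed
    finally have fin: "ennreal (norm (dyadic_psido L j u f x))
      \<le> ennreal (K * c * (1 + real DIM('n) * 2 ^ N) * S * A * H)" .
    have "0 \<le> K * c * (1 + real DIM('n) * 2 ^ N) * S * A * H"
      using K(1) c S A H by (intro mult_nonneg_nonneg) auto
    from fin this show "norm (dyadic_psido L j u f x)
      \<le> K * c * (1 + real DIM('n) * 2 ^ N) * 2 powr (real j * \<sigma>) * A * H"
      by (subst (asm) ennreal_le_iff) (auto simp: S_def)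
  qed
qed

section \<open>Summing the dyadic pieces\<close>

lemma schwartz_integrable:
  fixes f :: "'n::euclidean_space \<Rightarrow> complex"
  assumes "schwartz f"
  shows "integrable lborel f"
proof -
  have sm: "smooth_fun f" using assms by (simp add: schwartz_def)
  have "continuous_on UNIV (dpart [] f)" by (rule continuous_on_dpart[OF sm]) simp
  then have m: "f \<in> borel_measurable borel" by (intro borel_measurable_continuous_onI) simp
  have "\<exists>C. \<forall>x. (1 + norm x) ^ Suc DIM('n) * norm (dpart [] f x) \<le> C"
    using assms unfolding schwartz_def by (metis empty_subsetI list.set(1))
  then obtain C where C: "\<And>x. (1 + norm x) ^ Suc DIM('n) * norm (f x) \<le> C" by auto
  show ?thesis
  proof (rule integrable_jbr_powr_bound[OF _ m])
    show "real DIM('n) < real (Suc DIM('n))" by simp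
    fix x :: 'n
    have "jbr x ^ Suc DIM('n) * norm (f x) \<le> (1 + norm x) ^ Suc DIM('n) * norm (f x)"
      by (intro mult_right_mono power_mono jbr_le_one_plus_norm) (auto intro: less_imp_le)
    also have "\<dots> \<le> C" by (rule C)
    finally have "norm (f x) \<le> C / jbr x ^ Suc DIM('n)"
      unfolding pos_le_divide_eq[OF zero_less_power[OF jbr_pos]] by (simp only: mult.commute)
    then show "norm (f x) \<le> C * jbr x powr - real (Suc DIM('n))"
      unfolding powr_minus powr_realpow[OF jbr_pos] by (simp only: divide_inverse)
  qed
qed

lemma fourier_eq_FT:
  fixes f :: "'n::euclidean_space \<Rightarrow> complex"
  assumes [measurable]: "f \<in> borel_measurable borel"
  shows "fourier f \<xi> = FT (\<lambda>y. f (- y)) \<xi>"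
proof -
  have "fourier f \<xi> = (LINT x|lborel. cis (- (x \<bullet> \<xi>)) * f x)"
    unfolding fourier_def by (rule integral_completion) measurable
  also have "\<dots> = FT f (- \<xi>)" unfolding FT_def by (simp add: mult.commute inner_commute)
  also have "\<dots> = FT (\<lambda>y. f (- y)) \<xi>" by (rule FT_reflect[OF assms, symmetric])
  finally show ?thesis .
qed

lemma Lnorm_translate:
  fixes f :: "'n::euclidean_space \<Rightarrow> complex"
  assumes [measurable]: "f \<in> borel_measurable borel" and q: "0 < q" and B: "0 \<le> B" and f: "Lnorm q f \<le> ennreal B"
  shows "Lnorm q (\<lambda>x. of_real (norm (f (x - z)))) \<le> ennreal B"
proof (cases "q = top")
  case True
  \<comment> \<open>The exceptional set is encoded in a Borel function, so that its nullity can be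
    translated by a change of variables in an \<open>lborel\<close> integral.\<close>
  define h where "h x = (if norm (f x) \<le> B then 0 else 1 :: ennreal)" for x
  have [measurable]: "h \<in> borel_measurable borel" unfolding h_def[abs_def] by measurable
  have "AE x in lebesgue. norm (f x) \<le> B" using f unfolding True by (rule Lnorm_top_le[OF B, THEN iffD1])
  then have "AE x in lebesgue. h x = 0" by eventually_elim (simp add: h_def)
  then have "(\<integral>\<^sup>+ x. h x \<partial>lebesgue) = 0" by (subst nn_integral_0_iff_AE) (auto intro: measurable_completion)
  then have "(\<integral>\<^sup>+ x. h x \<partial>lborel) = 0" by (simp add: nn_integral_completion)
  then have "(\<integral>\<^sup>+ x. h (- z + 1 *\<^sub>R x) \<partial>lborel) = 0" by (subst nn_integral_lborel_affine) auto
  then have "AE x in lborel. h (x - z) = 0" by (subst (asm) nn_integral_0_iff_AE) auto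
  then have "AE x in lebesgue. h (x - z) = 0" by (rule AE_completion)
  then have "AE x in lebesgue. norm (complex_of_real (norm (f (x - z)))) \<le> B"
    by eventually_elim (auto simp: h_def split: if_splits)
  then show ?thesis unfolding True by (rule Lnorm_top_le[OF B, THEN iffD2])
next
  case False
  let ?Q = "enn2real q"
  have "(\<integral>\<^sup>+ x. ennreal (norm (complex_of_real (norm (f (x - z)))) powr ?Q) \<partial>lebesgue)
     = (\<integral>\<^sup>+ x. (\<lambda>x. ennreal (norm (f x) powr ?Q)) (- z + 1 *\<^sub>R x) \<partial>lborel)"
    by (simp add: nn_integral_completion)
  also have "\<dots> = (\<integral>\<^sup>+ x. ennreal (norm (f x) powr ?Q) \<partial>lebesgue)"
    by (subst nn_integral_lborel_affine) (auto simp: nn_integral_completion)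
  also have "\<dots> \<le> ennreal (B powr ?Q)" by (rule Lnorm_le_finite[OF False q B, THEN iffD1, OF f])
  finally show ?thesis by (rule Lnorm_le_finite[OF False q B, THEN iffD2])
qed

text \<open>Only finitely many derivatives enter, so one constant serves them all; dividing by the
  order \<open>m\<close> makes it uniform in \<xi>, as required of the slices in
  \<open>Lnorm_integral_powr\<close>.\<close>

lemma msize_Lnorm_bound:
  fixes a :: "'n::euclidean_space \<Rightarrow> 'n \<Rightarrow> complex"
  assumes p: "1 \<le> p" and m: "\<And>\<xi>. (\<lambda>x. a x \<xi>) \<in> borel_measurable lebesgue" and sm: "\<And>x. smooth_fun (a x)"
    and bd: "\<And>ds. set ds \<subseteq> Basis \<Longrightarrow> \<exists>C::real. \<forall>\<xi>. Lnorm p (\<lambda>x. dpart ds (a x) \<xi>) \<le> ennreal (C * jbr \<xi> powr (m - \<rho> * real (length ds)))"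
  obtains B :: real where "0 \<le> B" "\<And>\<xi>. Lnorm p (\<lambda>x. of_real (msize \<rho> (a x) \<xi> * jbr \<xi> powr (- m))) \<le> ennreal B"
proof -
  define I where "I = (Basis :: 'n set) \<times> {..Suc DIM('n)}"
  have I: "finite I" "I \<noteq> {}" by (auto simp: I_def)
  have p0: "0 < p" using p by (meson less_le_trans zero_less_one)
  have sub: "set (replicate l b) \<subseteq> Basis" if "b \<in> Basis" for l and b :: 'n using that by auto
  have "\<forall>i\<in>I. \<exists>C::real. \<forall>\<xi>. Lnorm p (\<lambda>x. dpart (replicate (snd i) (fst i)) (a x) \<xi>) \<le> ennreal (C * jbr \<xi> powr (m - \<rho> * real (snd i)))"
    using bd[OF sub] by (auto simp: I_def)
  then obtain C where C: "\<And>i \<xi>. i \<in> I \<Longrightarrow> Lnorm p (\<lambda>x. dpart (replicate (snd i) (fst i)) (a x) \<xi>) \<le> ennreal (C i * jbr \<xi> powr (m - \<rho> * real (snd i)))"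
    by metis
  \<comment> \<open>Absolute values are taken because \<open>LpS\<close> does not force its
    constants to be nonnegative: \<open>ennreal\<close> sends negative reals to 0.\<close>
  define D where "D = (\<Sum>i\<in>I. \<bar>C i\<bar>)"
  have D: "0 \<le> D" by (auto simp: D_def)
  show thesis
  proof (rule that)
    show "0 \<le> real (card I) ^ 2 * D" using D by simp
    fix \<xi> :: 'n
    define F where "F i x = complex_of_real (jbr \<xi> powr (\<rho> * real (snd i) - m)) * dpart (replicate (snd i) (fst i)) (a x) \<xi>" for i x
    have dm: "(\<lambda>x. dpart (replicate (snd i) (fst i)) (a x) \<xi>) \<in> borel_measurable lebesgue" if "i \<in> I" for i
      using that by (intro borel_measurable_dpart_param[OF m sm] sub) (auto simp: I_def)
    have "Lnorm p (\<lambda>x. of_real (\<Sum>i\<in>I. norm (F i x))) \<le> ennreal (real (card I) ^ 2 * D)"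
    proof (rule Lnorm_sum_norm[OF p I D])
      fix i assume i: "i \<in> I"
      show "F i \<in> borel_measurable lebesgue" unfolding F_def[abs_def]
        by (intro borel_measurable_times borel_measurable_const dm i)
      have CD: "\<bar>C i\<bar> \<le> D" unfolding D_def using i I by (intro member_le_sum) auto
      have "Lnorm p (\<lambda>x. dpart (replicate (snd i) (fst i)) (a x) \<xi>) \<le> ennreal (\<bar>C i\<bar> * jbr \<xi> powr (m - \<rho> * real (snd i)))"
        by (rule order_trans[OF C[OF i]]) (intro ennreal_leI mult_right_mono, auto)
      then have "Lnorm p (F i) \<le> ennreal (jbr \<xi> powr (\<rho> * real (snd i) - m) * (\<bar>C i\<bar> * jbr \<xi> powr (m - \<rho> * real (snd i))))"
        unfolding F_def[abs_def] by (intro Lnorm_scale p0 dm i) auto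
      also have "jbr \<xi> powr (\<rho> * real (snd i) - m) * (\<bar>C i\<bar> * jbr \<xi> powr (m - \<rho> * real (snd i))) = \<bar>C i\<bar>"
        using less_imp_neq[OF jbr_pos[of \<xi>]] by (simp add: powr_add[symmetric] mult.left_commute)
      also have "ennreal \<bar>C i\<bar> \<le> ennreal D" by (rule ennreal_leI[OF CD])
      finally show "Lnorm p (F i) \<le> ennreal D" .
    qed
    moreover have "(\<Sum>i\<in>I. norm (F i x)) = msize \<rho> (a x) \<xi> * jbr \<xi> powr (- m)" for x
      unfolding msize_def I_def[symmetric] sum_distrib_right F_def
      by (intro sum.cong refl) (simp add: case_prod_beta norm_mult norm_inverse powr_diff powr_minus divide_inverse mult_ac)
    ultimately show "Lnorm p (\<lambda>x. of_real (msize \<rho> (a x) \<xi> * jbr \<xi> powr (- m))) \<le> ennreal (real (card I) ^ 2 * D)"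
      by simp
  qed
qed

text \<open>The integral defining the operator is not assumed to converge: if it does not, the Bochner integral is
  \<open>0\<close> and the bound is trivial.\<close>

lemma psido_le_of_dyadic:
  fixes u f :: "'n::euclidean_space \<Rightarrow> complex"
  assumes u [measurable]: "u \<in> borel_measurable borel" and f: "integrable lborel f" and L: "L > 0"
    and int: "\<And>j. integrable lborel (\<lambda>\<xi>. u \<xi> * dycut L j (of_real (jbr \<xi> ^ 2)))"
    and bd: "\<And>j. norm (dyadic_psido L j u f x) \<le> K * r ^ j"
    and r: "0 \<le> r" "r < 1" and K: "0 \<le> K"
  shows "norm (LINT \<xi>|lebesgue. u \<xi> * cis (x \<bullet> \<xi>) * fourier f \<xi>) \<le> K / (1 - r)"
proof -
  have [measurable]: "f \<in> borel_measurable borel" using f by auto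
  define \<Phi> where "\<Phi> = FT (\<lambda>y. f (- y))"
  let ?u = "\<lambda>\<xi>. u \<xi> * cis (x \<bullet> \<xi>) * \<Phi> \<xi>"
  have [measurable]: "\<Phi> \<in> borel_measurable borel" unfolding \<Phi>_def by measurable
  have f': "integrable lborel (\<lambda>y. f (- y))" by (rule integrable_reflect[OF f])
  have "(LINT \<xi>|lebesgue. u \<xi> * cis (x \<bullet> \<xi>) * fourier f \<xi>) = (LINT \<xi>|lebesgue. ?u \<xi>)"
    by (simp add: fourier_eq_FT \<Phi>_def)
  also have "\<dots> = (LINT \<xi>|lborel. ?u \<xi>)" by (rule integral_completion) measurable
  finally have eq: "(LINT \<xi>|lebesgue. u \<xi> * cis (x \<bullet> \<xi>) * fourier f \<xi>) = (LINT \<xi>|lborel. ?u \<xi>)" .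
  have K1: "0 \<le> K / (1 - r)" using K r by simp
  show ?thesis
  proof (cases "integrable lborel ?u")
    case False
    then show ?thesis unfolding eq using K1 by (simp add: not_integrable_integral_eq)
  next
    case True
    define \<kappa> where "\<kappa> J \<xi> = (\<Sum>j\<le>J. dycut L j (of_real (jbr \<xi> ^ 2)))" for J and \<xi> :: 'n
    \<comment> \<open>By telescoping, the partial sums lie between 0 and 1 and tend to 1, so the
      full integrand itself is the dominating function.\<close>
    have \<kappa>: "\<kappa> J \<xi> = of_real (1 / (1 + (jbr \<xi> ^ 2 / 4 ^ J) ^ L))" for J \<xi>
      unfolding \<kappa>_def sum_dycut by simp
    have [measurable]: "\<kappa> J \<in> borel_measurable borel" for J unfolding \<kappa>[abs_def] by measurable
    have intj: "integrable lborel (\<lambda>\<xi>. u \<xi> * dycut L j (of_real (jbr \<xi> ^ 2)) * cis (x \<bullet> \<xi>) * \<Phi> \<xi>)" for j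
      using integrable_mult_FT[OF integrable_cis[OF int[of j], of x] f', of 0] by (simp add: \<Phi>_def)
    have SJ: "norm (LINT \<xi>|lborel. \<kappa> J \<xi> * (?u \<xi>)) \<le> K / (1 - r)" for J
    proof -
      have "(LINT \<xi>|lborel. \<kappa> J \<xi> * (?u \<xi>))
        = (LINT \<xi>|lborel. (\<Sum>j\<le>J. u \<xi> * dycut L j (of_real (jbr \<xi> ^ 2)) * cis (x \<bullet> \<xi>) * \<Phi> \<xi>))"
        unfolding \<kappa>_def sum_distrib_right by (simp add: mult_ac)
      also have "\<dots> = (\<Sum>j\<le>J. LINT \<xi>|lborel. u \<xi> * dycut L j (of_real (jbr \<xi> ^ 2)) * cis (x \<bullet> \<xi>) * \<Phi> \<xi>)"
        by (intro Bochner_Integration.integral_sum intj)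
      also have "norm \<dots> \<le> (\<Sum>j\<le>J. K * r ^ j)"
        using bd by (intro sum_norm_le) (simp add: \<Phi>_def)
      also have "\<dots> = K * (\<Sum>j\<le>J. r ^ j)" by (simp add: sum_distrib_left)
      also have "\<dots> \<le> K * (1 / (1 - r))"
      proof (rule mult_left_mono[OF _ K])
        have "(\<Sum>j\<le>J. r ^ j) \<le> (\<Sum>j. r ^ j)" using r by (intro sum_le_suminf summable_geometric) auto
        also have "\<dots> = 1 / (1 - r)" using r by (intro suminf_geometric) auto
        finally show "(\<Sum>j\<le>J. r ^ j) \<le> 1 / (1 - r)" .
      qed
      finally show ?thesis by simp
    qed
    have "(\<lambda>J. LINT \<xi>|lborel. \<kappa> J \<xi> * (?u \<xi>)) \<longlonglongrightarrow> (LINT \<xi>|lborel. ?u \<xi>)"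
    proof (rule integral_dominated_convergence)
      show "integrable lborel (\<lambda>\<xi>. norm (?u \<xi>))" using True by (rule integrable_norm)
      show "AE \<xi> in lborel. (\<lambda>J. \<kappa> J \<xi> * (?u \<xi>)) \<longlonglongrightarrow> ?u \<xi>"
      proof (rule AE_I2)
        fix \<xi> :: 'n
        have "(\<lambda>J. jbr \<xi> ^ 2 * (1/4) ^ J) \<longlonglongrightarrow> jbr \<xi> ^ 2 * 0"
          by (intro tendsto_mult tendsto_const LIMSEQ_power_zero) auto
        then have "(\<lambda>J. jbr \<xi> ^ 2 / 4 ^ J) \<longlonglongrightarrow> 0" by (simp add: power_divide)
        then have "(\<lambda>J. (jbr \<xi> ^ 2 / 4 ^ J) ^ L) \<longlonglongrightarrow> 0 ^ L" by (rule tendsto_power)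
        then have z: "(\<lambda>J. (jbr \<xi> ^ 2 / 4 ^ J) ^ L) \<longlonglongrightarrow> 0" using L by (simp add: zero_power)
        have "(\<lambda>J. 1 / (1 + (jbr \<xi> ^ 2 / 4 ^ J) ^ L)) \<longlonglongrightarrow> 1 / (1 + 0)"
          by (intro tendsto_divide tendsto_add tendsto_const z) simp
        then have "(\<lambda>J. \<kappa> J \<xi>) \<longlonglongrightarrow> of_real (1 / (1 + 0))" unfolding \<kappa> by (rule tendsto_of_real)
        then have "(\<lambda>J. \<kappa> J \<xi> * (?u \<xi>)) \<longlonglongrightarrow> of_real (1 / (1 + 0)) * (?u \<xi>)"
          by (intro tendsto_mult tendsto_const)
        then show "(\<lambda>J. \<kappa> J \<xi> * (?u \<xi>)) \<longlonglongrightarrow> ?u \<xi>" by simp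
      qed
      fix J
      show "AE \<xi> in lborel. norm (\<kappa> J \<xi> * (?u \<xi>)) \<le> norm (?u \<xi>)"
      proof (rule AE_I2)
        fix \<xi> :: 'n
        have "0 \<le> (jbr \<xi> ^ 2 / 4 ^ J) ^ L" by simp
        then have "norm (\<kappa> J \<xi>) \<le> 1" unfolding \<kappa> norm_of_real by (simp del: zero_le_power)
        then show "norm (\<kappa> J \<xi> * (?u \<xi>)) \<le> norm (?u \<xi>)"
          unfolding norm_mult[of "\<kappa> J \<xi>"] by (intro mult_left_le_one_le) auto
      qed
    qed measurable
    then have "(\<lambda>J. norm (LINT \<xi>|lborel. \<kappa> J \<xi> * (?u \<xi>))) \<longlonglongrightarrow> norm (LINT \<xi>|lborel. ?u \<xi>)"
      by (rule tendsto_norm)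
    then show ?thesis unfolding eq by (rule LIMSEQ_le_const2) (use SJ in auto)
  qed
qed

text \<open>Smoothness for every \<open>x\<close>, not merely almost every one, provides the
  continuity in \<xi> on which the joint measurability of the symbol and its derivatives
  rests.\<close>

lemma psido_bound_smooth:
  fixes a :: "'n::euclidean_space \<Rightarrow> 'n \<Rightarrow> complex"
    and p q r :: ennreal and m \<rho> :: real
  assumes r0: "0 < r" and p1: "1 \<le> p" and q1: "1 \<le> q"
    and pqr: "inverse r = inverse q + inverse p"
    and \<rho>: "0 \<le> \<rho>" "\<rho> \<le> 1"
    and am: "\<And>\<xi>. (\<lambda>x. a x \<xi>) \<in> borel_measurable lebesgue" and sm: "\<And>x. smooth_fun (a x)"
    and bd: "\<And>ds. set ds \<subseteq> Basis \<Longrightarrow> \<exists>C::real. \<forall>\<xi>. Lnorm p (\<lambda>x. dpart ds (a x) \<xi>) \<le> ennreal (C * jbr \<xi> powr (m - \<rho> * real (length ds)))"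
    and m: "m < real DIM('n) * (\<rho> - 1) / enn2real (min 2 (min p q))"
  shows "\<exists>C::real. \<forall>f. schwartz f \<longrightarrow> Lnorm r (psido a f) \<le> ennreal C * Lnorm q f"
proof -
  define s where "s = enn2real (min 2 (min p q))"
  have "min 2 (min p q) < top" by (simp add: min_less_iff_disj)
  then have s_eq: "ennreal s = min 2 (min p q)" by (simp add: s_def)
  have "1 \<le> ennreal s" unfolding s_eq using p1 q1 by simp
  then have s1: "1 \<le> s" by simp
  have "ennreal s \<le> ennreal 2" unfolding s_eq by (simp add: min.coboundedI1)
  then have s2: "s \<le> 2" by (subst (asm) ennreal_le_iff) auto
  have sp: "ennreal s \<le> p" and sq: "ennreal s \<le> q" unfolding s_eq by (auto simp: min.coboundedI2 min.coboundedI1)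
  have p0: "0 < p" and q0: "0 < q" using p1 q1 by (meson less_le_trans zero_less_one)+
  define n where "n = real DIM('n)"
  have n: "n > 0" by (simp add: n_def)
  define \<delta> where "\<delta> = (\<rho> * n / s - n / s - m) / 3"
  have "n * (\<rho> - 1) / s = \<rho> * n / s - n / s" by (simp add: algebra_simps diff_divide_distrib)
  then have \<delta>: "\<delta> > 0" using m unfolding s_def[symmetric] n_def[symmetric] \<delta>_def by simp
  \<comment> \<open>The term n/s is the price of L^s integrability in \<xi> of a symbol of order
    \<open>m\<close>, and \<delta> makes that integrability strict. By the next identity \<sigma> +
    \<delta> still stays \<delta> below the gain \<rho> n / s from the kernel scale.\<close>
  define \<sigma> where "\<sigma> = m + n / s + \<delta>"
  have \<sigma>\<delta>: "(\<sigma> + \<delta>) * s = \<rho> * n - \<delta> * s"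
    using s1 by (simp add: \<sigma>_def \<delta>_def field_simps)
  define L where "L = nat \<lceil>\<bar>\<sigma>\<bar>\<rceil> + Suc DIM('n)"
  have L: "L > 0" by (simp add: L_def)
  have L\<sigma>: "\<bar>\<sigma>\<bar> + 2 * real (Suc DIM('n)) \<le> 2 * real L"
  proof -
    have gen: "y + 2 * d \<le> 2 * (c + d)" if "y \<le> c" "0 \<le> y" for y c d :: real using that by simp
    show ?thesis unfolding L_def of_nat_add by (rule gen[OF real_nat_ceiling_ge abs_ge_zero])
  qed
  obtain K :: real where K: "K > 0"
    "\<And>(u :: 'n \<Rightarrow> complex) f j x A H. smooth_fun u \<Longrightarrow> integrable lborel f \<Longrightarrow> 0 \<le> A \<Longrightarrow> 0 \<le> H \<Longrightarrow>
      power_mass s (weighted_msize \<rho> \<sigma> u) \<le> ennreal (A powr s) \<Longrightarrow>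
      power_mass s (weighted_shift \<rho> j f x) \<le> ennreal (H powr s) \<Longrightarrow>
      norm (dyadic_psido L j u f x)
        \<le> K * 2 powr (real j * \<sigma>) * A * H"
    using dyadic_bound[OF s1 s2 L \<rho> L\<sigma>] by blast

  \<comment> \<open>The exponent -\<sigma> s is split into -m s, which normalises the symbol, and
    -(n + \<delta> s), an integrable density. Thus \<open>A\<close> is an L^s norm over a finite
    measure, as Minkowski's inequality requires.\<close>
  define v where "v \<xi> = jbr \<xi> powr (- (n + \<delta> * s))" for \<xi> :: 'n
  have [measurable]: "v \<in> borel_measurable borel" unfolding v_def[abs_def] by measurable
  define N1 where "N1 = density lborel (\<lambda>\<xi>. ennreal (v \<xi>))"
  have N1_fin: "emeasure N1 (space N1) < \<infinity>"
    using nn_integral_jbr_powr_finite[where 'n='n, of "n + \<delta> * s"] \<delta> s1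
    by (simp add: N1_def emeasure_density v_def n_def)
  then have fN1: "finite_measure N1" by (intro finite_measureI) auto
  define M1 where "M1 = enn2real (emeasure N1 (space N1)) + 1"
  have M1: "0 < M1" "emeasure N1 (space N1) \<le> ennreal M1"
    using N1_fin by (auto simp: M1_def add_nonneg_pos ennreal_plus top.not_eq_extremum intro!: add_increasing2)
  define g1 where "g1 x \<xi> = msize \<rho> (a x) \<xi> * jbr \<xi> powr (- m)" for x \<xi>
  have g1_0: "0 \<le> g1 x \<xi>" for x \<xi> by (simp add: g1_def msize_nonneg)
  have g1_m: "(\<lambda>(x, \<xi>). g1 x \<xi>) \<in> borel_measurable (lebesgue \<Otimes>\<^sub>M N1)"
  proof -
    have "(\<lambda>z. \<Sum>i\<in>Basis \<times> {..Suc DIM('n)}. norm (dpart (replicate (snd i) (fst i)) (a (fst z)) (snd z)) * jbr (snd z) powr (\<rho> * real (snd i)))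
        \<in> borel_measurable (lebesgue \<Otimes>\<^sub>M borel)"
    proof (intro borel_measurable_sum borel_measurable_times)
      fix i :: "'n \<times> nat" assume "i \<in> Basis \<times> {..Suc DIM('n)}"
      then have "fst i \<in> Basis" by auto
      then have "(\<lambda>z. dpart (replicate (snd i) (fst i)) (a (fst z)) (snd z)) \<in> borel_measurable (lebesgue \<Otimes>\<^sub>M borel)"
        using borel_measurable_dpart_pair[OF am sm, of "replicate (snd i) (fst i)"]
        by (simp add: case_prod_beta set_replicate_conv_if)
      then show "(\<lambda>z. norm (dpart (replicate (snd i) (fst i)) (a (fst z)) (snd z))) \<in> borel_measurable (lebesgue \<Otimes>\<^sub>M borel)"
        by measurable
      show "(\<lambda>z. jbr (snd z) powr (\<rho> * real (snd i))) \<in> borel_measurable (lebesgue \<Otimes>\<^sub>M borel)" by measurable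
    qed
    then have "(\<lambda>(x, \<xi>). g1 x \<xi>) \<in> borel_measurable (lebesgue \<Otimes>\<^sub>M (borel :: 'n measure))"
      unfolding g1_def msize_def case_prod_beta by measurable
    moreover have se: "sets (lebesgue \<Otimes>\<^sub>M N1) = sets (lebesgue \<Otimes>\<^sub>M (borel :: 'n measure))"
      by (intro sets_pair_measure_cong) (auto simp: N1_def)
    ultimately show ?thesis by (subst measurable_cong_sets[OF se refl])
  qed
  obtain B1 where B1: "0 \<le> B1" "\<And>\<xi>. Lnorm p (\<lambda>x. of_real (g1 x \<xi>)) \<le> ennreal B1"
    unfolding g1_def using msize_Lnorm_bound[OF p1 am sm bd] by blast
  define I1 where "I1 x = (\<integral>\<^sup>+ \<xi>. ennreal (g1 x \<xi> powr s) \<partial>N1)" for x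
  define A where "A x = enn2real (I1 x) powr (1 / s)" for x
  note LA = Lnorm_integral_powr[OF s1 sp fN1 M1 g1_m g1_0 B1(1) B1(2), folded I1_def, folded A_def]
  have A0: "0 \<le> A x" for x by (simp add: A_def)
  have A_le: "power_mass s (weighted_msize \<rho> \<sigma> (a x)) = ennreal (A x powr s)"
    if "I1 x < top" for x
  proof -
    have [measurable]: "msize \<rho> (a x) \<in> borel_measurable borel" by (rule borel_measurable_msize[OF sm])
    have "I1 x = (\<integral>\<^sup>+ \<xi>. ennreal (v \<xi>) * ennreal (g1 x \<xi> powr s) \<partial>lborel)"
      unfolding I1_def N1_def g1_def by (subst nn_integral_density) auto
    also have "\<dots> = power_mass s (weighted_msize \<rho> \<sigma> (a x))"
    proof (rule nn_integral_cong)
      fix \<xi> :: 'n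
      have "v \<xi> * g1 x \<xi> powr s = msize \<rho> (a x) \<xi> powr s * jbr \<xi> powr (- (n + \<delta> * s) + - m * s)"
        by (simp only: v_def g1_def powr_mult powr_powr powr_add mult_ac)
      also have "- (n + \<delta> * s) + - m * s = - \<sigma> * s"
        using s1 by (simp add: \<sigma>_def field_simps)
      also have "msize \<rho> (a x) \<xi> powr s * jbr \<xi> powr (- \<sigma> * s) = weighted_msize \<rho> \<sigma> (a x) \<xi> powr s"
        by (simp add: powr_mult powr_powr)
      finally show "ennreal (v \<xi>) * ennreal (g1 x \<xi> powr s) = ennreal (weighted_msize \<rho> \<sigma> (a x) \<xi> powr s)"
        by (simp add: ennreal_mult[symmetric] v_def)
    qed
    finally have "power_mass s (weighted_msize \<rho> \<sigma> (a x)) = I1 x" ..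
    also have "I1 x = ennreal (A x powr s)" using that s1 by (simp add: A_def powr_powr)
    finally show ?thesis .
  qed

  \<comment> \<open>The factor 2^(j (\<sigma> + \<delta>)) is the largest that leaves the masses of
    the \<open>w j\<close> summable with ratio 2^(-\<delta> s). Their sum \<open>W\<close> dominates
    each one, so a single \<open>F\<close> serves all scales with a spare factor 2^(-j (\<sigma> +
    \<delta>)).\<close>
  define w where "w j z = (2 powr (real j * (\<sigma> + \<delta>)) / wt (2 powr (real j * \<rho>)) z) powr s" for j and z :: 'n
  have [measurable]: "w j \<in> borel_measurable borel" for j unfolding w_def[abs_def] by measurable
  define W where "W z = (\<Sum>j. ennreal (w j z))" for z
  have [measurable]: "W \<in> borel_measurable borel" unfolding W_def[abs_def] by measurable
  define N2 where "N2 = density lborel W"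
  have N2_fin: "emeasure N2 (space N2) < \<infinity>"
  proof -
    obtain C where C: "C \<ge> 0" "\<And>R. R > 0 \<Longrightarrow> (\<integral>\<^sup>+ y. ennreal (1 / wt R y) \<partial>(lborel :: 'n measure)) = ennreal (C / R ^ DIM('n))"
      using nn_integral_inverse_wt[where 'n='n] by blast
    define t where "t = 2 powr (- (\<delta> * s))"
    have t: "0 \<le> t" "t < 1" using \<delta> s1 by (auto simp: t_def powr_less_one)
    have wj: "(\<integral>\<^sup>+ z. ennreal (w j z) \<partial>lborel) \<le> ennreal (C * t ^ j)" for j
    proof -
      define R where "R = 2 powr (real j * \<rho>)"
      have R: "R > 0" by (simp add: R_def)
      have "(\<integral>\<^sup>+ z. ennreal (w j z) \<partial>lborel) \<le> (\<integral>\<^sup>+ z. ennreal (2 powr (real j * ((\<sigma> + \<delta>) * s))) * ennreal (1 / wt R z) \<partial>(lborel :: 'n measure))"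
      proof (rule nn_integral_mono)
        fix z :: 'n
        have wt: "1 \<le> wt R z" using R by (intro wt_ge_one) auto
        have "w j z = 2 powr (real j * ((\<sigma> + \<delta>) * s)) / wt R z powr s"
          using wt by (simp add: w_def R_def[symmetric] powr_divide powr_powr mult.assoc)
        also have "\<dots> \<le> 2 powr (real j * ((\<sigma> + \<delta>) * s)) / wt R z powr 1"
          using wt s1 by (intro divide_left_mono powr_mono) auto
        also have "\<dots> = 2 powr (real j * ((\<sigma> + \<delta>) * s)) * (1 / wt R z)" using wt by simp
        finally show "ennreal (w j z) \<le> ennreal (2 powr (real j * ((\<sigma> + \<delta>) * s))) * ennreal (1 / wt R z)"
          using wt by (simp add: ennreal_mult[symmetric] ennreal_leI)
      qed
      also have "\<dots> = ennreal (2 powr (real j * ((\<sigma> + \<delta>) * s))) * ennreal (C / R ^ DIM('n))"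
        unfolding C(2)[OF R, symmetric] by (rule nn_integral_cmult) measurable
      also have "\<dots> = ennreal (C * (2 powr (real j * ((\<sigma> + \<delta>) * s)) / R ^ DIM('n)))"
        using C(1) R by (simp add: ennreal_mult[symmetric] mult.commute)
      also have "2 powr (real j * ((\<sigma> + \<delta>) * s)) / R ^ DIM('n) = t ^ j"
        unfolding R_def t_def \<sigma>\<delta>
        by (simp add: powr_realpow[symmetric] powr_powr powr_diff[symmetric] n_def algebra_simps)
      finally show ?thesis .
    qed
    have "emeasure N2 (space N2) = (\<integral>\<^sup>+ z. W z \<partial>lborel)" by (simp add: N2_def emeasure_density)
    also have "\<dots> = (\<Sum>j. (\<integral>\<^sup>+ z. ennreal (w j z) \<partial>lborel))" unfolding W_def by (rule nn_integral_suminf) measurable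
    also have "\<dots> \<le> (\<Sum>j. ennreal (C * t ^ j))" by (intro suminf_le wj) auto
    also have "\<dots> < \<infinity>"
    proof -
      have "summable (\<lambda>j. C * t ^ j)" using t by (intro summable_mult summable_geometric) auto
      then show ?thesis using C(1) t by (subst suminf_ennreal2) auto
    qed
    finally show ?thesis .
  qed
  then have fN2: "finite_measure N2" by (intro finite_measureI) auto
  define M2 where "M2 = enn2real (emeasure N2 (space N2)) + 1"
  have M2: "0 < M2" "emeasure N2 (space N2) \<le> ennreal M2"
    using N2_fin by (auto simp: M2_def add_nonneg_pos ennreal_plus top.not_eq_extremum intro!: add_increasing2)

  define rr where "rr = 2 powr (- \<delta>)"
  have rr: "0 \<le> rr" "rr < 1" using \<delta> by (auto simp: rr_def powr_less_one)
  define K' where "K' = K / (1 - rr)"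
  have K': "0 \<le> K'" using K(1) rr by (simp add: K'_def)
  define Ct where "Ct = K' * (M1 powr (1 / s) * B1) * M2 powr (1 / s)"
  have Ct: "0 \<le> Ct" using K' B1(1) by (simp add: Ct_def)
  show ?thesis
  \<comment> \<open>Adding 1 keeps the constant positive, so that the bound is trivially true when
    \<open>Lnorm q f\<close> is infinite; in \<open>ennreal\<close> zero times infinity would be
    0.\<close>
  proof (intro exI[of _ "Ct + 1"] allI impI)
    fix f :: "'n \<Rightarrow> complex" assume "schwartz f"
    then have f: "integrable lborel f" by (rule schwartz_integrable)
    then have fm [measurable]: "f \<in> borel_measurable borel" by auto
    show "Lnorm r (psido a f) \<le> ennreal (Ct + 1) * Lnorm q f"
    proof (cases "Lnorm q f")
      case top
      then show ?thesis using Ct by (simp add: ennreal_mult_top)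
    next
      case (real B)
      define g2 where "g2 x z = norm (f (x - z))" for x z
      have g2_m: "(\<lambda>(x, z). g2 x z) \<in> borel_measurable (lebesgue \<Otimes>\<^sub>M N2)"
      proof -
        have [measurable]: "(\<lambda>x. x) \<in> lebesgue \<rightarrow>\<^sub>M (borel :: 'n measure)"
          by (rule measurable_completion) simp
        have "(\<lambda>z. fst z) \<in> lebesgue \<Otimes>\<^sub>M borel \<rightarrow>\<^sub>M (borel :: 'n measure)"
          by (rule measurable_compose[OF measurable_fst]) measurable
        moreover have "(\<lambda>z. snd z) \<in> lebesgue \<Otimes>\<^sub>M borel \<rightarrow>\<^sub>M (borel :: 'n measure)" by measurable
        ultimately have [measurable]: "(\<lambda>z. f (fst z - snd z)) \<in> borel_measurable (lebesgue \<Otimes>\<^sub>M borel)"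
          by (intro measurable_compose[OF _ fm] borel_measurable_diff)
        have "(\<lambda>(x, z). g2 x z) \<in> borel_measurable (lebesgue \<Otimes>\<^sub>M (borel :: 'n measure))"
          unfolding g2_def case_prod_beta by measurable
        moreover have se: "sets (lebesgue \<Otimes>\<^sub>M N2) = sets (lebesgue \<Otimes>\<^sub>M (borel :: 'n measure))"
          by (intro sets_pair_measure_cong) (auto simp: N2_def)
        ultimately show ?thesis by (subst measurable_cong_sets[OF se refl])
      qed
      have g2_0: "0 \<le> g2 x z" for x z by (simp add: g2_def)
      have B: "0 \<le> B" "Lnorm q f \<le> ennreal B" using real by auto
      have g2_L: "Lnorm q (\<lambda>x. of_real (g2 x z)) \<le> ennreal B" for z
        unfolding g2_def by (rule Lnorm_translate[OF fm q0 B])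
      define I2 where "I2 x = (\<integral>\<^sup>+ z. ennreal (g2 x z powr s) \<partial>N2)" for x
      define F where "F x = enn2real (I2 x) powr (1 / s)" for x
      note LF = Lnorm_integral_powr[OF s1 sq fN2 M2 g2_m g2_0 B(1) g2_L, folded I2_def, folded F_def]
      have F0: "0 \<le> F x" for x by (simp add: F_def)
      \<comment> \<open>Finiteness matters because \<open>enn2real\<close> sends infinity to 0: only
        where \<open>I1\<close> and \<open>I2\<close> are finite do \<open>A x\<close> and
        \<open>F x\<close> represent the true masses.\<close>
      have pt: "norm (psido a f x) \<le> K' * A x * F x" if x: "I1 x < top" "I2 x < top" for x
      proof -
        have I2: "I2 x = ennreal (F x powr s)" using x s1 by (simp add: F_def powr_powr)
        have Hj: "power_mass s (weighted_shift \<rho> j f x)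
            \<le> ennreal ((2 powr (- real j * (\<sigma> + \<delta>)) * F x) powr s)" for j
        proof -
          have "power_mass s (weighted_shift \<rho> j f x)
            \<le> (\<integral>\<^sup>+ z. ennreal ((2 powr (- real j * (\<sigma> + \<delta>))) powr s) * (W z * ennreal (g2 x z powr s)) \<partial>lborel)"
          proof (rule nn_integral_mono)
            fix z :: 'n
            define y where "y = wt (2 powr (real j * \<rho>)) z"
            have y: "y \<ge> 1" unfolding y_def by (rule wt_ge_one) simp
            define e where "e = 2 powr (real j * (\<sigma> + \<delta>))"
            have e: "e > 0" "2 powr (- real j * (\<sigma> + \<delta>)) = 1 / e"
              by (auto simp: e_def powr_minus_divide[symmetric])
            have "norm (f (x - z)) / y = (1 / e) * ((e / y) * g2 x z)" using e by (simp add: g2_def)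
            then have "(norm (f (x - z)) / y) powr s = ((1 / e) * ((e / y) * g2 x z)) powr s" by (rule arg_cong)
            also have "\<dots> = (1 / e) powr s * (w j z * g2 x z powr s)"
              unfolding w_def y_def[symmetric] e_def[symmetric] by (simp only: powr_mult)
            finally have "ennreal ((norm (f (x - z)) / y) powr s) = ennreal ((1 / e) powr s) * (ennreal (w j z) * ennreal (g2 x z powr s))"
              by (simp add: ennreal_mult w_def)
            also have "\<dots> \<le> ennreal ((1 / e) powr s) * (W z * ennreal (g2 x z powr s))"
            proof (intro mult_left_mono mult_right_mono)
              have "ennreal (w j z) = (\<Sum>i\<in>{j}. ennreal (w i z))" by simp
              also have "\<dots> \<le> W z" unfolding W_def by (rule sum_le_suminf) auto
              finally show "ennreal (w j z) \<le> W z" .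
            qed auto
            finally show "ennreal ((norm (f (x - z)) / wt (2 powr (real j * \<rho>)) z) powr s)
              \<le> ennreal ((2 powr (- real j * (\<sigma> + \<delta>))) powr s) * (W z * ennreal (g2 x z powr s))"
              unfolding y_def e(2) .
          qed
          also have "\<dots> = ennreal ((2 powr (- real j * (\<sigma> + \<delta>))) powr s) * I2 x"
            unfolding I2_def N2_def g2_def by (subst nn_integral_density, measurable, rule nn_integral_cmult) measurable
          also have "\<dots> = ennreal ((2 powr (- real j * (\<sigma> + \<delta>)) * F x) powr s)"
            unfolding I2 by (simp only: ennreal_mult[symmetric] powr_ge_zero powr_mult)
          finally show ?thesis .
        qed
        have fin1: "power_mass s (weighted_msize \<rho> \<sigma> (a x)) < \<infinity>"
          unfolding A_le[OF x(1)] by simp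
        obtain b0 :: 'n where b0: "b0 \<in> Basis" using nonempty_Basis by blast
        have ax: "a x \<in> borel_measurable borel"
          using borel_measurable_continuous_onI[OF continuous_on_dpart[OF sm[of x], of "[]"]] by simp
        have "norm (LINT \<xi>|lebesgue. a x \<xi> * cis (x \<bullet> \<xi>) * fourier f \<xi>) \<le> (K * A x * F x) / (1 - rr)"
        proof (rule psido_le_of_dyadic[OF ax f L _ _ rr])
          fix j
          show "integrable lborel (\<lambda>\<xi>. a x \<xi> * dycut L j (of_real (jbr \<xi> ^ 2)))"
            using integrable_piece[OF sm[of x] b0 L \<rho> s1 _ L\<sigma> fin1, of 0 j] unfolding piece_0[abs_def] by simp
          have "norm (dyadic_psido L j (a x) f x)
            \<le> K * 2 powr (real j * \<sigma>) * A x * (2 powr (- real j * (\<sigma> + \<delta>)) * F x)"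
            by (rule K(2)[OF sm f A0 _ eq_refl[OF A_le[OF x(1)]] Hj]) (use F0 in simp)
          also have "\<dots> = K * A x * F x * (2 powr (real j * \<sigma>) * 2 powr (- real j * (\<sigma> + \<delta>)))"
            by (simp only: mult_ac)
          also have "2 powr (real j * \<sigma>) * 2 powr (- real j * (\<sigma> + \<delta>)) = rr ^ j"
            unfolding powr_add[symmetric] rr_def by (simp add: powr_realpow[symmetric] powr_powr algebra_simps)
          finally show "norm (dyadic_psido L j (a x) f x)
            \<le> K * A x * F x * rr ^ j" .
        next
          show "0 \<le> K * A x * F x" using K(1) A0 F0 by simp
        qed
        then show ?thesis by (simp add: psido_def K'_def)
      qed
      have "AE x in lebesgue. norm (psido a f x) \<le> norm (complex_of_real ((K' * A x) * F x))"
        using LA(1) LF(1)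
      proof eventually_elim
        case (elim x)
        have "norm (complex_of_real ((K' * A x) * F x)) = K' * A x * F x"
          unfolding norm_of_real using K' A0[of x] F0[of x] by simp
        then show ?case using pt[OF elim] by simp
      qed
      then have "Lnorm r (psido a f) \<le> Lnorm r (\<lambda>x. of_real ((K' * A x) * F x))"
        using r0 by (rule Lnorm_mono_AE)
      also have "\<dots> \<le> ennreal ((K' * (M1 powr (1 / s) * B1)) * (M2 powr (1 / s) * B))"
      proof (rule Lnorm_Hoelder[OF p0 q0 r0 pqr _ LF(3)])
        show "(\<lambda>x. K' * A x) \<in> borel_measurable lebesgue"
          using LA(3) by (intro borel_measurable_times borel_measurable_const)
        have "Lnorm p (\<lambda>x. of_real K' * of_real (A x)) \<le> ennreal (K' * (M1 powr (1 / s) * B1))"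
          using LA(3) B1(1) by (intro Lnorm_scale[OF p0 K' _ LA(2)] borel_measurable_of_real) auto
        then show "Lnorm p (\<lambda>x. of_real (K' * A x)) \<le> ennreal (K' * (M1 powr (1 / s) * B1))" by simp
        show "Lnorm q (\<lambda>x. of_real (F x)) \<le> ennreal (M2 powr (1 / s) * B)" by (rule LF(2))
      qed (use K' A0 F0 B1(1) B(1) in auto)
      also have "\<dots> = ennreal (Ct * B)" by (simp add: Ct_def mult_ac)
      also have "\<dots> \<le> ennreal ((Ct + 1) * B)" using B(1) by (intro ennreal_leI mult_right_mono) auto
      also have "\<dots> = ennreal (Ct + 1) * Lnorm q f" unfolding real(2) using Ct B(1) by (intro ennreal_mult) auto
      finally show ?thesis .
    qed
  qed
qed

lemma smooth_fun_zero: "smooth_fun (\<lambda>x::'n::euclidean_space. 0)"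
proof -
  have "dpart ds (\<lambda>x::'n. 0) = (\<lambda>x. 0)" for ds
    by (induction ds) (simp_all add: pdir_def[abs_def])
  then show ?thesis by (simp add: smooth_fun_def)
qed

theorem theorem4p10:
  fixes a :: "'n::euclidean_space \<Rightarrow> 'n \<Rightarrow> complex"
    and p q r :: ennreal and m \<rho> :: real
  assumes "0 < r" and "1 \<le> p" and "1 \<le> q"
    and "inverse r = inverse q + inverse p"
    and "0 \<le> \<rho>" and "\<rho> \<le> 1"
    and "LpS p m \<rho> a"
    and "m < real DIM('n) * (\<rho> - 1) / enn2real (min 2 (min p q))"
  shows "\<exists>C::real. \<forall>f. schwartz f \<longrightarrow> Lnorm r (psido a f) \<le> ennreal C * Lnorm q f"
proof -
  have am: "\<And>\<xi>. (\<lambda>x. a x \<xi>) \<in> borel_measurable lebesgue" and sm: "AE x in lebesgue. smooth_fun (a x)"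
    and bd: "\<And>ds. set ds \<subseteq> Basis \<Longrightarrow> \<exists>C::real. \<forall>\<xi>. Lnorm p (\<lambda>x. dpart ds (a x) \<xi>) \<le> ennreal (C * jbr \<xi> powr (m - \<rho> * real (length ds)))"
    using assms(7) by (auto simp: LpS_def)
  have p0: "0 < p" using assms(2) by (meson less_le_trans zero_less_one)
  \<comment> \<open>\<open>a\<close> is replaced by \<open>0\<close> on a null set, after which it is smooth for every \<open>x\<close>.\<close>
  obtain Z where Z: "{x \<in> space lebesgue. \<not> smooth_fun (a x)} \<subseteq> Z" "Z \<in> null_sets lebesgue"
    using sm unfolding eventually_ae_filter by blast
  define a' where "a' x = (if x \<in> Z then (\<lambda>\<xi>. 0) else a x)" for x
  have Zs [measurable]: "Z \<in> sets lebesgue" using Z by auto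
  have AEZ: "AE x in lebesgue. x \<notin> Z" using Z(2) by (rule AE_not_in)
  have "\<exists>C::real. \<forall>f. schwartz f \<longrightarrow> Lnorm r (psido a' f) \<le> ennreal C * Lnorm q f"
  proof (rule psido_bound_smooth[OF assms(1-6) _ _ _ assms(8)])
    show "smooth_fun (a' x)" for x using Z(1) by (auto simp: a'_def smooth_fun_zero)
    show "(\<lambda>x. a' x \<xi>) \<in> borel_measurable lebesgue" for \<xi>
    proof -
      have "(\<lambda>x. a' x \<xi>) = (\<lambda>x. if x \<in> Z then 0 else a x \<xi>)" by (auto simp: a'_def)
      then show ?thesis using am[of \<xi>] by (simp add: measurable_If_set)
    qed
    fix ds :: "'n list" assume ds: "set ds \<subseteq> Basis"
    have "Lnorm p (\<lambda>x. dpart ds (a' x) \<xi>) \<le> Lnorm p (\<lambda>x. dpart ds (a x) \<xi>)" for \<xi>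
      by (rule Lnorm_mono_AE[OF _ p0], rule AE_mp[OF AEZ]) (auto simp: a'_def)
    then show "\<exists>C::real. \<forall>\<xi>. Lnorm p (\<lambda>x. dpart ds (a' x) \<xi>) \<le> ennreal (C * jbr \<xi> powr (m - \<rho> * real (length ds)))"
      using bd[OF ds] by (meson order_trans)
  qed
  moreover have "Lnorm r (psido a f) \<le> Lnorm r (psido a' f)" for f
    by (rule Lnorm_mono_AE[OF _ assms(1)], rule AE_mp[OF AEZ]) (auto simp: psido_def a'_def)
  ultimately show ?thesis by (meson order_trans)
qed

end
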